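(* Let $t\in\mathbb{R}$, let $r>0$, $R>0$, and let $n_0\ge 1$ be an integer. Let $\Phi_t$ be the time-$t$ flow map on $H^{1/2}_0(\mathbb{T})$ of the BBM equation $u_t+u_x+uu_x-u_{txx}=0$, $x\in\mathbb{T}$. Set $$B_r=\left\{u\in H^{1/2}_0(\mathbb{T}) : \|u\|_{H^{1/2}}<r\right\},$$ $$\mathcal{C}_{R,n_0}=\left\{u=\sum_{n\ge1}\left(p_n\varphi_n^+ + q_n\varphi_n^-\right)\in H^{1/2}_0(\mathbb{T}) : p_{n_0}^2+q_{n_0}^2<R^2\right\}.$$ If $\Phi_t(B_r)\subset\mathcal{C}_{R,n_0}$, then $r\le R$.
   Context: $\mathbb{T}=\mathbb{R}/2\pi\mathbb{Z}$; functions are real-valued. $H^{1/2}_0(\mathbb{T})=\{u\in H^{1/2}(\mathbb{T}) : \int_{\mathbb{T}}u=0\}$ is equipped with the Hilbert norm (equivalent to the usual $H^{1/2}$ norm, and denoted $\|\cdot\|_{H^{1/2}}$ here) for which the functions $$\varphi_n^{+}(x)=\sqrt{\frac{n}{\pi(n^2+1)}}\cos(nx),\qquad \varphi_n^{-}(x)=\sqrt{\frac{n}{\pi(n^2+1)}}\sin(nx),\qquad n\ge1,$$ form a Hilbert (orthonormal) basis; that is, $\left\|\sum_n (p_n\varphi_n^++q_n\varphi_n^-)\right\|_{H^{1/2}}^2=\sum_n(p_n^2+q_n^2)$. The BBM equation $u_t+u_x+uu_x-u_{txx}=0$ with $u(0,\cdot)=u_0$ is understood as $u_t=-\partial_x(1-\partial_x^2)^{-1}\left(u+\tfrac{u^2}{2}\right)$,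 or equivalently in its integral form $$u(t)=e^{-it\varphi(D)}u_0-\frac{i}{2}\int_0^t e^{-i(t-\tau)\varphi(D)}\varphi(D)\left(u(\tau)^2\right)d\tau,$$ where $\varphi(k)=\frac{k}{1+k^2}$ and $\varphi(D)$ is the Fourier multiplier $\widehat{\varphi(D)u}(k)=\varphi(k)\widehat{u}(k)$. The equation is globally well-posed in $H^{s}(\mathbb{T})$ for $s\ge0$, and the mean $\int_{\mathbb{T}}u$ is conserved. For $u_0\in H^{1/2}_0(\mathbb{T})$, $\Phi_t(u_0)=u(t)$, where $u\in C^0(\mathbb{R},H^{1/2}(\mathbb{T}))$ is the unique solution with initial data $u_0$. *)

theory Defs
  imports "HOL-Analysis.Analysis"
begin

text \<open>
  Functions on the circle of length \<open>2 * pi\<close> are represented by \<open>2 * pi\<close>-periodic functions on the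
  real line; as usual two of them stand for the same element of \<open>L\<^sup>2\<close> when they agree almost
  everywhere.  No quotient is formed: every notion below depends only on the class of a function.
\<close>

definition L2_torus :: "(real \<Rightarrow> real) set" where
  "L2_torus = {u. u \<in> borel_measurable borel \<and> (\<forall>x. u (x + 2 * pi) = u x) \<and>
     set_integrable lborel {0..2 * pi} (\<lambda>x. (u x)\<^sup>2)}"

definition fourier :: "(real \<Rightarrow> real) \<Rightarrow> int \<Rightarrow> complex" where
  "fourier u k = (LINT x:{0..2 * pi}|lborel. complex_of_real (u x) * cis (- (of_int k * x)))
     / complex_of_real (2 * pi)"

definition sobolev :: "real \<Rightarrow> (real \<Rightarrow> real) set" where
  "sobolev s = {u \<in> L2_torus.
     (\<lambda>k::int. (1 + (of_int k)\<^sup>2) powr s * (cmod (fourier u k))\<^sup>2) summable_on UNIV}"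

text \<open>The usual norm; it is meaningful on \<^term>\<open>sobolev s\<close> for \<open>s \<ge> 0\<close> only.\<close>

definition sobolev_norm :: "real \<Rightarrow> (real \<Rightarrow> real) \<Rightarrow> real" where
  "sobolev_norm s u =
     sqrt (\<Sum>\<^sub>\<infinity>k::int. (1 + (of_int k)\<^sup>2) powr s * (cmod (fourier u k))\<^sup>2)"

definition H_half_0 :: "(real \<Rightarrow> real) set" where
  "H_half_0 = {u \<in> sobolev (1/2). (LINT x:{0..2 * pi}|lborel. u x) = 0}"

definition phi_plus :: "nat \<Rightarrow> real \<Rightarrow> real" where
  "phi_plus n x = sqrt (real n / (pi * ((real n)\<^sup>2 + 1))) * cos (real n * x)"

definition phi_minus :: "nat \<Rightarrow> real \<Rightarrow> real" where
  "phi_minus n x = sqrt (real n / (pi * ((real n)\<^sup>2 + 1))) * sin (real n * x)"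

text \<open>
  \<open>u = (\<Sum>n\<ge>1. p n * phi_plus n + q n * phi_minus n)\<close>, with convergence in the usual norm of
  \<open>H\<^bsup>1/2\<^esup>\<close>.  The values \<open>p 0\<close> and \<open>q 0\<close> are irrelevant; the others are determined by \<open>u\<close>.
\<close>

definition has_expansion :: "(real \<Rightarrow> real) \<Rightarrow> (nat \<Rightarrow> real) \<Rightarrow> (nat \<Rightarrow> real) \<Rightarrow> bool" where
  "has_expansion u p q \<longleftrightarrow> u \<in> H_half_0 \<and>
     (\<lambda>N. sobolev_norm (1/2)
        (\<lambda>x. u x - (\<Sum>n=1..N. p n * phi_plus n x + q n * phi_minus n x))) \<longlonglongrightarrow> 0"

text \<open>
  The equivalent norm on \<^term>\<open>H_half_0\<close> for which the functions \<^term>\<open>phi_plus n\<close> and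
  \<^term>\<open>phi_minus n\<close>, \<open>n \<ge> 1\<close>, form a Hilbert basis.
\<close>

definition H_norm :: "(real \<Rightarrow> real) \<Rightarrow> real" where
  "H_norm u = sqrt (THE s. \<exists>p q. has_expansion u p q \<and>
     (\<lambda>n. (p (Suc n))\<^sup>2 + (q (Suc n))\<^sup>2) sums s)"

definition H_ball :: "real \<Rightarrow> (real \<Rightarrow> real) set" where
  "H_ball r = {u \<in> H_half_0. H_norm u < r}"

definition H_cylinder :: "real \<Rightarrow> nat \<Rightarrow> (real \<Rightarrow> real) set" where
  "H_cylinder R n0 =
     {u \<in> H_half_0. \<exists>p q. has_expansion u p q \<and> (p n0)\<^sup>2 + (q n0)\<^sup>2 < R\<^sup>2}"

definition bbm_symbol :: "int \<Rightarrow> real" where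
  "bbm_symbol k = of_int k / (1 + (of_int k)\<^sup>2)"

text \<open>
  \<open>u \<in> C\<^sup>0(\<real>, H\<^bsup>1/2\<^esup>)\<close> solves the integral form
  \<open>u(t) = exp (-i t \<phi>(D)) u0 - i/2 \<integral>\<^sub>0\<^sup>t exp (-i (t-\<tau>) \<phi>(D)) \<phi>(D) (u(\<tau>)\<^sup>2) d\<tau>\<close>
  of the BBM equation.  Being an identity in \<open>L\<^sup>2\<close> between Fourier multipliers, it is
  written on each Fourier mode.  At \<open>t = 0\<close> it gives the initial condition \<open>u(0) = u0\<close>.
\<close>

definition bbm_solution :: "(real \<Rightarrow> real) \<Rightarrow> (real \<Rightarrow> real \<Rightarrow> real) \<Rightarrow> bool" where
  "bbm_solution u0 u \<longleftrightarrow>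
     (\<forall>t. u t \<in> sobolev (1/2)) \<and>
     (\<forall>t. ((\<lambda>s. sobolev_norm (1/2) (\<lambda>x. u s x - u t x)) \<longlongrightarrow> 0) (at t)) \<and>
     (\<forall>t k. fourier (u t) k =
        cis (- (t * bbm_symbol k)) * fourier u0 k
        - \<i> / 2 * (LBINT \<tau>=ereal 0..ereal t.
            cis (- ((t - \<tau>) * bbm_symbol k)) *
            (complex_of_real (bbm_symbol k) * fourier (\<lambda>x. (u \<tau> x)\<^sup>2) k)))"

text \<open>
  By global well-posedness the solution exists and is unique up to equality almost everywhere
  at each time, so the choice only selects a representative.
\<close>

definition bbm_flow :: "real \<Rightarrow> (real \<Rightarrow> real) \<Rightarrow> real \<Rightarrow> real" where
  "bbm_flow t u0 = (SOME u. bbm_solution u0 u) t"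

end

theory Submission
  imports Defs "HOL-Probability.Discrete_Topology"
begin

text \<open>
  Writing \<open>e n\<close> for the contribution of the modes \<open>n\<close> and \<open>- n\<close> to the \<open>H\<^sup>1\<close> energy
  \<open>\<integral> u\<^sup>2 + u\<^sub>x\<^sup>2\<close>, the squared norm of \<open>H_half_0\<close> is, up to a constant factor,
  \<open>(\<Sum>n\<ge>1. e n / n)\<close>, while \<open>(\<Sum>n\<ge>1. e n)\<close> is conserved by the BBM flow.  The functions of period \<open>2 * pi / n0\<close> are
  invariant under the flow as well, and for them \<open>(\<Sum>n\<ge>1. e n / n) \<le> (\<Sum>n\<ge>1. e n) / n0\<close>, with equality
  for a pure mode \<open>n0\<close>.  Hence, running the flow backwards from a pure mode \<open>n0\<close> of norm \<open>R\<close> at time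
  \<open>t\<close>, one obtains initial data of norm at most \<open>R\<close> whose solution at time \<open>t\<close> lies on the boundary
  of the cylinder of radius \<open>R\<close>.  So if \<open>R < r\<close>, the ball of radius \<open>r\<close> is not mapped into the
  cylinder; no symplectic topology is needed.
\<close>

section \<open>Square summable sequences and convolution\<close>

text \<open>\<open>bbm_flow\<close> is a choice among all solutions, so nothing is known about it
  until a solution with the chosen data is exhibited and every solution is shown to have the same
  Fourier coefficients. For existence the equation is treated as an ODE for coefficient sequences
  bounded by a multiple of \<open>1 / wt k\<close>, with the quadratic term cut off so that a single
  contraction covers all times. The obstacle is the energy: its conservation rests on reordering a
  triple sum, and decay like \<open>1 / wt k\<close> does not make that sum absolutely convergent.
  One application of the equation improves the decay of increments in time to
  \<open>wt k powr (-7/4)\<close>: one power comes from \<open>bbm_symbol\<close>, 3/4 from the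
  convolution. Data with this decay keep it, and a pure mode has it trivially. Uniqueness must cover
  arbitrary competitors that are merely continuous into H^{1/2}; it is proved in L^2, and this is
  why Parseval's identity is established.\<close>

lemma summable_on_int_abs:
  fixes f :: "nat \<Rightarrow> real"
  assumes "summable f" "\<And>n. 0 \<le> f n"
  shows "(\<lambda>k::int. f (nat \<bar>k\<bar>)) summable_on UNIV"
proof -
  have f: "f summable_on UNIV" using assms by (simp add: summable_on_UNIV_nonneg_real_iff)
  have p: "(\<lambda>k::int. f (nat \<bar>k\<bar>)) summable_on {0..}"
    by (rule summable_on_reindex_bij_witness[where i=int and j=nat and h=f, THEN iffD2, OF _ _ _ _ _ f]) auto
  have n: "(\<lambda>k::int. f (nat \<bar>k\<bar>)) summable_on {..0}"
    by (rule summable_on_reindex_bij_witness[where i="\<lambda>n. - int n" and j="\<lambda>k. nat (-k)" and h=f, THEN iffD2, OF _ _ _ _ _ f]) auto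
  have "(UNIV::int set) = {0..} \<union> {..0}" by auto
  with summable_on_union[OF p n] show ?thesis by simp
qed

lemma summable_on_int_powr:
  fixes s :: real
  assumes "s < -1"
  shows "(\<lambda>k::int. (1 + \<bar>of_int k\<bar>) powr s) summable_on UNIV"
proof -
  have "summable (\<lambda>n. real (Suc n) powr s)"
    using assms by (subst summable_Suc_iff) (simp only: summable_real_powr_iff)
  then have "(\<lambda>k::int. real (Suc (nat \<bar>k\<bar>)) powr s) summable_on UNIV"
    by (rule summable_on_int_abs) auto
  moreover have "real (Suc (nat \<bar>k\<bar>)) = 1 + \<bar>of_int k\<bar>" for k :: int by simp
  ultimately show ?thesis by simp
qed

text \<open>Symmetric windows are cofinal among the finite sets of integers, so the unordered sum is
  also their limit. This turns a summable majorant into an explicit null sequence of error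
  bounds.\<close>

lemma summable_on_int_tail:
  fixes f :: "int \<Rightarrow> real"
  assumes "f summable_on UNIV"
  shows "(\<lambda>N. infsum f UNIV - (\<Sum>k\<in>{-int N..int N}. f k)) \<longlonglongrightarrow> 0"
proof -
  have "(sum f \<longlongrightarrow> infsum f UNIV) (finite_subsets_at_top UNIV)"
    using assms infsum_tendsto by blast
  moreover have "filterlim (\<lambda>N. {-int N..int N}) (finite_subsets_at_top UNIV) sequentially"
    unfolding filterlim_finite_subsets_at_top
  proof (intro allI impI)
    fix X :: "int set" assume "finite X \<and> X \<subseteq> UNIV"
    then have "finite X" by simp
    define M where "M = Max (abs ` X)"
    have M: "\<bar>x\<bar> \<le> M" if "x \<in> X" for x
      unfolding M_def using \<open>finite X\<close> that by (intro Max_ge) auto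
    show "\<forall>\<^sub>F N in sequentially. finite {- int N..int N} \<and> X \<subseteq> {- int N..int N} \<and> {- int N..int N} \<subseteq> UNIV"
      using eventually_ge_at_top[of "nat M"]
    proof eventually_elim
      case (elim N)
      have "x \<in> {- int N..int N}" if "x \<in> X" for x using M[OF that] elim by auto
      then show ?case by auto
    qed
  qed
  ultimately have "(\<lambda>N. sum f {-int N..int N}) \<longlonglongrightarrow> infsum f UNIV"
    by (rule filterlim_compose)
  from tendsto_diff[OF tendsto_const[of "infsum f UNIV"] this] show ?thesis by simp
qed

text \<open>Both differences are sums over the complement of \<open>F\<close>, where the majorant
  applies termwise. The bound depends on \<open>g\<close> only, hence is uniform in any parameter
  hidden in \<open>f\<close>.\<close>

lemma infsum_int_tail_le:
  fixes f :: "int \<Rightarrow> complex" and g :: "int \<Rightarrow> real"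
  assumes g: "g summable_on UNIV" and fg: "\<And>k. cmod (f k) \<le> g k" and F: "finite F"
  shows "cmod (infsum f UNIV - (\<Sum>k\<in>F. f k)) \<le> infsum g UNIV - (\<Sum>k\<in>F. g k)"
proof -
  have f: "f summable_on UNIV"
    by (rule abs_summable_summable, rule Infinite_Sum.abs_summable_on_comparison_test'[OF g fg])
  have 1: "(f has_sum (infsum f UNIV - sum f F)) (UNIV - F)"
    using has_sum_Diff[OF has_sum_infsum[OF f] has_sum_finite[OF F]] by simp
  have 2: "(g has_sum (infsum g UNIV - sum g F)) (UNIV - F)"
    using has_sum_Diff[OF has_sum_infsum[OF g] has_sum_finite[OF F]] by simp
  show ?thesis by (rule norm_infsum_le[OF 1 2]) (use fg in auto)
qed

definition sq_summable :: "(int \<Rightarrow> complex) \<Rightarrow> bool" where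
  "sq_summable a \<longleftrightarrow> (\<lambda>k. (cmod (a k))\<^sup>2) summable_on UNIV"

text \<open>Without \<open>sq_summable\<close> the \<open>infsum\<close> is 0 by convention, so a
  bound on \<open>l2_norm\<close> carries information only together with summability.\<close>

definition l2_norm :: "(int \<Rightarrow> complex) \<Rightarrow> real" where
  "l2_norm a = sqrt (\<Sum>\<^sub>\<infinity>k. (cmod (a k))\<^sup>2)"

lemma l2_norm_nonneg [simp]: "0 \<le> l2_norm a"
  unfolding l2_norm_def by (simp add: infsum_nonneg)

lemma l2_norm_sq: "(l2_norm a)\<^sup>2 = (\<Sum>\<^sub>\<infinity>k. (cmod (a k))\<^sup>2)"
  unfolding l2_norm_def by (simp add: infsum_nonneg)

lemma L2_set_le_l2_norm:
  assumes "sq_summable a" "finite F"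
  shows "L2_set (\<lambda>k. cmod (a k)) F \<le> l2_norm a"
  unfolding L2_set_def l2_norm_def
  using assms by (auto simp: sq_summable_def intro!: finite_sum_le_infsum)

text \<open>Bounds on all finite sections suffice. In this way the triangle inequality and
  monotonicity are inherited from \<open>L2_set\<close>, and an energy bound later yields an
  \<open>l2_norm\<close> bound.\<close>

lemma sq_summableI_bounded:
  assumes "\<And>F. finite F \<Longrightarrow> L2_set (\<lambda>k. cmod (a k)) F \<le> c"
  shows "sq_summable a" "l2_norm a \<le> c"
proof -
  have c: "0 \<le> c" using assms[of "{}"] by simp
  have b: "(\<Sum>k\<in>F. (cmod (a k))\<^sup>2) \<le> c\<^sup>2" if "finite F" for F
  proof -
    have "sqrt (\<Sum>k\<in>F. (cmod (a k))\<^sup>2) \<le> c" using assms[OF that] by (simp add: L2_set_def)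
    then show ?thesis by (rule sqrt_le_D)
  qed
  show s: "sq_summable a" unfolding sq_summable_def
    by (rule nonneg_bdd_above_summable_on) (use b in \<open>auto intro!: bdd_aboveI2\<close>)
  show "l2_norm a \<le> c"
    unfolding l2_norm_def
    by (rule real_le_lsqrt[OF c])
       (use s b in \<open>auto simp: sq_summable_def intro!: infsum_le_finite_sums\<close>)
qed

lemma l2_norm_add:
  assumes "sq_summable a" "sq_summable b"
  shows "sq_summable (\<lambda>k. a k + b k)" "l2_norm (\<lambda>k. a k + b k) \<le> l2_norm a + l2_norm b"
proof -
  have "L2_set (\<lambda>k. cmod (a k + b k)) F \<le> l2_norm a + l2_norm b" if "finite F" for F
  proof -
    have "L2_set (\<lambda>k. cmod (a k + b k)) F \<le> L2_set (\<lambda>k. cmod (a k) + cmod (b k)) F"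
      by (rule L2_set_mono) (auto simp: norm_triangle_ineq)
    also have "\<dots> \<le> L2_set (\<lambda>k. cmod (a k)) F + L2_set (\<lambda>k. cmod (b k)) F"
      by (rule L2_set_triangle_ineq)
    also have "\<dots> \<le> l2_norm a + l2_norm b"
      using L2_set_le_l2_norm assms that by (intro add_mono) auto
    finally show ?thesis .
  qed
  then show "sq_summable (\<lambda>k. a k + b k)" "l2_norm (\<lambda>k. a k + b k) \<le> l2_norm a + l2_norm b"
    by (rule sq_summableI_bounded; blast)+
qed

lemma l2_norm_mult:
  assumes "sq_summable a"
  shows "sq_summable (\<lambda>k. c * a k)" "l2_norm (\<lambda>k. c * a k) = cmod c * l2_norm a"
proof -
  show "sq_summable (\<lambda>k. c * a k)"
    using assms unfolding sq_summable_def by (auto simp: norm_mult power_mult_distrib intro: summable_on_cmult_right)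
  show "l2_norm (\<lambda>k. c * a k) = cmod c * l2_norm a"
    unfolding l2_norm_def by (simp add: norm_mult power_mult_distrib infsum_cmult_right' real_sqrt_mult)
qed

lemma l2_norm_minus_commute: "l2_norm (\<lambda>k. a k - b k) = l2_norm (\<lambda>k. b k - a k)"
  unfolding l2_norm_def by (subst norm_minus_commute) (rule refl)

lemma l2_norm_diff:
  assumes "sq_summable a" "sq_summable b"
  shows "sq_summable (\<lambda>k. a k - b k)" "l2_norm (\<lambda>k. a k - b k) \<le> l2_norm a + l2_norm b"
  using l2_norm_add[OF assms(1) l2_norm_mult(1)[OF assms(2), of "-1"]] l2_norm_mult(2)[OF assms(2), of "-1"]
  by auto

lemma l2_norm_triangle_abs:
  assumes "sq_summable a" "sq_summable b"
  shows "\<bar>l2_norm a - l2_norm b\<bar> \<le> l2_norm (\<lambda>k. a k - b k)"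
proof -
  have "l2_norm a \<le> l2_norm (\<lambda>k. a k - b k) + l2_norm b"
    using l2_norm_add(2)[OF l2_norm_diff(1)[OF assms] assms(2)] by simp
  moreover have "l2_norm b \<le> l2_norm (\<lambda>k. a k - b k) + l2_norm a"
    using l2_norm_add(2)[OF l2_norm_diff(1)[OF assms(2,1)] assms(1)]
    unfolding l2_norm_minus_commute[of a b] by simp
  ultimately show ?thesis by linarith
qed

lemma l2_norm_mono:
  assumes b: "sq_summable b" and c: "0 \<le> c" and ab: "\<And>k. cmod (a k) \<le> c * cmod (b k)"
  shows "sq_summable a" "l2_norm a \<le> c * l2_norm b"
proof -
  have "L2_set (\<lambda>k. cmod (a k)) F \<le> c * l2_norm b" if "finite F" for F
  proof -
    have "L2_set (\<lambda>k. cmod (a k)) F \<le> L2_set (\<lambda>k. c * cmod (b k)) F"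
      by (rule L2_set_mono) (use ab in auto)
    also have "\<dots> = c * L2_set (\<lambda>k. cmod (b k)) F" using c by (simp add: L2_set_right_distrib)
    also have "\<dots> \<le> c * l2_norm b" using c b that by (intro mult_left_mono L2_set_le_l2_norm)
    finally show ?thesis .
  qed
  then show "sq_summable a" "l2_norm a \<le> c * l2_norm b"
    by (rule sq_summableI_bounded; blast)+
qed

lemma l2_Cauchy_Schwarz:
  assumes "sq_summable a" "sq_summable b"
  shows "(\<lambda>k. cmod (a k * b k)) summable_on UNIV" "(\<Sum>\<^sub>\<infinity>k. cmod (a k * b k)) \<le> l2_norm a * l2_norm b"
proof -
  have b: "(\<Sum>k\<in>F. cmod (a k * b k)) \<le> l2_norm a * l2_norm b" if "finite F" for F
  proof -
    have "(\<Sum>k\<in>F. cmod (a k * b k)) \<le> L2_set (\<lambda>k. cmod (a k)) F * L2_set (\<lambda>k. cmod (b k)) F"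
      using L2_set_mult_ineq[of "\<lambda>k. cmod (a k)" "\<lambda>k. cmod (b k)" F] by (simp add: norm_mult)
    also have "\<dots> \<le> l2_norm a * l2_norm b"
      using assms that by (intro mult_mono L2_set_le_l2_norm) auto
    finally show ?thesis .
  qed
  show s: "(\<lambda>k. cmod (a k * b k)) summable_on UNIV"
    by (rule nonneg_bdd_above_summable_on) (use b in \<open>auto intro!: bdd_aboveI2\<close>)
  show "(\<Sum>\<^sub>\<infinity>k. cmod (a k * b k)) \<le> l2_norm a * l2_norm b"
    by (rule infsum_le_finite_sums[OF s]) (use b in auto)
qed

section \<open>Convolution over the integers\<close>

lemma bij_int_reflect: "bij (\<lambda>j::int. k - j)"
  by (rule bij_betw_byWitness[where f'="\<lambda>j. k - j"]) auto

lemma sq_summable_reflect: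
  assumes "sq_summable a"
  shows "sq_summable (\<lambda>j. a (k - j))" "l2_norm (\<lambda>j. a (k - j)) = l2_norm a"
  using assms summable_on_reindex_bij_betw[OF bij_int_reflect[of k], of "\<lambda>k. (cmod (a k))\<^sup>2"]
    infsum_reindex_bij_betw[OF bij_int_reflect[of k], of "\<lambda>k. (cmod (a k))\<^sup>2"]
  by (auto simp: sq_summable_def l2_norm_def)

text \<open>The coefficients of a pointwise product; for the square of a \<open>trig_series\<close>
  this is \<open>fourier_trig_series_square\<close>.\<close>

definition conv :: "(int \<Rightarrow> complex) \<Rightarrow> (int \<Rightarrow> complex) \<Rightarrow> int \<Rightarrow> complex" where
  "conv a b k = (\<Sum>\<^sub>\<infinity>j. a j * b (k - j))"

lemma conv_abs_summable:
  assumes "sq_summable a" "sq_summable b"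
  shows "(\<lambda>j. cmod (a j * b (k - j))) summable_on UNIV"
  using l2_Cauchy_Schwarz(1)[OF assms(1) sq_summable_reflect(1)[OF assms(2)]] .

lemma conv_summable:
  assumes "sq_summable a" "sq_summable b"
  shows "(\<lambda>j. a j * b (k - j)) summable_on UNIV"
  using abs_summable_summable[OF conv_abs_summable[OF assms]] .

lemma conv_bound:
  assumes "sq_summable a" "sq_summable b"
  shows "cmod (conv a b k) \<le> l2_norm a * l2_norm b"
proof -
  have "cmod (conv a b k) \<le> (\<Sum>\<^sub>\<infinity>j. cmod (a j * b (k - j)))"
    unfolding conv_def using conv_abs_summable[OF assms] by (rule norm_infsum_bound)
  also have "\<dots> \<le> l2_norm a * l2_norm b"
    using l2_Cauchy_Schwarz(2)[OF assms(1) sq_summable_reflect(1)[OF assms(2)]]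
      sq_summable_reflect(2)[OF assms(2)] by metis
  finally show ?thesis .
qed

text \<open>With \<open>d = a - b\<close> the difference is \<open>conv d a + conv b d\<close>. The
  resulting Lipschitz constant is proportional to the size of the arguments, which is why a cutoff
  is introduced below.\<close>

lemma conv_self_diff_bound:
  assumes a: "sq_summable a" and b: "sq_summable b"
  shows "cmod (conv a a k - conv b b k) \<le> l2_norm (\<lambda>k. a k - b k) * (l2_norm a + l2_norm b)"
proof -
  let ?d = "\<lambda>k. a k - b k"
  have d: "sq_summable ?d" using l2_norm_diff a b by blast
  have "conv a a k - conv b b k = conv a a k + (\<Sum>\<^sub>\<infinity>j. - (b j * b (k - j)))"
    unfolding conv_def by (simp add: infsum_uminus)
  also have "\<dots> = (\<Sum>\<^sub>\<infinity>j. a j * a (k - j) + - (b j * b (k - j)))"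
    unfolding conv_def
    by (rule infsum_add[symmetric]) (intro conv_summable summable_on_uminus[THEN iffD2] a b)+
  also have "\<dots> = (\<Sum>\<^sub>\<infinity>j. ?d j * a (k - j) + b j * ?d (k - j))"
    by (simp add: algebra_simps)
  also have "\<dots> = conv ?d a k + conv b ?d k"
    unfolding conv_def using conv_summable[OF d a] conv_summable[OF b d]
    by (subst infsum_add) auto
  finally have "cmod (conv a a k - conv b b k) \<le> cmod (conv ?d a k) + cmod (conv b ?d k)"
    by (metis norm_triangle_ineq)
  also have "\<dots> \<le> l2_norm ?d * l2_norm a + l2_norm b * l2_norm ?d"
    by (intro add_mono conv_bound a b d)
  finally show ?thesis by (simp add: algebra_simps)
qed

lemma conv_mult: "conv (\<lambda>k. c * a k) (\<lambda>k. c * b k) k = c\<^sup>2 * conv a b k"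
proof -
  have "conv (\<lambda>k. c * a k) (\<lambda>k. c * b k) k = (\<Sum>\<^sub>\<infinity>j. c\<^sup>2 * (a j * b (k - j)))"
    unfolding conv_def by (simp add: power2_eq_square ac_simps)
  then show ?thesis unfolding conv_def by (simp only: infsum_cmult_right')
qed

text \<open>Counterpart of the fact that the square of a real function is real.\<close>

lemma conv_hermitian:
  assumes "\<And>k. a (-k) = cnj (a k)"
  shows "conv a a (-k) = cnj (conv a a k)"
proof -
  have "conv a a (-k) = (\<Sum>\<^sub>\<infinity>j. a (-j) * a (-k - (-j)))"
    unfolding conv_def
    by (rule infsum_reindex_bij_witness[of _ uminus uminus]) auto
  also have "\<dots> = (\<Sum>\<^sub>\<infinity>j. cnj (a j * a (k - j)))"
  proof (rule infsum_cong)
    fix j :: int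
    have "a (-k - (-j)) = a (-(k - j))" by (simp add: algebra_simps)
    then show "a (-j) * a (-k - (-j)) = cnj (a j * a (k - j))"
      using assms[of j] assms[of "k - j"] by simp
  qed
  also have "\<dots> = cnj (conv a a k)"
    unfolding conv_def by (rule infsum_cnj)
  finally show ?thesis .
qed

text \<open>For nonzero \<open>m\<close>, the counterpart of the fact that squaring keeps the period
  \<open>2 * pi / m\<close>: if \<open>m\<close> divides \<open>j\<close> and \<open>k - j\<close>,
  it divides \<open>k\<close>.\<close>

lemma conv_support:
  assumes "\<And>k. \<not> m dvd k \<Longrightarrow> a k = 0" "\<not> m dvd k"
  shows "conv a a k = 0"
proof -
  have "a j * a (k - j) = 0" for j
  proof (cases "m dvd j")
    case True
    then have "\<not> m dvd k - j" using assms(2) using dvd_add[of m "k - j" j] by auto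
    then show ?thesis using assms by simp
  qed (use assms in auto)
  then show ?thesis unfolding conv_def by (simp only: infsum_0_simp)
qed

section \<open>The BBM vector field on Fourier coefficients\<close>

text \<open>Integrating \<open>exp (L * \<bar>\<tau>\<bar>)\<close> gains the factor
  \<open>1 / L\<close>. This gain makes the Picard map a contraction and, in the same way, gives
  uniqueness. The integral is oriented, so negative \<open>t\<close> is reduced to positive by
  reflection.\<close>

lemma norm_interval_integral_exp_bound:
  fixes f :: "real \<Rightarrow> complex"
  assumes f: "continuous_on UNIV f" and L: "0 < L" and m: "0 \<le> m"
    and fm: "\<And>\<tau>. \<bar>\<tau>\<bar> \<le> \<bar>t\<bar> \<Longrightarrow> cmod (f \<tau>) \<le> m * exp (L * \<bar>\<tau>\<bar>)"
  shows "cmod (LBINT \<tau>=ereal 0..ereal t. f \<tau>) \<le> m / L * exp (L * \<bar>t\<bar>)"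
proof -
  have pos: "cmod (LBINT \<tau>=ereal 0..ereal s. g \<tau>) \<le> m / L * exp (L * s)"
    if s: "0 \<le> s" and g: "continuous_on UNIV g"
      and gm: "\<And>\<tau>. 0 \<le> \<tau> \<Longrightarrow> \<tau> \<le> s \<Longrightarrow> cmod (g \<tau>) \<le> m * exp (L * \<tau>)" for s and g :: "real \<Rightarrow> complex"
  proof -
    have gs: "continuous_on {0..s} g" using g continuous_on_subset by blast
    have "((\<lambda>\<tau>. m * exp (L * \<tau>)) has_integral (m / L * exp (L * s) - m / L * exp (L * 0))) {0..s}"
      by (rule fundamental_theorem_of_calculus[OF s])
         (use L in \<open>auto intro!: derivative_eq_intros simp: has_real_derivative_iff_has_vector_derivative[symmetric]\<close>)
    from integral_unique[OF this]
    have I: "integral {0..s} (\<lambda>\<tau>. m * exp (L * \<tau>)) = m / L * exp (L * s) - m / L * exp (L * 0)" .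
    have "(LBINT \<tau>=ereal 0..ereal s. g \<tau>) = integral {0..s} g"
      by (rule interval_integral_eq_integral[OF s borel_integrable_atLeastAtMost'[OF gs]])
    also have "cmod (integral {0..s} g) \<le> integral {0..s} (\<lambda>\<tau>. m * exp (L * \<tau>))"
      by (rule Henstock_Kurzweil_Integration.integral_norm_bound_integral)
         (use gm in \<open>auto intro!: integrable_continuous_interval continuous_intros gs\<close>)
    also have "\<dots> \<le> m / L * exp (L * s)" unfolding I using m L by simp
    finally show ?thesis .
  qed
  show ?thesis
  proof (cases "0 \<le> t")
    case True
    have "cmod (f \<tau>) \<le> m * exp (L * \<tau>)" if "0 \<le> \<tau>" "\<tau> \<le> t" for \<tau>
      using fm[of \<tau>] that by simp
    from pos[OF True f this] True show ?thesis by simp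
  next
    case False
    have "(LBINT \<tau>=ereal 0..ereal t. f \<tau>) = - (LBINT \<tau>=ereal t..ereal 0. f \<tau>)"
      by (rule interval_integral_endpoints_reverse)
    also have "(LBINT \<tau>=ereal t..ereal 0. f \<tau>) = (LBINT \<tau>=ereal 0..ereal (-t). f (- \<tau>))"
      by (subst interval_integral_reflect) (simp add: zero_ereal_def[symmetric])
    finally have "cmod (LBINT \<tau>=ereal 0..ereal t. f \<tau>) = cmod (LBINT \<tau>=ereal 0..ereal (-t). f (- \<tau>))"
      by simp
    also have "\<dots> \<le> m / L * exp (L * (- t))"
    proof (rule pos)
      show "continuous_on UNIV (\<lambda>\<tau>. f (- \<tau>))"
        by (rule continuous_on_compose2[OF f]) (auto intro!: continuous_intros)
      show "cmod (f (- \<tau>)) \<le> m * exp (L * \<tau>)" if "0 \<le> \<tau>" "\<tau> \<le> - t" for \<tau>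
        using fm[of "-\<tau>"] that by simp
    qed (use False in simp)
    finally show ?thesis using False by simp
  qed
qed

lemma interval_integral_has_vector_derivative:
  fixes f :: "real \<Rightarrow> complex"
  assumes f: "continuous_on UNIV f"
  shows "((\<lambda>u. LBINT y=ereal 0..ereal u. f y) has_vector_derivative f t) (at t)"
proof -
  let ?T = "\<bar>t\<bar> + 1"
  have "((\<lambda>u. LBINT y=ereal 0..ereal u. f y) has_vector_derivative f t) (at t within {-?T..?T})"
    by (rule interval_integral_FTC2) (use f continuous_on_subset in auto)
  then show ?thesis
    by (subst (asm) at_within_interior) auto
qed

lemma continuous_on_infsum:
  fixes f :: "int \<Rightarrow> 'a::topological_space \<Rightarrow> 'b::banach"
  assumes "\<And>k. continuous_on S (f k)" "\<And>k t. t \<in> S \<Longrightarrow> norm (f k t) \<le> M k" "M summable_on UNIV"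
  shows "continuous_on S (\<lambda>t. \<Sum>\<^sub>\<infinity>k. f k t)"
proof (rule uniform_limit_theorem)
  show "uniform_limit S (\<lambda>F t. \<Sum>k\<in>F. f k t) (\<lambda>t. \<Sum>\<^sub>\<infinity>k. f k t) (finite_subsets_at_top UNIV)"
    by (rule Weierstrass_m_test_general) (use assms in auto)
  show "\<forall>\<^sub>F F in finite_subsets_at_top UNIV. continuous_on S (\<lambda>t. \<Sum>k\<in>F. f k t)"
    using assms(1) by (intro always_eventually allI continuous_on_sum) auto
qed simp

text \<open>The majorants for series depending on time are uniform only on bounded time intervals.
  These are taken open, so that continuity on each of them glues.\<close>

lemma continuous_on_UNIV_if_bounded_intervals:
  fixes f :: "real \<Rightarrow> 'b::topological_space"
  assumes "\<And>T. 0 < T \<Longrightarrow> continuous_on {-T<..<T} f"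
  shows "continuous_on UNIV f"
proof -
  have "continuous_on (\<Union>T\<in>{0<..}. {-T<..<T}) f"
    by (rule continuous_on_open_UN) (use assms in auto)
  moreover have "(\<Union>T\<in>{0<..}. {-T<..<T}) = (UNIV :: real set)"
  proof (intro equalityI subsetI UNIV_I)
    fix x :: real
    have "x \<in> {-(\<bar>x\<bar> + 1)<..<\<bar>x\<bar> + 1}" by auto
    then show "x \<in> (\<Union>T\<in>{0<..}. {-T<..<T})" by (metis UN_I abs_ge_zero greaterThan_iff add_nonneg_pos zero_less_one)
  qed
  ultimately show ?thesis by simp
qed

section \<open>Weights and the smoothing symbol\<close>

definition wt :: "int \<Rightarrow> real" where "wt k = 1 + \<bar>of_int k\<bar>"

lemma wt_ge_1 [simp]: "1 \<le> wt k" and wt_pos [simp]: "0 < wt k" and wt_nonneg [simp]: "0 \<le> wt k"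
  and wt_neq_0 [simp]: "wt k \<noteq> 0"
  unfolding wt_def by auto

lemma wt_uminus [simp]: "wt (-k) = wt k"
  unfolding wt_def by simp

text \<open>\<open>wt k\<close> is comparable to the square root of 1 + k^2, and it obeys the simple
  \<open>wt_triangle\<close>. A bound by a multiple of \<open>1 / wt k\<close> is a comparison with
  this one square summable sequence.\<close>

definition wt_inv :: "int \<Rightarrow> complex" where "wt_inv k = of_real (1 / wt k)"

lemma norm_wt_inv [simp]: "cmod (wt_inv k) = 1 / wt k"
  unfolding wt_inv_def norm_of_real using wt_nonneg[of k] by simp

lemma sq_summable_wt_inv: "sq_summable wt_inv"
proof -
  have "(cmod (wt_inv k))\<^sup>2 = (1 + \<bar>of_int k\<bar>) powr (-2)" for k
  proof -
    have "wt k powr (-2) = inverse (wt k powr 2)" by (rule powr_minus)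
    also have "wt k powr 2 = (wt k)\<^sup>2" by simp
    finally show ?thesis unfolding norm_wt_inv by (simp add: power_divide inverse_eq_divide wt_def)
  qed
  then show ?thesis unfolding sq_summable_def using summable_on_int_powr[of "-2"] by simp
qed

lemma sq_summable_if_weighted:
  assumes "0 \<le> B" "\<And>k. cmod (a k) \<le> B / wt k"
  shows "sq_summable a" "l2_norm a \<le> B * l2_norm wt_inv"
  using l2_norm_mono[OF sq_summable_wt_inv assms(1), of a] assms(2) by auto

text \<open>The symbol is smoothing of order one: the first bound serves the linear term, the second
  turns a merely bounded convolution into one of size \<open>1 / wt k\<close>. Both come from the
  square of |k| - 1 being nonnegative.\<close>

lemma bbm_symbol_wt: "\<bar>bbm_symbol k\<bar> \<le> 1" "\<bar>bbm_symbol k\<bar> * wt k \<le> 2"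
proof -
  have p: "0 < 1 + (real_of_int k)\<^sup>2" by (simp add: add_pos_nonneg)
  have a: "\<bar>bbm_symbol k\<bar> = \<bar>of_int k\<bar> / (1 + (of_int k)\<^sup>2)"
    unfolding bbm_symbol_def using p by (simp add: abs_divide)
  have q: "2 * \<bar>real_of_int k\<bar> \<le> 1 + (real_of_int k)\<^sup>2"
    using zero_le_power2[of "\<bar>real_of_int k\<bar> - 1"] by (simp add: power2_diff)
  show "\<bar>bbm_symbol k\<bar> \<le> 1" unfolding a using p q by (simp add: divide_le_eq)
  show "\<bar>bbm_symbol k\<bar> * wt k \<le> 2"
  proof -
    have lin: "x + y \<le> 2 * (1 + y)" if "2 * x \<le> 1 + y" "0 \<le> y" for x y :: real using that by simp
    have "\<bar>real_of_int k\<bar> * (1 + \<bar>real_of_int k\<bar>) = \<bar>real_of_int k\<bar> + (real_of_int k)\<^sup>2"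
      by (simp add: distrib_left power2_eq_square)
    also have "\<dots> \<le> 2 * (1 + (real_of_int k)\<^sup>2)" using lin[OF q] by simp
    finally show ?thesis unfolding a wt_def times_divide_eq_left using p by (simp add: divide_le_eq)
  qed
qed

lemma bbm_symbol_uminus [simp]: "bbm_symbol (-k) = - bbm_symbol k"
  unfolding bbm_symbol_def by simp

section \<open>The cut-off vector field and its global Lipschitz bound\<close>

definition cut :: "real \<Rightarrow> (int \<Rightarrow> complex) \<Rightarrow> real" where
  "cut \<rho> a = \<rho> / max \<rho> (l2_norm a)"

text \<open>For positive \<open>\<rho>\<close> the factor \<open>cut \<rho> a\<close> is positive,
  and it is 1 on the ball of radius \<open>\<rho>\<close>. Being real and common to all modes, it
  factors out of \<open>conv\<close> and does not spoil the energy identity.\<close>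

definition retract :: "real \<Rightarrow> (int \<Rightarrow> complex) \<Rightarrow> int \<Rightarrow> complex" where
  "retract \<rho> a k = of_real (cut \<rho> a) * a k"

lemma cut_bounds:
  assumes "0 < \<rho>"
  shows "0 < cut \<rho> a" "cut \<rho> a \<le> 1"
  using assms unfolding cut_def by (auto simp: max_def)

lemma retract_sq_summable: "sq_summable a \<Longrightarrow> sq_summable (retract \<rho> a)"
  unfolding retract_def[abs_def] by (rule l2_norm_mult)

lemma l2_norm_retract:
  assumes "0 < \<rho>" "sq_summable a"
  shows "l2_norm (retract \<rho> a) \<le> \<rho>"
proof -
  have "l2_norm (retract \<rho> a) = cut \<rho> a * l2_norm a"
    unfolding retract_def[abs_def] l2_norm_mult(2)[OF assms(2)] using cut_bounds[OF assms(1), of a] by simp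
  also have "\<dots> \<le> \<rho>" using assms(1) unfolding cut_def by (auto simp: max_def field_simps)
  finally show ?thesis .
qed

text \<open>The difference splits into \<open>cut \<rho> a\<close> times \<open>a - b\<close> and
  \<open>cut \<rho> a - cut \<rho> b\<close> times \<open>b\<close>. Each part is at most the norm
  of \<open>a - b\<close>, the second because \<open>max \<rho>\<close> is nonexpansive; hence the
  factor 2.\<close>

lemma l2_norm_retract_diff:
  assumes \<rho>: "0 < \<rho>" and a: "sq_summable a" and b: "sq_summable b"
  shows "l2_norm (\<lambda>k. retract \<rho> a k - retract \<rho> b k) \<le> 2 * l2_norm (\<lambda>k. a k - b k)"
proof -
  let ?d = "\<lambda>k. a k - b k"
  define A where "A = max \<rho> (l2_norm a)"
  define B where "B = max \<rho> (l2_norm b)"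
  have d: "sq_summable ?d" using l2_norm_diff a b by blast
  have pos: "0 < A" "0 < B" "\<rho> \<le> A" "l2_norm b \<le> B" using \<rho> unfolding A_def B_def by auto
  have AB: "\<bar>B - A\<bar> \<le> l2_norm ?d"
    using l2_norm_triangle_abs[OF a b] unfolding A_def B_def by linarith
  have "cut \<rho> a - cut \<rho> b = (\<rho> / A) * ((B - A) / B)"
    using pos unfolding cut_def A_def[symmetric] B_def[symmetric] by (simp add: field_simps)
  then have "\<bar>cut \<rho> a - cut \<rho> b\<bar> * l2_norm b = (\<rho> / A) * (\<bar>B - A\<bar> * (l2_norm b / B))"
    using pos \<rho> by (simp add: abs_mult)
  also have "\<dots> \<le> 1 * (\<bar>B - A\<bar> * 1)"
    using pos \<rho> by (intro mult_mono) auto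
  finally have c: "\<bar>cut \<rho> a - cut \<rho> b\<bar> * l2_norm b \<le> l2_norm ?d" using AB by simp
  have "(\<lambda>k. retract \<rho> a k - retract \<rho> b k)
      = (\<lambda>k. of_real (cut \<rho> a) * ?d k + of_real (cut \<rho> a - cut \<rho> b) * b k)"
    unfolding retract_def by (auto simp: algebra_simps)
  then have "l2_norm (\<lambda>k. retract \<rho> a k - retract \<rho> b k)
      \<le> l2_norm (\<lambda>k. of_real (cut \<rho> a) * ?d k) + l2_norm (\<lambda>k. of_real (cut \<rho> a - cut \<rho> b) * b k)"
    using l2_norm_add(2) l2_norm_mult(1) d b by simp
  also have "\<dots> = cut \<rho> a * l2_norm ?d + \<bar>cut \<rho> a - cut \<rho> b\<bar> * l2_norm b"
    using l2_norm_mult(2)[OF d] l2_norm_mult(2)[OF b] cut_bounds[OF \<rho>, of a] by (simp del: of_real_diff)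
  also have "\<dots> \<le> 1 * l2_norm ?d + l2_norm ?d"
    using c cut_bounds[OF \<rho>, of a] by (intro add_mono mult_right_mono) auto
  finally show ?thesis by simp
qed

text \<open>
  The right-hand side of the BBM equation on Fourier coefficients, with the nonlinearity
  evaluated at the radial retraction onto an \<open>l\<^sup>2\<close> ball. This makes it globally Lipschitz, hence
  gives global solutions; the energy is still conserved, so the cutoff is never active.
\<close>

definition cut_field :: "real \<Rightarrow> (int \<Rightarrow> complex) \<Rightarrow> int \<Rightarrow> complex" where
  "cut_field \<rho> a k = - \<i> * of_real (bbm_symbol k) * (a k + 1 / 2 * conv (retract \<rho> a) (retract \<rho> a) k)"

text \<open>After the retraction the convolution is at most \<open>\<rho>\<^sup>2\<close> whatever
  the size of \<open>a\<close>, so the field grows only linearly in \<open>B\<close>.\<close>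

lemma cut_field_bound:
  assumes \<rho>: "0 < \<rho>" and B: "0 \<le> B" and a: "\<And>k. cmod (a k) \<le> B / wt k"
  shows "cmod (cut_field \<rho> a k) \<le> (B + \<rho>\<^sup>2) / wt k"
proof -
  have s: "sq_summable a" using sq_summable_if_weighted[OF B a] by blast
  let ?c = "conv (retract \<rho> a) (retract \<rho> a) k"
  have c: "cmod ?c \<le> \<rho> * \<rho>"
    using conv_bound[OF retract_sq_summable[OF s] retract_sq_summable[OF s], of \<rho> \<rho> k]
      l2_norm_retract[OF \<rho> s] mult_mono[of "l2_norm (retract \<rho> a)" \<rho> "l2_norm (retract \<rho> a)" \<rho>] \<rho>
    by simp
  have "cmod (cut_field \<rho> a k) \<le> \<bar>bbm_symbol k\<bar> * (cmod (a k) + 1 / 2 * cmod ?c)"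
    unfolding cut_field_def norm_mult
    using norm_triangle_ineq[of "a k" "1/2 * ?c"] by (auto simp: norm_mult intro!: mult_left_mono)
  then have "cmod (cut_field \<rho> a k) * wt k \<le> \<bar>bbm_symbol k\<bar> * (cmod (a k) + 1 / 2 * cmod ?c) * wt k"
    using wt_nonneg by (rule mult_right_mono)
  also have "\<dots> = \<bar>bbm_symbol k\<bar> * (cmod (a k) * wt k) + 1/2 * ((\<bar>bbm_symbol k\<bar> * wt k) * cmod ?c)"
    by (simp add: algebra_simps)
  also have "\<dots> \<le> 1 * B + 1/2 * (2 * (\<rho> * \<rho>))"
    using bbm_symbol_wt[of k] a[of k] c B \<rho> by (intro add_mono mult_mono mult_left_mono) (auto simp: field_simps)
  finally show ?thesis by (simp add: le_divide_eq power2_eq_square)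
qed

text \<open>The constant collects 1 from the linear term and, for the quadratic one, 2 from the
  retraction, \<open>2 * \<rho>\<close> from the two factors of the convolution and
  \<open>l2_norm wt_inv\<close> from passing to the l^2 norm. The 1/2 in the field cancels the 2 in
  \<open>bbm_symbol_wt\<close>.\<close>

lemma cut_field_diff_bound:
  assumes \<rho>: "0 < \<rho>" and a: "sq_summable a" and b: "sq_summable b" and D: "0 \<le> D"
    and ab: "\<And>k. cmod (a k - b k) \<le> D / wt k"
  shows "cmod (cut_field \<rho> a k - cut_field \<rho> b k) \<le> (1 + 4 * \<rho> * l2_norm wt_inv) * D / wt k"
proof -
  let ?ca = "conv (retract \<rho> a) (retract \<rho> a) k" and ?cb = "conv (retract \<rho> b) (retract \<rho> b) k"
  have "cmod (?ca - ?cb) \<le> l2_norm (\<lambda>k. retract \<rho> a k - retract \<rho> b k)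
      * (l2_norm (retract \<rho> a) + l2_norm (retract \<rho> b))"
    by (intro conv_self_diff_bound retract_sq_summable a b)
  also have "\<dots> \<le> (2 * (D * l2_norm wt_inv)) * (\<rho> + \<rho>)"
  proof (intro mult_mono add_mono l2_norm_retract \<rho> a b)
    have "l2_norm (\<lambda>k. a k - b k) \<le> D * l2_norm wt_inv"
      using sq_summable_if_weighted(2)[OF D ab] .
    then show "l2_norm (\<lambda>k. retract \<rho> a k - retract \<rho> b k) \<le> 2 * (D * l2_norm wt_inv)"
      using l2_norm_retract_diff[OF \<rho> a b] by linarith
  qed (use D in auto)
  finally have c: "cmod (?ca - ?cb) \<le> 4 * \<rho> * l2_norm wt_inv * D" by (simp add: algebra_simps)
  have "cut_field \<rho> a k - cut_field \<rho> b k
      = - \<i> * of_real (bbm_symbol k) * ((a k - b k) + 1 / 2 * (?ca - ?cb))"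
    unfolding cut_field_def by (simp add: algebra_simps)
  then have "cmod (cut_field \<rho> a k - cut_field \<rho> b k)
      \<le> \<bar>bbm_symbol k\<bar> * (cmod (a k - b k) + 1 / 2 * cmod (?ca - ?cb))"
    using norm_triangle_ineq[of "a k - b k" "1/2 * (?ca - ?cb)"]
    by (auto simp: norm_mult intro!: mult_left_mono)
  then have "cmod (cut_field \<rho> a k - cut_field \<rho> b k) * wt k
      \<le> \<bar>bbm_symbol k\<bar> * (cmod (a k - b k) + 1 / 2 * cmod (?ca - ?cb)) * wt k"
    using wt_nonneg by (rule mult_right_mono)
  also have "\<dots> = \<bar>bbm_symbol k\<bar> * (cmod (a k - b k) * wt k) + 1/2 * ((\<bar>bbm_symbol k\<bar> * wt k) * cmod (?ca - ?cb))"
    by (simp add: algebra_simps)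
  also have "\<dots> \<le> 1 * D + 1/2 * (2 * (4 * \<rho> * l2_norm wt_inv * D))"
    using bbm_symbol_wt[of k] ab[of k] c D \<rho> by (intro add_mono mult_mono mult_left_mono) (auto simp: field_simps)
  finally show ?thesis by (simp add: le_divide_eq algebra_simps)
qed

text \<open>Each mode depends on all others through series whose terms, on a bounded time interval,
  are dominated by products of \<open>wt_inv\<close>; so the M-test applies. The second claim serves
  later for the equation without cutoff.\<close>

lemma cut_field_continuous:
  fixes a :: "real \<Rightarrow> int \<Rightarrow> complex"
  assumes \<rho>: "0 < \<rho>" and a: "\<And>k. continuous_on UNIV (\<lambda>t. a t k)"
    and B: "\<And>T. 0 < T \<Longrightarrow> \<exists>B\<ge>0. \<forall>t k. \<bar>t\<bar> \<le> T \<longrightarrow> cmod (a t k) \<le> B / wt k"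
  shows "continuous_on UNIV (\<lambda>t. cut_field \<rho> (a t) k)" "continuous_on UNIV (\<lambda>t. conv (a t) (a t) k)"
proof -
  have c: "continuous_on UNIV (\<lambda>t. conv (a t) (a t) k)"
  proof (rule continuous_on_UNIV_if_bounded_intervals)
    fix T :: real assume "0 < T"
    then obtain B where "0 \<le> B" and B: "\<And>t k. \<bar>t\<bar> \<le> T \<Longrightarrow> cmod (a t k) \<le> B / wt k"
      using B by blast
    show "continuous_on {-T<..<T} (\<lambda>t. conv (a t) (a t) k)"
      unfolding conv_def
    proof (rule continuous_on_infsum)
      show "continuous_on {-T<..<T} (\<lambda>t. a t j * a t (k - j))" for j
        by (intro continuous_on_mult continuous_on_subset[OF a]) auto
      show "cmod (a t j * a t (k - j)) \<le> B\<^sup>2 * cmod (wt_inv j * wt_inv (k - j))"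
        if "t \<in> {-T<..<T}" for t j
      proof -
        have "cmod (a t j) * cmod (a t (k - j)) \<le> (B / wt j) * (B / wt (k - j))"
          using B[of t] that \<open>0 \<le> B\<close> by (intro mult_mono) auto
        then show ?thesis by (simp add: norm_mult power2_eq_square)
      qed
      show "(\<lambda>j. B\<^sup>2 * cmod (wt_inv j * wt_inv (k - j))) summable_on UNIV"
        by (intro summable_on_cmult_right conv_abs_summable sq_summable_wt_inv)
    qed
  qed
  have n: "continuous_on UNIV (\<lambda>t. l2_norm (a t))"
  proof (rule continuous_on_UNIV_if_bounded_intervals)
    fix T :: real assume "0 < T"
    then obtain B where "0 \<le> B" and B: "\<And>t k. \<bar>t\<bar> \<le> T \<Longrightarrow> cmod (a t k) \<le> B / wt k"
      using B by blast
    show "continuous_on {-T<..<T} (\<lambda>t. l2_norm (a t))"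
      unfolding l2_norm_def
    proof (intro continuous_on_real_sqrt, rule continuous_on_infsum)
      show "continuous_on {-T<..<T} (\<lambda>t. (cmod (a t k))\<^sup>2)" for k
        by (intro continuous_intros continuous_on_subset[OF a]) auto
      show "norm ((cmod (a t k))\<^sup>2) \<le> B\<^sup>2 * (cmod (wt_inv k))\<^sup>2" if "t \<in> {-T<..<T}" for t k
        using power_mono[OF B[of t k], of 2] that by (auto simp: power_divide)
      show "(\<lambda>k. B\<^sup>2 * (cmod (wt_inv k))\<^sup>2) summable_on UNIV"
        using sq_summable_wt_inv unfolding sq_summable_def by (rule summable_on_cmult_right)
    qed
  qed
  have m: "max \<rho> (l2_norm (a t)) \<noteq> 0" for t using \<rho> by (simp add: max_def)
  have "conv (retract \<rho> (a t)) (retract \<rho> (a t)) k = (of_real (cut \<rho> (a t)))\<^sup>2 * conv (a t) (a t) k" for t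
    unfolding retract_def[abs_def] by (rule conv_mult)
  then show "continuous_on UNIV (\<lambda>t. cut_field \<rho> (a t) k)"
    unfolding cut_field_def cut_def using m by (auto intro!: continuous_intros a c n)
  show "continuous_on UNIV (\<lambda>t. conv (a t) (a t) k)" by (rule c)
qed

section \<open>The Picard map\<close>

text \<open>The slices over single integers are open, so joint continuity reduces to continuity in
  time for each mode.\<close>

lemma continuous_on_real_discrete_product:
  fixes f :: "real \<times> int discrete \<Rightarrow> 'b::topological_space"
  assumes "\<And>k. continuous_on UNIV (\<lambda>t. f (t, k))"
  shows "continuous_on UNIV f"
proof -
  have "continuous_on (\<Union>k. UNIV \<times> {k}) f"
  proof (rule continuous_on_open_UN)
    fix k :: "int discrete"
    show "open (UNIV \<times> {k} :: (real \<times> int discrete) set)"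
      by (intro open_Times Discrete_Topology.open_discrete open_UNIV)
    have "continuous_on (UNIV \<times> {k}) (\<lambda>p. f (fst p, k))"
      by (rule continuous_on_compose2[where g="\<lambda>t. f (t, k)" and f=fst, OF assms])
         (auto intro: continuous_on_fst continuous_on_id)
    then show "continuous_on (UNIV \<times> {k}) f"
      by (rule continuous_on_eq) auto
  qed
  moreover have "(\<Union>k. UNIV \<times> {k}) = (UNIV :: (real \<times> int discrete) set)" by auto
  ultimately show ?thesis by simp
qed

lemma interval_integral_cnj:
  "(LBINT t=a..b. cnj (f t)) = cnj (LBINT t=a..b. f t)"
proof -
  have "(LINT t:S|lborel. cnj (f t)) = cnj (LINT t:S|lborel. f t)" for S
    unfolding set_lebesgue_integral_def
    using Bochner_Integration.integral_cnj[of lborel "\<lambda>t. indicator S t *\<^sub>R f t"] by (simp only: complex_cnj_scaleR)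
  then show ?thesis unfolding interval_lebesgue_integral_def by simp
qed

text \<open>
  Coefficient families of growth at most \<open>exp (L * \<bar>t\<bar>) / wt k\<close> are encoded as bounded continuous
  functions on \<open>\<real> \<times> \<int>\<close> (\<open>\<int>\<close> discrete), a Banach space in which the Picard map is a contraction for large \<open>L\<close>.
\<close>

definition unweight :: "real \<Rightarrow> ((real \<times> int discrete) \<Rightarrow>\<^sub>C complex) \<Rightarrow> real \<Rightarrow> int \<Rightarrow> complex" where
  "unweight L b t k = of_real (exp (L * \<bar>t\<bar>) / wt k) * apply_bcontfun b (t, discrete k)"

lemma norm_unweight:
  "cmod (unweight L b t k) \<le> norm b * exp (L * \<bar>t\<bar>) / wt k"
  using mult_left_mono[OF norm_bounded[of b "(t, discrete k)"], of "exp (L * \<bar>t\<bar>) / wt k"]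
  by (simp add: unweight_def norm_mult norm_divide mult.commute del: of_real_divide)

lemma norm_unweight_diff:
  "cmod (unweight L b t k - unweight L b' t k) \<le> dist b b' * exp (L * \<bar>t\<bar>) / wt k"
proof -
  have "unweight L b t k - unweight L b' t k
      = of_real (exp (L * \<bar>t\<bar>) / wt k) * (apply_bcontfun b (t, discrete k) - apply_bcontfun b' (t, discrete k))"
    unfolding unweight_def by (simp add: algebra_simps)
  then show ?thesis
    using mult_left_mono[OF dist_bounded[of b "(t, discrete k)" b'], of "exp (L * \<bar>t\<bar>) / wt k"]
    by (simp add: norm_mult norm_divide mult.commute dist_norm del: of_real_divide)
qed

lemma continuous_unweight: "continuous_on UNIV (\<lambda>t. unweight L b t k)"
  unfolding unweight_def
  by (intro continuous_intros continuous_on_compose2[OF continuous_on_apply_bcontfun[of UNIV b]]) auto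

lemma unweight_locally_bounded:
  assumes "0 \<le> L"
  shows "\<exists>B\<ge>0. \<forall>t k. \<bar>t\<bar> \<le> T \<longrightarrow> cmod (unweight L b t k) \<le> B / wt k"
proof (intro exI[of _ "norm b * exp (L * T)"] conjI allI impI)
  fix t :: real and k assume "\<bar>t\<bar> \<le> T"
  then have "norm b * exp (L * \<bar>t\<bar>) / wt k \<le> norm b * exp (L * T) / wt k"
    using assms by (intro divide_right_mono mult_left_mono) (auto intro: mult_left_mono)
  with norm_unweight[of L b t k] show "cmod (unweight L b t k) \<le> norm b * exp (L * T) / wt k"
    by linarith
qed simp

lemma cut_field_continuous_unweight:
  assumes "0 < \<rho>" "0 \<le> L"
  shows "continuous_on UNIV (\<lambda>t. cut_field \<rho> (unweight L b t) k)"
  by (rule cut_field_continuous(1)[OF assms(1) continuous_unweight]) (use unweight_locally_bounded assms in auto)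

lemma cut_field_hermitian:
  assumes "\<And>k. a (-k) = cnj (a k)"
  shows "cut_field \<rho> a (-k) = cnj (cut_field \<rho> a k)"
proof -
  have "conv (retract \<rho> a) (retract \<rho> a) (-k) = cnj (conv (retract \<rho> a) (retract \<rho> a) k)"
    by (rule conv_hermitian) (simp add: retract_def assms)
  then show ?thesis unfolding cut_field_def by (simp add: assms)
qed

lemma cut_field_support:
  assumes "\<And>k. \<not> m dvd k \<Longrightarrow> a k = 0" "\<not> m dvd k"
  shows "cut_field \<rho> a k = 0"
proof -
  have "conv (retract \<rho> a) (retract \<rho> a) k = 0"
    by (rule conv_support[OF _ assms(2)]) (simp add: retract_def assms)
  then show ?thesis unfolding cut_field_def using assms by simp
qed

definition picard ::
  "real \<Rightarrow> real \<Rightarrow> (int \<Rightarrow> complex) \<Rightarrow> ((real \<times> int discrete) \<Rightarrow>\<^sub>C complex) \<Rightarrow> real \<Rightarrow> int \<Rightarrow> complex" where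
  "picard \<rho> L v b t k = v k + (LBINT \<tau>=ereal 0..ereal t. cut_field \<rho> (unweight L b \<tau>) k)"

text \<open>\<open>Bcontfun\<close> is meaningful only on bounded continuous functions; that this
  function is one is proved inside \<open>apply_picard_map\<close>.\<close>

definition picard_map ::
  "real \<Rightarrow> real \<Rightarrow> (int \<Rightarrow> complex) \<Rightarrow> ((real \<times> int discrete) \<Rightarrow>\<^sub>C complex) \<Rightarrow> (real \<times> int discrete) \<Rightarrow>\<^sub>C complex" where
  "picard_map \<rho> L v b = Bcontfun (\<lambda>(t, d). of_real (wt (of_discrete d) / exp (L * \<bar>t\<bar>)) * picard \<rho> L v b t (of_discrete d))"

lemma picard_has_vector_derivative:
  assumes "0 < \<rho>" "0 \<le> L"
  shows "((\<lambda>t. picard \<rho> L v b t k) has_vector_derivative cut_field \<rho> (unweight L b t) k) (at t)"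
  unfolding picard_def
  using interval_integral_has_vector_derivative[OF cut_field_continuous_unweight[OF assms, of b k], of t]
  by (auto intro!: derivative_eq_intros)

lemma apply_picard_map:
  assumes \<rho>: "0 < \<rho>" and L: "0 < L" and V: "\<And>k. cmod (v k) \<le> V / wt k"
  shows "apply_bcontfun (picard_map \<rho> L v b) (t, discrete k) = of_real (wt k / exp (L * \<bar>t\<bar>)) * picard \<rho> L v b t k"
proof -
  let ?f = "\<lambda>(t, d). of_real (wt (of_discrete d) / exp (L * \<bar>t\<bar>)) * picard \<rho> L v b t (of_discrete d) :: complex"
  have "?f \<in> bcontfun"
  proof (rule bcontfun_normI)
    show "continuous_on UNIV ?f"
    proof (rule continuous_on_real_discrete_product)
      fix d :: "int discrete"
      have "continuous_on UNIV (\<lambda>t. picard \<rho> L v b t (of_discrete d))"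
        unfolding continuous_on_eq_continuous_within
        using has_vector_derivative_continuous[OF picard_has_vector_derivative[OF \<rho>]] L by auto
      then show "continuous_on UNIV (\<lambda>t. ?f (t, d))"
        unfolding case_prod_conv by (intro continuous_intros) auto
    qed
    show "norm (?f p) \<le> V + (norm b + \<rho>\<^sup>2) / L" for p
    proof -
      obtain t k where p: "p = (t, discrete k)" by (metis of_discrete_inverse surj_pair)
      let ?I = "LBINT \<tau>=ereal 0..ereal t. cut_field \<rho> (unweight L b \<tau>) k"
      have I: "cmod ?I \<le> ((norm b + \<rho>\<^sup>2) / wt k) / L * exp (L * \<bar>t\<bar>)"
      proof (rule norm_interval_integral_exp_bound[OF cut_field_continuous_unweight[OF \<rho>] L])
        fix \<tau> :: real
        \<comment> \<open>The weight is at least 1, so the part \<open>\<rho>\<^sup>2\<close> of the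
          field can be absorbed into the exponential form as well.\<close>
        have e: "1 \<le> exp (L * \<bar>\<tau>\<bar>)" using L by simp
        have "cmod (cut_field \<rho> (unweight L b \<tau>) k) \<le> (norm b * exp (L * \<bar>\<tau>\<bar>) + \<rho>\<^sup>2) / wt k"
          by (rule cut_field_bound[OF \<rho> _ norm_unweight]) auto
        also have "\<dots> \<le> (norm b * exp (L * \<bar>\<tau>\<bar>) + \<rho>\<^sup>2 * exp (L * \<bar>\<tau>\<bar>)) / wt k"
          using mult_left_mono[OF e, of "\<rho>\<^sup>2"] by (intro divide_right_mono) auto
        finally show "cmod (cut_field \<rho> (unweight L b \<tau>) k) \<le> (norm b + \<rho>\<^sup>2) / wt k * exp (L * \<bar>\<tau>\<bar>)"
          by (simp add: algebra_simps add_divide_distrib)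
      qed (use L in \<open>auto intro!: divide_nonneg_pos\<close>)
      have V0: "0 \<le> V" using V[of 0] norm_ge_zero[of "v 0"] by (simp add: wt_def del: norm_ge_zero)
      have e: "1 \<le> exp (L * \<bar>t\<bar>)" using L by simp
      have "norm (?f p) = wt k / exp (L * \<bar>t\<bar>) * cmod (v k + ?I)"
        unfolding p by (simp add: discrete_inverse picard_def norm_mult norm_divide del: of_real_divide)
      also have "\<dots> \<le> wt k / exp (L * \<bar>t\<bar>) * (V / wt k * exp (L * \<bar>t\<bar>) + ((norm b + \<rho>\<^sup>2) / wt k) / L * exp (L * \<bar>t\<bar>))"
      proof (rule mult_left_mono)
        have "V / wt k \<le> V / wt k * exp (L * \<bar>t\<bar>)"
          using mult_left_mono[OF e, of "V / wt k"] V0 by simp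
        then show "cmod (v k + ?I) \<le> V / wt k * exp (L * \<bar>t\<bar>) + ((norm b + \<rho>\<^sup>2) / wt k) / L * exp (L * \<bar>t\<bar>)"
          using norm_triangle_ineq[of "v k" ?I] V[of k] I by linarith
      qed simp
      also have "\<dots> = V + (norm b + \<rho>\<^sup>2) / L"
        using L by (simp add: field_simps)
      finally show ?thesis .
    qed
  qed
  then show ?thesis unfolding picard_map_def by (simp add: Bcontfun_inverse discrete_inverse)
qed

lemma unweight_picard_map:
  assumes "0 < \<rho>" "0 < L" "\<And>k. cmod (v k) \<le> V / wt k"
  shows "unweight L (picard_map \<rho> L v b) = picard \<rho> L v b"
proof (intro ext)
  fix t k
  show "unweight L (picard_map \<rho> L v b) t k = picard \<rho> L v b t k"
    unfolding unweight_def apply_picard_map[OF assms] by (simp add: field_simps)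
qed

text \<open>\<open>L\<close> is twice the Lipschitz constant of \<open>cut_field_diff_bound\<close>;
  integration against the exponential weight divides that constant by \<open>L\<close>, which leaves
  1/2.\<close>

lemma dist_picard_map:
  assumes \<rho>: "0 < \<rho>" and V: "\<And>k. cmod (v k) \<le> V / wt k"
    and L: "L = 2 * (1 + 4 * \<rho> * l2_norm wt_inv)"
  shows "dist (picard_map \<rho> L v b) (picard_map \<rho> L v b') \<le> 1 / 2 * dist b b'"
proof (rule dist_bound)
  fix p :: "real \<times> int discrete"
  obtain t k where p: "p = (t, discrete k)" by (metis of_discrete_inverse surj_pair)
  have L0: "0 < L" "0 \<le> L" using \<rho> unfolding L by (auto simp: add_pos_nonneg)
  have sq: "sq_summable (unweight L b t)" for b t
    by (rule sq_summable_if_weighted(1)[OF _ norm_unweight]) auto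
  note c = cut_field_continuous_unweight[OF \<rho> L0(2), of _ k]
  have int: "interval_lebesgue_integrable lborel (ereal 0) (ereal t) (\<lambda>\<tau>. cut_field \<rho> (unweight L b \<tau>) k)" for b
    by (rule interval_integrable_isCont) (use c in \<open>simp add: continuous_on_eq_continuous_at\<close>)
  have 1: "picard \<rho> L v b t k - picard \<rho> L v b' t k
      = (LBINT \<tau>=ereal 0..ereal t. cut_field \<rho> (unweight L b \<tau>) k - cut_field \<rho> (unweight L b' \<tau>) k)"
    unfolding picard_def by (subst interval_lebesgue_integral_diff(2)[OF int int]) simp
  have 2: "cmod (LBINT \<tau>=ereal 0..ereal t. cut_field \<rho> (unweight L b \<tau>) k - cut_field \<rho> (unweight L b' \<tau>) k)
      \<le> ((1 + 4 * \<rho> * l2_norm wt_inv) * dist b b' / wt k) / L * exp (L * \<bar>t\<bar>)"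
  proof (rule norm_interval_integral_exp_bound[OF _ L0(1)])
    show "continuous_on UNIV (\<lambda>\<tau>. cut_field \<rho> (unweight L b \<tau>) k - cut_field \<rho> (unweight L b' \<tau>) k)"
      by (intro continuous_on_diff c)
    show "cmod (cut_field \<rho> (unweight L b \<tau>) k - cut_field \<rho> (unweight L b' \<tau>) k)
        \<le> (1 + 4 * \<rho> * l2_norm wt_inv) * dist b b' / wt k * exp (L * \<bar>\<tau>\<bar>)" for \<tau>
    proof -
      have "cmod (cut_field \<rho> (unweight L b \<tau>) k - cut_field \<rho> (unweight L b' \<tau>) k)
          \<le> (1 + 4 * \<rho> * l2_norm wt_inv) * (dist b b' * exp (L * \<bar>\<tau>\<bar>)) / wt k"
        by (rule cut_field_diff_bound[OF \<rho> sq sq _ norm_unweight_diff]) simp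
      then show ?thesis by (simp add: ac_simps)
    qed
  qed (use \<rho> in \<open>auto intro!: divide_nonneg_pos mult_nonneg_nonneg\<close>)
  have 3: "((1 + 4 * \<rho> * l2_norm wt_inv) * dist b b' / wt k) / L = dist b b' / wt k / 2"
  proof -
    have "1 + 4 * \<rho> * l2_norm wt_inv = L / 2" unfolding L by simp
    then show ?thesis using L0 by (simp only:) simp
  qed
  have *: "cmod (picard \<rho> L v b t k - picard \<rho> L v b' t k) \<le> dist b b' / wt k / 2 * exp (L * \<bar>t\<bar>)"
    using 2 unfolding 1 3 .
  have "dist (apply_bcontfun (picard_map \<rho> L v b) p) (apply_bcontfun (picard_map \<rho> L v b') p)
      = wt k / exp (L * \<bar>t\<bar>) * cmod (picard \<rho> L v b t k - picard \<rho> L v b' t k)"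
    unfolding p apply_picard_map[OF \<rho> L0(1) V] dist_norm right_diff_distrib[symmetric]
    by (simp add: norm_mult norm_divide del: of_real_divide)
  also have "\<dots> \<le> wt k / exp (L * \<bar>t\<bar>) * (dist b b' / wt k / 2 * exp (L * \<bar>t\<bar>))"
    by (rule mult_left_mono[OF *]) simp
  also have "\<dots> = 1 / 2 * dist b b'" using wt_pos[of k] by simp
  finally show "dist (apply_bcontfun (picard_map \<rho> L v b) p) (apply_bcontfun (picard_map \<rho> L v b') p)
      \<le> 1 / 2 * dist b b'" .
qed

text \<open>Hermitian symmetry and support in the multiples of \<open>m\<close> are closed
  conditions preserved by the Picard map, so a fixed point sought among such families has them at
  once.\<close>

lemma cut_field_ode_exists:
  assumes \<rho>: "0 < \<rho>" and V: "\<And>k. cmod (v k) \<le> V / wt k"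
    and herm: "\<And>k. v (-k) = cnj (v k)" and supp: "\<And>k. \<not> m dvd k \<Longrightarrow> v k = 0"
  obtains a where "a 0 = v"
    "\<And>t k. ((\<lambda>t. a t k) has_vector_derivative cut_field \<rho> (a t) k) (at t)"
    "\<And>T. 0 < T \<Longrightarrow> \<exists>B\<ge>0. \<forall>t k. \<bar>t\<bar> \<le> T \<longrightarrow> cmod (a t k) \<le> B / wt k"
    "\<And>t k. a t (-k) = cnj (a t k)" "\<And>t k. \<not> m dvd k \<Longrightarrow> a t k = 0"
proof -
  define L where "L = 2 * (1 + 4 * \<rho> * l2_norm wt_inv)"
  have L0: "0 < L" "0 \<le> L" using \<rho> unfolding L_def by (auto simp: add_pos_nonneg)
  define S :: "((real \<times> int discrete) \<Rightarrow>\<^sub>C complex) set" where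
    "S = {b. (\<forall>t k. apply_bcontfun b (t, discrete (-k)) = cnj (apply_bcontfun b (t, discrete k))) \<and>
             (\<forall>t k. \<not> m dvd k \<longrightarrow> apply_bcontfun b (t, discrete k) = 0)}"
  \<comment> \<open>Evaluation at a point is 1-Lipschitz for the supremum distance, which makes
    \<open>S\<close> closed.\<close>
  have ev: "continuous_on UNIV (\<lambda>b :: (real \<times> int discrete) \<Rightarrow>\<^sub>C complex. apply_bcontfun b p)" for p
    unfolding continuous_on_iff
  proof (intro ballI allI impI)
    fix b :: "(real \<times> int discrete) \<Rightarrow>\<^sub>C complex" and e :: real assume "0 < e"
    then show "\<exists>d>0. \<forall>b'\<in>UNIV. dist b' b < d \<longrightarrow> dist (apply_bcontfun b' p) (apply_bcontfun b p) < e"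
      using le_less_trans[OF dist_bounded] by blast
  qed
  have "closed S"
  proof -
    have "S = (\<Inter>t. \<Inter>k. {b. apply_bcontfun b (t, discrete (-k)) = cnj (apply_bcontfun b (t, discrete k))})
        \<inter> (\<Inter>t. \<Inter>k\<in>{k. \<not> m dvd k}. {b. apply_bcontfun b (t, discrete k) = 0})"
      unfolding S_def by auto
    also have "closed \<dots>"
      by (intro closed_Int closed_INT ballI closed_Collect_eq continuous_intros ev)
    finally show ?thesis .
  qed
  then have "complete S"
    by (rule complete_closed_subset[OF _ subset_UNIV complete_UNIV])
  have "0 \<in> S" unfolding S_def by simp
  have in_S: "b \<in> S \<longleftrightarrow> (\<forall>t k. unweight L b t (-k) = cnj (unweight L b t k)) \<and>
             (\<forall>t k. \<not> m dvd k \<longrightarrow> unweight L b t k = 0)" for b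
    unfolding S_def unweight_def by simp
  have "picard_map \<rho> L v b \<in> S" if "b \<in> S" for b
  proof -
    have h: "unweight L b t (-k) = cnj (unweight L b t k)"
      and z: "\<not> m dvd k \<Longrightarrow> unweight L b t k = 0" for t k using that unfolding in_S by auto
    have "picard \<rho> L v b t (-k) = cnj (picard \<rho> L v b t k)" for t k
      unfolding picard_def cut_field_hermitian[of "unweight L b _", OF h] herm
      by (simp add: interval_integral_cnj)
    moreover have "picard \<rho> L v b t k = 0" if "\<not> m dvd k" for t k
    proof -
      have "cut_field \<rho> (unweight L b \<tau>) k = 0" for \<tau>
        by (rule cut_field_support[OF z that])
      then show ?thesis unfolding picard_def using supp that by simp
    qed
    ultimately show ?thesis unfolding in_S unweight_picard_map[OF \<rho> L0(1) V] by blast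
  qed
  then have "\<exists>!b\<in>S. picard_map \<rho> L v b = b"
    using \<open>complete S\<close> \<open>0 \<in> S\<close> dist_picard_map[OF \<rho> V L_def]
    by (intro Banach_fix[where c="1/2"]) auto
  then obtain b where b: "b \<in> S" "picard_map \<rho> L v b = b" by blast
  then have eq: "unweight L b = picard \<rho> L v b" using unweight_picard_map[OF \<rho> L0(1) V, of b] by simp
  show thesis
  proof (rule that[of "unweight L b"])
    have "picard \<rho> L v b 0 = v" by (intro ext) (simp add: picard_def)
    then show "unweight L b 0 = v" by (simp only: eq)
    show "((\<lambda>t. unweight L b t k) has_vector_derivative cut_field \<rho> (unweight L b t) k) (at t)" for t k
      using picard_has_vector_derivative[OF \<rho> L0(2), of v b k t] unfolding eq[symmetric] .
    show "\<exists>B\<ge>0. \<forall>t k. \<bar>t\<bar> \<le> T \<longrightarrow> cmod (unweight L b t k) \<le> B / wt k" for T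
      by (rule unweight_locally_bounded[OF L0(2)])
  qed (use \<open>b \<in> S\<close>[unfolded in_S] in auto)
qed

section \<open>Conservation of energy\<close>

lemma wt_triangle: "wt k \<le> wt j + wt (k - j)"
  unfolding wt_def using abs_triangle_ineq[of "real_of_int j" "real_of_int (k - j)"] by simp

lemma summable_on_wt_powr: "s < -1 \<Longrightarrow> (\<lambda>k. wt k powr s) summable_on UNIV"
  unfolding wt_def by (rule summable_on_int_powr)

lemma summable_on_wt_powr_reflect: "s < -1 \<Longrightarrow> (\<lambda>j. wt (k - j) powr s) summable_on UNIV"
  using summable_on_reindex_bij_betw[OF bij_int_reflect[of k], of "\<lambda>k. wt k powr s"] summable_on_wt_powr by auto

text \<open>The larger of \<open>X\<close> and \<open>Y\<close> is at least \<open>Z / 2\<close>. Of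
  its inverse, the power 3/4 is spent on decay in \<open>Z\<close>, at the price of a factor below
  2; the remaining 1/4 is moved to the smaller variable, whose power -5/4 is summable over the
  integers.\<close>

lemma inverse_product_powr_bound:
  fixes X Y Z :: real
  assumes "1 \<le> X" "1 \<le> Y" "1 \<le> Z" "Z \<le> X + Y"
  shows "1 / X * (1 / Y) \<le> 2 * Z powr (-3/4) * (X powr (-5/4) + Y powr (-5/4))"
proof -
  have main: "1 / X * (1 / Y) \<le> 2 * Z powr (-3/4) * Y powr (-5/4)"
    if "1 \<le> X" "1 \<le> Y" "1 \<le> Z" "Z \<le> X + Y" "Y \<le> X" for X Y :: real
  proof -
    have "1 / X * (1 / Y) = X powr (-3/4) * X powr (-1/4) * Y powr (-1)"
      using that by (simp add: powr_minus_divide flip: powr_add)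
    also have "\<dots> \<le> X powr (-3/4) * Y powr (-1/4) * Y powr (-1)"
      using that by (intro mult_right_mono mult_left_mono powr_mono2') auto
    also have "\<dots> = X powr (-3/4) * Y powr (-5/4)"
    proof -
      have "Y powr (-1/4) * Y powr (-1) = Y powr (-5/4)" by (subst powr_add[symmetric]) simp
      then show ?thesis by (simp only: mult.assoc)
    qed
    also have "X powr (-3/4) \<le> 2 * Z powr (-3/4)"
    proof -
      have "X powr (-3/4) \<le> (Z / 2) powr (-3/4)"
        by (rule powr_mono2') (use that in auto)
      also have "\<dots> = Z powr (-3/4) * 2 powr (3/4)"
        using that by (simp add: powr_divide powr_minus_divide)
      also have "\<dots> \<le> Z powr (-3/4) * 2 powr 1"
        by (intro mult_left_mono powr_mono) auto
      finally show ?thesis by simp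
    qed
    finally show ?thesis by (simp add: mult_right_mono)
  qed
  show ?thesis
  proof (cases "Y \<le> X")
    case True
    have "2 * Z powr (-3/4) * Y powr (-5/4) \<le> 2 * Z powr (-3/4) * (X powr (-5/4) + Y powr (-5/4))"
      by (intro mult_left_mono) auto
    with main[of X Y] True assms show ?thesis by linarith
  next
    case False
    have "2 * Z powr (-3/4) * X powr (-5/4) \<le> 2 * Z powr (-3/4) * (X powr (-5/4) + Y powr (-5/4))"
      by (intro mult_left_mono) auto
    moreover have "1 / X * (1 / Y) = 1 / Y * (1 / X)" by simp
    ultimately show ?thesis using main[of Y X] False assms by linarith
  qed
qed

text \<open>One factor 2 is that of \<open>inverse_product_powr_bound\<close>, the other comes from
  the two equal sums over \<open>j\<close> and \<open>k - j\<close>.\<close>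

definition conv_const :: real where
  "conv_const = 4 * (\<Sum>\<^sub>\<infinity>j. wt j powr (-5/4))"

lemma conv_const_nonneg: "0 \<le> conv_const"
  unfolding conv_const_def by (simp add: infsum_nonneg)

text \<open>Stated for absolute values, because \<open>energy_trilinear_zero\<close> needs an
  absolutely summable double series. The exponent stays below 1 because the convolution of
  \<open>1 / wt\<close> with itself carries a logarithm.\<close>

lemma conv_abs_decay:
  assumes B: "0 \<le> B" and a: "\<And>j. cmod (a j) \<le> B / wt j"
  shows "(\<Sum>\<^sub>\<infinity>j. cmod (a j * a (k - j))) \<le> B\<^sup>2 * conv_const * wt k powr (-3/4)"
proof -
  have sq: "sq_summable a" using sq_summable_if_weighted(1)[OF B a] .
  let ?M = "\<lambda>j. 2 * B\<^sup>2 * wt k powr (-3/4) * (wt j powr (-5/4) + wt (k - j) powr (-5/4))"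
  have s1: "(\<lambda>j. wt j powr (-5/4)) summable_on UNIV" by (rule summable_on_wt_powr) simp
  have s2: "(\<lambda>j. wt (k - j) powr (-5/4)) summable_on UNIV" by (rule summable_on_wt_powr_reflect) simp
  have e: "(\<Sum>\<^sub>\<infinity>j. wt (k - j) powr (-5/4)) = (\<Sum>\<^sub>\<infinity>j. wt j powr (-5/4))"
    by (rule infsum_reindex_bij_betw[OF bij_int_reflect])
  have "(\<Sum>\<^sub>\<infinity>j. cmod (a j * a (k - j))) \<le> infsum ?M UNIV"
  proof (rule infsum_mono[OF conv_abs_summable[OF sq sq]])
    show "?M summable_on UNIV" by (intro summable_on_cmult_right summable_on_add s1 s2)
    fix j
    have "cmod (a j * a (k - j)) \<le> (B / wt j) * (B / wt (k - j))"
      unfolding norm_mult using a B by (intro mult_mono) auto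
    also have "\<dots> = B\<^sup>2 * (1 / wt j * (1 / wt (k - j)))" by (simp add: power2_eq_square)
    also have "\<dots> \<le> B\<^sup>2 * (2 * wt k powr (-3/4) * (wt j powr (-5/4) + wt (k - j) powr (-5/4)))"
      by (intro mult_left_mono inverse_product_powr_bound wt_triangle) auto
    finally show "cmod (a j * a (k - j)) \<le> ?M j" by (simp add: mult_ac)
  qed
  also have "infsum ?M UNIV = 2 * B\<^sup>2 * wt k powr (-3/4) * (\<Sum>\<^sub>\<infinity>j. wt j powr (-5/4) + wt (k - j) powr (-5/4))"
    by (rule infsum_cmult_right')
  also have "(\<Sum>\<^sub>\<infinity>j. wt j powr (-5/4) + wt (k - j) powr (-5/4)) = conv_const / 2"
    unfolding infsum_add[OF s1 s2] e conv_const_def by simp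
  finally show ?thesis by (simp add: mult_ac)
qed

lemma conv_decay:
  assumes B: "0 \<le> B" and a: "\<And>j. cmod (a j) \<le> B / wt j"
  shows "cmod (conv a a k) \<le> B\<^sup>2 * conv_const * wt k powr (-3/4)"
proof -
  have sq: "sq_summable a" using sq_summable_if_weighted(1)[OF B a] .
  have "cmod (conv a a k) \<le> (\<Sum>\<^sub>\<infinity>j. cmod (a j * a (k - j)))"
    unfolding conv_def using conv_abs_summable[OF sq sq] by (rule norm_infsum_bound)
  with conv_abs_decay[OF B a, of k] show ?thesis by linarith
qed

lemma wt_powr_le_inverse: "s \<le> -1 \<Longrightarrow> wt k powr s \<le> 1 / wt k"
  using powr_mono[of s "-1" "wt k"] by (simp add: powr_minus_divide)

lemma conv_retract: "conv (retract \<rho> a) (retract \<rho> a) k = of_real ((cut \<rho> a)\<^sup>2) * conv a a k"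
  unfolding retract_def[abs_def] by (simp add: conv_mult)

text \<open>The exponent is -1 from the symbol plus -3/4 from \<open>conv_decay\<close>. The
  velocity decays faster than \<open>a\<close> is assumed to, so such decay of the initial data
  persists in time.\<close>

lemma cut_field_decay:
  assumes \<rho>: "0 < \<rho>" and B: "0 \<le> B" and a: "\<And>j. cmod (a j) \<le> B / wt j"
  shows "cmod (cut_field \<rho> a k) \<le> 2 * (B + B\<^sup>2 * conv_const) * wt k powr (-7/4)"
proof -
  have c: "cmod (conv (retract \<rho> a) (retract \<rho> a) k) \<le> B\<^sup>2 * conv_const * wt k powr (-3/4)"
  proof -
    have "\<bar>cut \<rho> a\<bar>\<^sup>2 \<le> 1" using cut_bounds[OF \<rho>, of a] by (intro power_le_one) auto
    then have "(cut \<rho> a)\<^sup>2 * cmod (conv a a k) \<le> 1 * cmod (conv a a k)"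
      by (intro mult_right_mono) auto
    then show ?thesis unfolding conv_retract norm_mult norm_of_real using conv_decay[OF B a, of k] by simp
  qed
  have e: "1 / wt k \<le> wt k powr (-3/4)"
    using powr_mono[of "-1" "-3/4" "wt k"] by (simp add: powr_minus_divide)
  have "\<bar>bbm_symbol k\<bar> \<le> 2 / wt k" using bbm_symbol_wt(2)[of k] by (simp add: field_simps)
  also have "\<dots> = 2 * wt k powr (-1)" by (simp add: powr_minus_divide)
  finally have p: "\<bar>bbm_symbol k\<bar> \<le> 2 * wt k powr (-1)" .
  have "cmod (cut_field \<rho> a k) = \<bar>bbm_symbol k\<bar> * cmod (a k + 1/2 * conv (retract \<rho> a) (retract \<rho> a) k)"
    unfolding cut_field_def norm_mult by simp
  also have "\<dots> \<le> (2 * wt k powr (-1)) * ((B + B\<^sup>2 * conv_const) * wt k powr (-3/4))"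
  proof (rule mult_mono[OF p])
    have "cmod (a k) \<le> B * wt k powr (-3/4)" using a[of k] mult_left_mono[OF e B] by simp
    then show "cmod (a k + 1/2 * conv (retract \<rho> a) (retract \<rho> a) k) \<le> (B + B\<^sup>2 * conv_const) * wt k powr (-3/4)"
      using norm_triangle_ineq[of "a k" "1/2 * conv (retract \<rho> a) (retract \<rho> a) k"] c
        norm_ge_zero[of "conv (retract \<rho> a) (retract \<rho> a) k"]
      by (simp add: norm_mult distrib_right del: norm_ge_zero)
  qed auto
  also have "\<dots> = 2 * (B + B\<^sup>2 * conv_const) * (wt k powr (-1) * wt k powr (-3/4))" by simp
  also have "wt k powr (-1) * wt k powr (-3/4) = wt k powr (-7/4)"
    by (subst powr_add[symmetric]) simp
  finally show ?thesis .
qed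

text \<open>
  This is \<open>\<integral> u\<^sub>x u\<^sup>2 = 0\<close> in Fourier variables: up to sign the summand is \<open>m * a m * a j * a l\<close> over
  \<open>m + j + l = 0\<close>, whose sum is invariant under permuting \<open>m, j, l\<close>.
\<close>

lemma energy_trilinear_zero:
  assumes B: "0 \<le> B" and a: "\<And>k. cmod (a k) \<le> B * wt k powr (-7/4)" and h: "\<And>k. a (-k) = cnj (a k)"
  shows "cmod (of_int k * cnj (a k) * conv a a k) \<le> B * (B\<^sup>2 * conv_const) * wt k powr (-3/2)"
    "(\<Sum>\<^sub>\<infinity>k. of_int k * cnj (a k) * conv a a k) = 0"
proof -
  have a1: "cmod (a k) \<le> B / wt k" for k
    using a[of k] mult_left_mono[OF wt_powr_le_inverse[of "-7/4" k] B] by simp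
  have sq: "sq_summable a" using sq_summable_if_weighted(1)[OF B a1] .
  \<comment> \<open>The factor \<open>k\<close> leaves -3/4 of the decay -7/4. Together with the
    -3/4 of the convolution the terms have order \<open>wt k powr (-3/2)\<close>, which is
    summable.\<close>
  have ka: "cmod (of_int k * cnj (a k)) \<le> B * wt k powr (-3/4)" for k
  proof -
    have "cmod (of_int k * cnj (a k)) \<le> wt k * (B * wt k powr (-7/4))"
      unfolding norm_mult complex_mod_cnj using a[of k] by (intro mult_mono) (auto simp: wt_def)
    also have "\<dots> = B * (wt k powr 1 * wt k powr (-7/4))" by simp
    also have "wt k powr 1 * wt k powr (-7/4) = wt k powr (-3/4)" by (subst powr_add[symmetric]) simp
    finally show ?thesis .
  qed
  have comb: "cmod (of_int k * cnj (a k)) * x \<le> B * (B\<^sup>2 * conv_const) * wt k powr (-3/2)"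
    if x: "x \<le> B\<^sup>2 * conv_const * wt k powr (-3/4)" "0 \<le> x" for k and x :: real
  proof -
    have "cmod (of_int k * cnj (a k)) * x \<le> (B * wt k powr (-3/4)) * (B\<^sup>2 * conv_const * wt k powr (-3/4))"
      using ka x B by (intro mult_mono) auto
    also have "\<dots> = B * (B\<^sup>2 * conv_const) * (wt k powr (-3/4) * wt k powr (-3/4))" by simp
    also have "wt k powr (-3/4) * wt k powr (-3/4) = wt k powr (-3/2)" by (subst powr_add[symmetric]) simp
    finally show ?thesis .
  qed
  show "cmod (of_int k * cnj (a k) * conv a a k) \<le> B * (B\<^sup>2 * conv_const) * wt k powr (-3/2)" for k
    using comb[OF conv_decay[OF B a1]] by (simp add: norm_mult)
  define G where "G = (\<lambda>(k, j). of_int k * cnj (a k) * (a j * a (k - j)))"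
  \<comment> \<open>Absolute summability over pairs gives the unordered summability needed for
    reindexing and for iterating the sum.\<close>
  have "(\<lambda>p. norm (G p)) summable_on Sigma UNIV (\<lambda>_. UNIV)"
  proof (rule Infinite_Sum.abs_summable_on_Sigma_iff[THEN iffD2], intro conjI ballI)
    have e: "norm (G (k, j)) = cmod (of_int k * cnj (a k)) * cmod (a j * a (k - j))" for k j
      unfolding G_def by (simp add: norm_mult)
    show "(\<lambda>j. norm (G (k, j))) summable_on UNIV" for k
      unfolding e by (intro summable_on_cmult_right conv_abs_summable sq)
    have "norm (\<Sum>\<^sub>\<infinity>j. norm (G (k, j))) \<le> B * (B\<^sup>2 * conv_const) * wt k powr (-3/2)" for k
      unfolding e infsum_cmult_right' using comb[OF conv_abs_decay[OF B a1]]
      by (simp add: infsum_nonneg abs_mult del: norm_mult)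
    moreover have "(\<lambda>k. B * (B\<^sup>2 * conv_const) * wt k powr (-3/2)) summable_on UNIV"
      by (intro summable_on_cmult_right summable_on_wt_powr) simp
    ultimately show "(\<lambda>k. norm (\<Sum>\<^sub>\<infinity>j. norm (G (k, j)))) summable_on UNIV"
      by (intro Infinite_Sum.abs_summable_on_comparison_test') auto
  qed
  then have "(\<lambda>p. norm (G p)) summable_on UNIV"
    by (simp only: UNIV_Times_UNIV)
  then have G: "G summable_on UNIV"
    by (rule abs_summable_summable)
  \<comment> \<open>In \<open>G (k, j)\<close> the frequencies \<open>- k\<close>, \<open>j\<close>
    and \<open>k - j\<close> add up to 0. The two maps permute them and carry the weight
    \<open>k\<close> into \<open>- j\<close> and \<open>j - k\<close>; the three weights
    cancel.\<close>
  let ?s = "\<lambda>(k::int, j::int). (-j, -k)" and ?r = "\<lambda>(k::int, j::int). (j - k, j)"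
  have bs: "bij ?s" by (rule bij_betw_byWitness[where f'="?s"]) auto
  have br: "bij ?r" by (rule bij_betw_byWitness[where f'="?r"]) auto
  have Gs: "(\<lambda>p. G (?s p)) summable_on UNIV" "infsum (\<lambda>p. G (?s p)) UNIV = infsum G UNIV"
    using summable_on_reindex_bij_betw[OF bs, of G] infsum_reindex_bij_betw[OF bs, of G] G by auto
  have Gr: "(\<lambda>p. G (?r p)) summable_on UNIV" "infsum (\<lambda>p. G (?r p)) UNIV = infsum G UNIV"
    using summable_on_reindex_bij_betw[OF br, of G] infsum_reindex_bij_betw[OF br, of G] G by auto
  have "G p + G (?s p) + G (?r p) = 0" for p
  proof -
    obtain k j where p: "p = (k, j)" by (cases p)
    have 1: "cnj (a k) = a (-k)" "cnj (a (-j)) = a j" "cnj (a (j - k)) = a (k - j)"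
      using h[of k] h[of "-j"] h[of "j - k"] by auto
    show ?thesis unfolding p G_def prod.case 1 by (simp add: algebra_simps)
  qed
  then have "0 = (\<Sum>\<^sub>\<infinity>p. G p + G (?s p) + G (?r p))" by simp
  also have "\<dots> = infsum G UNIV + infsum G UNIV + infsum G UNIV"
    by (simp only: infsum_add summable_on_add G Gs Gr)
  finally have z: "infsum G UNIV = 0" by simp
  have "(\<Sum>\<^sub>\<infinity>k. of_int k * cnj (a k) * conv a a k) = (\<Sum>\<^sub>\<infinity>k. \<Sum>\<^sub>\<infinity>j. G (k, j))"
    unfolding G_def prod.case infsum_cmult_right' conv_def ..
  also have "\<dots> = infsum G (UNIV \<times> UNIV)"
    using infsum_Sigma_banach[of G UNIV "\<lambda>_. UNIV"] G by simp
  finally show "(\<Sum>\<^sub>\<infinity>k. of_int k * cnj (a k) * conv a a k) = 0" using z by simp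
qed

section \<open>Energy of the truncated flow and removal of the cutoff\<close>

lemma vector_derivative_increment_bound:
  fixes f :: "real \<Rightarrow> 'a::real_normed_vector"
  assumes "\<And>s. \<bar>s\<bar> \<le> T \<Longrightarrow> (f has_vector_derivative f' s) (at s)" "\<And>s. \<bar>s\<bar> \<le> T \<Longrightarrow> norm (f' s) \<le> M"
    and "\<bar>s\<bar> \<le> T" "\<bar>t\<bar> \<le> T"
  shows "norm (f t - f s) \<le> M * \<bar>t - s\<bar>"
proof -
  have "norm (f t - f s) \<le> M * norm (t - s)"
  proof (rule differentiable_bound[where S="{-T..T}" and f'="\<lambda>s h. h *\<^sub>R f' s"])
    fix x assume x: "x \<in> {-T..T}"
    show "(f has_derivative (\<lambda>h. h *\<^sub>R f' x)) (at x within {-T..T})"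
      using assms(1)[of x] x unfolding has_vector_derivative_def by (auto intro: has_derivative_at_withinI)
    show "onorm (\<lambda>h. h *\<^sub>R f' x) \<le> M"
      by (rule onorm_le) (use assms(2)[of x] x in \<open>auto simp: mult.commute[of M] intro: mult_left_mono\<close>)
  qed (use assms(3,4) in auto)
  then show ?thesis by simp
qed

text \<open>Restricted to sets of modes, so that on finite ones differentiation in time is termwise;
  the total energy enters only through bounds uniform in \<open>F\<close>.\<close>

definition energy :: "(int \<Rightarrow> complex) \<Rightarrow> int set \<Rightarrow> real" where
  "energy a F = (\<Sum>k\<in>F. (1 + (of_int k)\<^sup>2) * (cmod (a k))\<^sup>2)"

lemma energy_mono: "F \<subseteq> F' \<Longrightarrow> finite F' \<Longrightarrow> energy a F \<le> energy a F'"
  unfolding energy_def by (rule sum_mono2) auto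

text \<open>The linear term is an imaginary multiple of \<open>a t k\<close>, hence orthogonal to
  it. The weight 1 + k^2 cancels the denominator of \<open>bbm_symbol\<close> and leaves the factor
  \<open>k\<close>; the 1/2 cancels the 2 from differentiating a square.\<close>

lemma energy_has_derivative:
  assumes "\<And>k. ((\<lambda>t. a t k) has_vector_derivative cut_field \<rho> (a t) k) (at t)"
  shows "((\<lambda>t. energy (a t) F) has_vector_derivative
     (cut \<rho> (a t))\<^sup>2 * Im (\<Sum>k\<in>F. of_int k * cnj (a t k) * conv (a t) (a t) k)) (at t)"
proof -
  have k: "((\<lambda>t. (1 + (of_int k)\<^sup>2) * (cmod (a t k))\<^sup>2) has_vector_derivative
     (cut \<rho> (a t))\<^sup>2 * Im (of_int k * cnj (a t k) * conv (a t) (a t) k)) (at t)" for k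
  proof -
    let ?d = "cut_field \<rho> (a t) k"
    have p: "1 + (real_of_int k)\<^sup>2 \<noteq> 0" by (simp add: add_nonneg_eq_0_iff)
    have "((\<lambda>t. (1 + (of_int k)\<^sup>2) * (a t k \<bullet> a t k)) has_vector_derivative
       (1 + (of_int k)\<^sup>2) * (a t k \<bullet> ?d + ?d \<bullet> a t k)) (at t)"
      by (intro has_vector_derivative_mult_right bounded_bilinear.has_vector_derivative[OF bounded_bilinear_inner] assms)
    moreover have "(1 + (of_int k)\<^sup>2) * (a t k \<bullet> ?d + ?d \<bullet> a t k)
        = (cut \<rho> (a t))\<^sup>2 * Im (of_int k * cnj (a t k) * conv (a t) (a t) k)"
    proof -
      have "a t k \<bullet> ?d = bbm_symbol k * ((cut \<rho> (a t))\<^sup>2 / 2 * Im (cnj (a t k) * conv (a t) (a t) k))"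
        unfolding cut_field_def conv_retract by (simp add: inner_complex_def algebra_simps)
      then show ?thesis unfolding bbm_symbol_def using p by (simp add: inner_commute field_simps)
    qed
    ultimately show ?thesis by (simp add: power2_norm_eq_inner)
  qed
  show ?thesis
    unfolding energy_def Im_sum sum_distrib_left by (rule has_vector_derivative_sum) (rule k)
qed

text \<open>By \<open>energy_trilinear_zero\<close> the derivative of the energy in a symmetric
  window is, up to the factor from \<open>cut\<close>, a partial sum of a series with sum 0, hence
  bounded by a tail. The tails tend to 0 uniformly on the time interval. The cutoff is harmless
  since its squared factor is common to all modes and at most 1.\<close>

lemma energy_bound:
  assumes \<rho>: "0 < \<rho>" and d: "\<And>t k. ((\<lambda>t. a t k) has_vector_derivative cut_field \<rho> (a t) k) (at t)"
    and B: "\<And>T. 0 < T \<Longrightarrow> \<exists>B\<ge>0. \<forall>t k. \<bar>t\<bar> \<le> T \<longrightarrow> cmod (a t k) \<le> B / wt k"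
    and h: "\<And>t k. a t (-k) = cnj (a t k)"
    and V: "0 \<le> V" "\<And>k. cmod (a 0 k) \<le> V * wt k powr (-7/4)"
    and E: "\<And>F. finite F \<Longrightarrow> energy (a 0) F \<le> E" and F: "finite F"
  shows "energy (a t) F \<le> E"
proof -
  define T where "T = \<bar>t\<bar> + 1"
  have "0 < T" unfolding T_def by simp
  obtain B where B0: "0 \<le> B" and B: "\<And>t k. \<bar>t\<bar> \<le> T \<Longrightarrow> cmod (a t k) \<le> B / wt k"
    using B[of T] \<open>0 < T\<close> by blast
  \<comment> \<open>Initial decay plus \<open>T\<close> times the velocity bound of
    \<open>cut_field_decay\<close>.\<close>
  define C where "C = V + 2 * (B + B\<^sup>2 * conv_const) * T"
  have T0: "0 \<le> T" unfolding T_def by simp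
  have C0: "0 \<le> C" unfolding C_def using V(1) B0 conv_const_nonneg T0 by simp
  have dec: "cmod (a s k) \<le> C * wt k powr (-7/4)" if s: "\<bar>s\<bar> \<le> T" for s k
  proof -
    have "cmod (a s k - a 0 k) \<le> 2 * (B + B\<^sup>2 * conv_const) * wt k powr (-7/4) * \<bar>s - 0\<bar>"
    proof (rule vector_derivative_increment_bound[OF d, where T=T])
      show "cmod (cut_field \<rho> (a s) k) \<le> 2 * (B + B\<^sup>2 * conv_const) * wt k powr (-7/4)" if "\<bar>s\<bar> \<le> T" for s
        by (rule cut_field_decay[OF \<rho> B0 B[OF that]])
    qed (use s T0 in auto)
    also have "\<dots> \<le> 2 * (B + B\<^sup>2 * conv_const) * wt k powr (-7/4) * T"
      using s B0 conv_const_nonneg by (intro mult_left_mono) auto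
    finally show ?thesis using V(2)[of k] norm_triangle_ineq2[of "a s k" "a 0 k"]
      unfolding C_def by (simp add: algebra_simps)
  qed
  \<comment> \<open>The majorant of \<open>energy_trilinear_zero\<close>, the same for all times up
    to \<open>T\<close>.\<close>
  define g where "g k = C * (C\<^sup>2 * conv_const) * wt k powr (-3/2)" for k
  have g: "g summable_on UNIV" unfolding g_def
    by (intro summable_on_cmult_right summable_on_wt_powr) simp
  define \<delta> where "\<delta> N = infsum g UNIV - (\<Sum>k\<in>{-int N..int N}. g k)" for N
  have "\<delta> \<longlonglongrightarrow> 0" unfolding \<delta>_def by (rule summable_on_int_tail[OF g])
  have EN: "energy (a t) {-int N..int N} \<le> E + \<delta> N * \<bar>t\<bar>" for N
  proof -
    have "norm (energy (a t) {-int N..int N} - energy (a 0) {-int N..int N}) \<le> \<delta> N * \<bar>t - 0\<bar>"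
    proof (rule vector_derivative_increment_bound[OF energy_has_derivative[OF d], where T=T])
      fix s assume s: "\<bar>s\<bar> \<le> T"
      let ?S = "\<Sum>k\<in>{-int N..int N}. of_int k * cnj (a s k) * conv (a s) (a s) k"
      have "cmod ?S \<le> \<delta> N"
        using infsum_int_tail_le[OF g, of "\<lambda>k. of_int k * cnj (a s k) * conv (a s) (a s) k" "{-int N..int N}"]
          energy_trilinear_zero[OF C0 dec[OF s] h]
        unfolding \<delta>_def g_def by simp
      moreover have "(cut \<rho> (a s))\<^sup>2 * \<bar>Im ?S\<bar> \<le> 1 * cmod ?S"
        using cut_bounds[OF \<rho>, of "a s"] by (intro mult_mono power_le_one abs_Im_le_cmod) auto
      ultimately show "norm ((cut \<rho> (a s))\<^sup>2 * Im ?S) \<le> \<delta> N" by (simp add: abs_mult)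
    qed (auto simp: T_def)
    then show ?thesis using E[of "{-int N..int N}"] by (simp add: abs_le_iff)
  qed
  have "(\<lambda>N. E + \<delta> N * \<bar>t\<bar>) \<longlonglongrightarrow> E + 0 * \<bar>t\<bar>"
    by (intro tendsto_intros) fact
  moreover have "\<forall>\<^sub>F N in sequentially. energy (a t) F \<le> E + \<delta> N * \<bar>t\<bar>"
  proof -
    define M where "M = (if F = {} then 0 else Max (abs ` F))"
    have M: "\<bar>k\<bar> \<le> M" if "k \<in> F" for k unfolding M_def using F that by auto
    show ?thesis
      using eventually_ge_at_top[of "nat M"]
    proof eventually_elim
      case (elim N)
      have "F \<subseteq> {-int N..int N}" using M elim by fastforce
      then have "energy (a t) F \<le> energy (a t) {-int N..int N}" by (rule energy_mono) simp
      with EN[of N] show ?case by linarith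
    qed
  qed
  ultimately show ?thesis by (simp add: tendsto_lowerbound)
qed

text \<open>The energy bound keeps the \<open>l2_norm\<close> within the cutoff radius, so the
  truncated solution solves the true equation. The energy also bounds each mode uniformly in time,
  which makes \<open>C\<close> independent of time.\<close>

lemma bbm_coefficients_exist:
  assumes V: "0 \<le> V" "\<And>k. cmod (v k) \<le> V * wt k powr (-7/4)"
    and E: "\<And>F. finite F \<Longrightarrow> energy v F \<le> E"
    and h: "\<And>k. v (-k) = cnj (v k)" and s: "\<And>k. \<not> m dvd k \<Longrightarrow> v k = 0"
  obtains a C where "0 \<le> C" "a 0 = v"
    "\<And>t k. ((\<lambda>t. a t k) has_vector_derivative
        - \<i> * of_real (bbm_symbol k) * (a t k + 1 / 2 * conv (a t) (a t) k)) (at t)"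
    "\<And>t k. a t (-k) = cnj (a t k)" "\<And>t k. \<not> m dvd k \<Longrightarrow> a t k = 0"
    "\<And>t F. finite F \<Longrightarrow> energy (a t) F \<le> E"
    "\<And>t k. cmod (a t k) \<le> (V + C * \<bar>t\<bar>) * wt k powr (-7/4)"
    "\<And>s t k. cmod (a t k - a s k) \<le> C * \<bar>t - s\<bar> * wt k powr (-7/4)"
proof -
  have E0: "0 \<le> E" using E[of "{}"] by (simp add: energy_def)
  \<comment> \<open>The energy weights are at least 1, so the \<open>l2_norm\<close> is at most
    \<open>sqrt E\<close>; the 1 keeps the radius positive when \<open>E = 0\<close>.\<close>
  define \<rho> where "\<rho> = sqrt E + 1"
  have \<rho>: "0 < \<rho>" unfolding \<rho>_def using E0 by (simp add: add_nonneg_pos)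
  have V1: "cmod (v k) \<le> V / wt k" for k
    using V(2)[of k] mult_left_mono[OF wt_powr_le_inverse[of "-7/4" k] V(1)] by simp
  obtain a where a0: "a 0 = v"
    and d: "\<And>t k. ((\<lambda>t. a t k) has_vector_derivative cut_field \<rho> (a t) k) (at t)"
    and bd: "\<And>T. 0 < T \<Longrightarrow> \<exists>B\<ge>0. \<forall>t k. \<bar>t\<bar> \<le> T \<longrightarrow> cmod (a t k) \<le> B / wt k"
    and ha: "\<And>t k. a t (-k) = cnj (a t k)" and sa: "\<And>t k. \<not> m dvd k \<Longrightarrow> a t k = 0"
    by (rule cut_field_ode_exists[where v=v and m=m, OF \<rho> V1 h s]) (assumption | rule that)+
  have EF: "energy (a t) F \<le> E" if "finite F" for t F
    by (rule energy_bound[OF \<rho> d bd ha V(1) _ _ that]) (use V(2) E a0 in auto)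
  have L: "L2_set (\<lambda>k. cmod (a t k)) F \<le> sqrt E" if "finite F" for t F
  proof -
    have "(\<Sum>k\<in>F. (cmod (a t k))\<^sup>2) \<le> energy (a t) F"
      unfolding energy_def by (intro sum_mono) (simp add: distrib_right)
    also have "\<dots> \<le> E" by (rule EF[OF that])
    finally show ?thesis unfolding L2_set_def by simp
  qed
  have "l2_norm (a t) \<le> sqrt E" for t using sq_summableI_bounded(2)[OF L] .
  then have "l2_norm (a t) \<le> \<rho>" for t unfolding \<rho>_def by (simp add: add_increasing2)
  then have "cut \<rho> (a t) = 1" for t
    using \<rho> unfolding cut_def by (simp add: max.absorb1)
  then have r: "retract \<rho> (a t) = a t" for t by (intro ext) (simp add: retract_def)
  \<comment> \<open>From the energy of the single mode \<open>k\<close> and (1 + |k|)^2 \<le> 2 (1 +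
    k^2).\<close>
  define B where "B = sqrt (2 * E)"
  have B0: "0 \<le> B" unfolding B_def using E0 by simp
  have B: "cmod (a t k) \<le> B / wt k" for t k
  proof -
    have "(1 + (of_int k)\<^sup>2) * (cmod (a t k))\<^sup>2 \<le> E" using EF[of "{k}" t] by (simp add: energy_def)
    moreover have "(wt k)\<^sup>2 \<le> 2 * (1 + (of_int k)\<^sup>2)"
    proof -
      have "0 \<le> (\<bar>real_of_int k\<bar> - 1)\<^sup>2" by simp
      then show ?thesis unfolding wt_def by (simp add: power2_eq_square algebra_simps)
    qed
    then have "(wt k)\<^sup>2 * (cmod (a t k))\<^sup>2 \<le> 2 * (1 + (of_int k)\<^sup>2) * (cmod (a t k))\<^sup>2"
      by (rule mult_right_mono) simp
    ultimately have "(wt k * cmod (a t k))\<^sup>2 \<le> 2 * E"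
      unfolding power_mult_distrib mult.assoc by linarith
    then have "wt k * cmod (a t k) \<le> B" unfolding B_def by (rule real_le_rsqrt)
    then show ?thesis by (simp add: field_simps)
  qed
  define C where "C = 2 * (B + B\<^sup>2 * conv_const)"
  have C0: "0 \<le> C" unfolding C_def using B0 conv_const_nonneg by simp
  have inc: "cmod (a t k - a s k) \<le> C * \<bar>t - s\<bar> * wt k powr (-7/4)" for s t k
  proof -
    have "cmod (a t k - a s k) \<le> (C * wt k powr (-7/4)) * \<bar>t - s\<bar>"
    proof (rule vector_derivative_increment_bound[OF d, where T="max \<bar>s\<bar> \<bar>t\<bar>"])
      show "cmod (cut_field \<rho> (a s) k) \<le> C * wt k powr (-7/4)" for s
        unfolding C_def by (rule cut_field_decay[OF \<rho> B0 B])
    qed auto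
    then show ?thesis by (simp add: mult_ac)
  qed
  show thesis
  proof (rule that[OF C0 a0 _ ha sa EF _ inc])
    show "((\<lambda>t. a t k) has_vector_derivative
        - \<i> * of_real (bbm_symbol k) * (a t k + 1 / 2 * conv (a t) (a t) k)) (at t)" for t k
      using d[of k t] unfolding cut_field_def r .
    show "cmod (a t k) \<le> (V + C * \<bar>t\<bar>) * wt k powr (-7/4)" for t k
      using inc[of t k 0] V(2)[of k] norm_triangle_ineq2[of "a t k" "a 0 k"]
      unfolding a0 by (simp add: algebra_simps)
  qed
qed

section \<open>Fourier coefficients of square integrable functions\<close>

definition circ :: "real measure" where
  "circ = restrict_space lborel {0..2 * pi}"

lemma space_circ: "space circ = {0..2 * pi}"
  unfolding circ_def by (simp add: space_restrict_space)

lemma set_integral_circ: "(LINT x:{0..2 * pi}|lborel. f x) = (LINT x|circ. f x)"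
  for f :: "real \<Rightarrow> 'a::{banach, second_countable_topology}"
  unfolding circ_def set_lebesgue_integral_def by (subst integral_restrict_space) auto

lemma set_integrable_circ: "set_integrable lborel {0..2 * pi} f \<longleftrightarrow> integrable circ f"
  for f :: "real \<Rightarrow> 'a::{banach, second_countable_topology}"
  unfolding circ_def by (rule set_integrable_eq) simp

lemma measurable_circ: "f \<in> borel_measurable borel \<Longrightarrow> f \<in> borel_measurable circ"
  unfolding circ_def by (simp add: measurable_restrict_space1)

lemma finite_measure_circ: "finite_measure circ"
  by (rule finite_measureI) (simp add: circ_def emeasure_restrict_space space_restrict_space)

lemma measure_circ: "measure circ (space circ) = 2 * pi"
  unfolding circ_def by (simp add: measure_restrict_space space_restrict_space)

lemma integrable_circ_const: "integrable circ (\<lambda>_. c)"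
  for c :: "'a::{banach, second_countable_topology}"
  using finite_measure.integrable_const[OF finite_measure_circ] .

lemma integrable_circ_continuous:
  fixes f :: "real \<Rightarrow> 'a::{banach, second_countable_topology}"
  assumes "continuous_on {0..2 * pi} f"
  shows "integrable circ f"
  using borel_integrable_atLeastAtMost'[OF assms] set_integrable_circ by blast

text \<open>All integrals run over one period, so periodicity is split off, as recorded in
  \<open>L2_torus_iff\<close>.\<close>

definition sq_int :: "(real \<Rightarrow> real) \<Rightarrow> bool" where
  "sq_int u \<longleftrightarrow> u \<in> borel_measurable borel \<and> integrable circ (\<lambda>x. (u x)\<^sup>2)"

lemma L2_torus_iff: "u \<in> L2_torus \<longleftrightarrow> sq_int u \<and> (\<forall>x. u (x + 2 * pi) = u x)"
  unfolding L2_torus_def sq_int_def set_integrable_circ by auto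

lemma sq_int_borel: "sq_int u \<Longrightarrow> u \<in> borel_measurable borel"
  and sq_int_measurable: "sq_int u \<Longrightarrow> u \<in> borel_measurable circ"
  unfolding sq_int_def by (auto intro: measurable_circ)

lemma sq_int_mult:
  assumes "sq_int u" "sq_int v"
  shows "integrable circ (\<lambda>x. u x * v x)"
proof (rule Bochner_Integration.integrable_bound)
  show "integrable circ (\<lambda>x. (u x)\<^sup>2 + (v x)\<^sup>2)" using assms by (auto simp: sq_int_def)
  show "(\<lambda>x. u x * v x) \<in> borel_measurable circ"
    using assms[THEN sq_int_measurable] by measurable
  have "\<bar>u x * v x\<bar> \<le> (u x)\<^sup>2 + (v x)\<^sup>2" for x
    using sum_squares_bound[of "\<bar>u x\<bar>" "\<bar>v x\<bar>"] mult_nonneg_nonneg[OF abs_ge_zero abs_ge_zero, of "u x" "v x"]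
    unfolding abs_mult power2_abs mult.assoc[of 2] by linarith
  then show "AE x in circ. norm (u x * v x) \<le> norm ((u x)\<^sup>2 + (v x)\<^sup>2)" by simp
qed

lemma sq_int_const: "sq_int (\<lambda>_. c)"
  unfolding sq_int_def using integrable_circ_const by auto

lemma sq_int_integrable: "sq_int u \<Longrightarrow> integrable circ u"
  using sq_int_mult[OF _ sq_int_const[of 1]] by simp

lemma sq_int_cmult: "sq_int u \<Longrightarrow> sq_int (\<lambda>x. c * u x)"
  unfolding sq_int_def by (auto simp: power_mult_distrib)

lemma sq_int_add: assumes "sq_int u" "sq_int v" shows "sq_int (\<lambda>x. u x + v x)"
  unfolding sq_int_def power2_sum using assms sq_int_mult[OF assms]
  by (auto simp: sq_int_def mult.assoc)

lemma sq_int_diff: assumes "sq_int u" "sq_int v" shows "sq_int (\<lambda>x. u x - v x)"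
  using sq_int_add[OF assms(1) sq_int_cmult[OF assms(2), of "-1"]] by simp

lemma sq_int_sum: "(\<And>i. i \<in> I \<Longrightarrow> sq_int (f i)) \<Longrightarrow> sq_int (\<lambda>x. \<Sum>i\<in>I. f i x)"
  by (induction I rule: infinite_finite_induct) (auto intro: sq_int_const sq_int_add)

lemma sq_int_continuous: assumes "continuous_on UNIV u" shows "sq_int u"
  unfolding sq_int_def
  by (intro conjI borel_measurable_continuous_onI integrable_circ_continuous assms continuous_intros
      continuous_on_subset[OF assms]) auto

definition L2_norm :: "(real \<Rightarrow> real) \<Rightarrow> real" where
  "L2_norm u = sqrt (LINT x|circ. (u x)\<^sup>2)"

lemma L2_norm_nonneg [simp]: "0 \<le> L2_norm u"
  unfolding L2_norm_def by simp

lemma L2_norm_sq: "(L2_norm u)\<^sup>2 = (LINT x|circ. (u x)\<^sup>2)"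
  unfolding L2_norm_def by simp

text \<open>The integral of the square of |u| - l |v| is a nonnegative quadratic in l. The absolute
  value stands inside the integral because \<open>fourier_mult_bound\<close> needs an L^1 bound on
  the product.\<close>

lemma L2_Cauchy_Schwarz:
  assumes u: "sq_int u" and v: "sq_int v"
  shows "(LINT x|circ. \<bar>u x * v x\<bar>) \<le> L2_norm u * L2_norm v"
proof -
  define A where "A = (LINT x|circ. (u x)\<^sup>2)"
  define B where "B = (LINT x|circ. (v x)\<^sup>2)"
  define C where "C = (LINT x|circ. \<bar>u x * v x\<bar>)"
  have iu: "integrable circ (\<lambda>x. (u x)\<^sup>2)" and iv: "integrable circ (\<lambda>x. (v x)\<^sup>2)"
    and iuv: "integrable circ (\<lambda>x. \<bar>u x * v x\<bar>)"
    using u v sq_int_mult[OF u v] by (auto simp: sq_int_def)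
  have A0: "0 \<le> A" "0 \<le> B" unfolding A_def B_def by auto
  have quad: "0 \<le> A - 2 * l * C + l\<^sup>2 * B" for l
  proof -
    have "0 \<le> (LINT x|circ. (\<bar>u x\<bar> - l * \<bar>v x\<bar>)\<^sup>2)" by simp
    also have "(\<lambda>x. (\<bar>u x\<bar> - l * \<bar>v x\<bar>)\<^sup>2) = (\<lambda>x. (u x)\<^sup>2 - 2 * l * \<bar>u x * v x\<bar> + l\<^sup>2 * (v x)\<^sup>2)"
      by (auto simp: power2_diff power_mult_distrib abs_mult)
    also have "(LINT x|circ. (u x)\<^sup>2 - 2 * l * \<bar>u x * v x\<bar> + l\<^sup>2 * (v x)\<^sup>2) = A - 2 * l * C + l\<^sup>2 * B"
      unfolding A_def B_def C_def using iu iv iuv by simp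
    finally show ?thesis .
  qed
  have "C\<^sup>2 \<le> A * B"
  proof (cases "B = 0")
    case True
    have "C = 0"
    proof (rule ccontr)
      assume "C \<noteq> 0"
      \<comment> \<open>For \<open>B = 0\<close> the quadratic is affine in \<open>l\<close>; this
        \<open>l\<close> gives it the value -1.\<close>
      then show False using quad[of "(A + 1) / (2 * C)"] True by (simp add: field_simps)
    qed
    then show ?thesis using True by simp
  next
    case False
    \<comment> \<open>\<open>C / B\<close> minimises the quadratic.\<close>
    then show ?thesis using quad[of "C / B"] A0 by (simp add: field_simps power2_eq_square)
  qed
  then have "C \<le> sqrt (A * B)" by (rule real_le_rsqrt)
  then show ?thesis unfolding L2_norm_def A_def B_def C_def by (simp add: real_sqrt_mult)
qed

section \<open>Fourier coefficients and Bessel's identity\<close>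

lemma integrable_mult_cis:
  assumes "integrable circ u"
  shows "integrable circ (\<lambda>x. complex_of_real (u x) * cis (c * x))"
proof (rule Bochner_Integration.integrable_bound[OF assms])
  have "(\<lambda>x. cis (c * x)) \<in> borel_measurable circ"
    by (intro measurable_circ borel_measurable_continuous_onI continuous_intros)
  with assms show "(\<lambda>x. complex_of_real (u x) * cis (c * x)) \<in> borel_measurable circ"
    by measurable
qed (simp add: norm_mult)

lemma fourier_circ: "fourier u k = (LINT x|circ. complex_of_real (u x) * cis (- (of_int k * x))) / complex_of_real (2 * pi)"
  unfolding fourier_def set_integral_circ ..

lemma integrable_fourier:
  "integrable circ u \<Longrightarrow> integrable circ (\<lambda>x. complex_of_real (u x) * cis (- (of_int k * x)))"
  using integrable_mult_cis[of u "- of_int k"] by simp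

lemma fourier_add:
  assumes "integrable circ u" "integrable circ v"
  shows "fourier (\<lambda>x. u x + v x) k = fourier u k + fourier v k"
  unfolding fourier_circ using assms[THEN integrable_fourier]
  by (simp add: distrib_right add_divide_distrib)

lemma fourier_diff:
  assumes "integrable circ u" "integrable circ v"
  shows "fourier (\<lambda>x. u x - v x) k = fourier u k - fourier v k"
  unfolding fourier_circ using assms[THEN integrable_fourier]
  by (simp add: left_diff_distrib diff_divide_distrib)

lemma fourier_sum:
  assumes "finite I" "\<And>i. i \<in> I \<Longrightarrow> integrable circ (f i)"
  shows "fourier (\<lambda>x. \<Sum>i\<in>I. f i x) k = (\<Sum>i\<in>I. fourier (f i) k)"
  using assms
proof (induction I)
  case empty
  show ?case by (simp add: fourier_circ)
next
  case (insert i I)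
  then show ?case by (simp add: fourier_add Bochner_Integration.integrable_sum)
qed

lemma fourier_uminus: "fourier u (-k) = cnj (fourier u k)"
proof -
  have "cnj (fourier u k) = (LINT x|circ. cnj (complex_of_real (u x) * cis (- (of_int k * x)))) / complex_of_real (2 * pi)"
    unfolding fourier_circ by (subst Bochner_Integration.integral_cnj) simp
  then show ?thesis unfolding fourier_circ by (simp add: cis_cnj)
qed

lemma fourier_bound:
  assumes "integrable circ u"
  shows "cmod (fourier u k) \<le> (LINT x|circ. \<bar>u x\<bar>) / (2 * pi)"
proof -
  have "cmod (LINT x|circ. complex_of_real (u x) * cis (- (of_int k * x))) \<le> (LINT x|circ. \<bar>u x\<bar>)"
    using integral_norm_bound[of circ "\<lambda>x. complex_of_real (u x) * cis (- (of_int k * x))"]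
    by (simp add: norm_mult)
  then show ?thesis unfolding fourier_circ by (simp add: norm_divide divide_right_mono)
qed

lemma fourier_mult_bound:
  assumes "sq_int u" "sq_int v"
  shows "cmod (fourier (\<lambda>x. u x * v x) k) \<le> L2_norm u * L2_norm v / (2 * pi)"
  using fourier_bound[OF sq_int_mult[OF assms], of k] L2_Cauchy_Schwarz[OF assms]
    divide_right_mono[OF L2_Cauchy_Schwarz[OF assms], of "2 * pi"] by simp

lemma cis_orthogonal: "(LINT x|circ. cis (of_int k * x)) = (if k = 0 then 2 * pi else 0)"
proof (cases "k = 0")
  case True
  then show ?thesis using measure_circ by (simp add: scaleR_conv_of_real)
next
  case False
  have "((\<lambda>x. cis (of_int k * x)) has_integral
      (cis (of_int k * (2 * pi)) / (\<i> * of_int k) - cis (of_int k * 0) / (\<i> * of_int k))) {0..2 * pi}"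
  proof (rule fundamental_theorem_of_calculus)
    fix x :: real
    have "((\<lambda>x. cis (of_int k * x)) has_vector_derivative (of_int k *\<^sub>R (\<i> * cis (of_int k * x)))) (at x within {0..2 * pi})"
    proof -
      have "((\<lambda>x. cis x) has_vector_derivative (\<i> * cis y)) (at y within S)" for y S
        using has_derivative_cis[OF has_derivative_ident, of y S]
        by (simp add: has_vector_derivative_def)
      then show ?thesis
        using vector_diff_chain_within[of "\<lambda>x. of_int k * x" "of_int k" x "{0..2 * pi}" cis "\<i> * cis (of_int k * x)"]
        by (auto simp: o_def intro!: derivative_eq_intros simp: has_real_derivative_iff_has_vector_derivative[symmetric])
    qed
    from has_vector_derivative_divide[OF this, of "\<i> * of_int k"]
    show "((\<lambda>x. cis (of_int k * x) / (\<i> * of_int k)) has_vector_derivative cis (of_int k * x)) (at x within {0..2 * pi})"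
      using False by (simp add: scaleR_conv_of_real)
  qed simp
  then have "integral {0..2 * pi} (\<lambda>x. cis (of_int k * x)) = 0"
    using cis_multiple_2pi[of "of_int k"] by (simp add: integral_unique mult.commute)
  moreover have "(LINT x:{0..2 * pi}|lborel. cis (of_int k * x)) = integral {0..2 * pi} (\<lambda>x. cis (of_int k * x))"
    by (rule set_borel_integral_eq_integral) (intro borel_integrable_atLeastAtMost' continuous_intros)
  ultimately show ?thesis using False by (simp add: set_integral_circ)
qed

text \<open>Expanding the square and completing it in \<open>c\<close>. The choice
  \<open>c = fourier u\<close> gives Bessel's inequality, while general \<open>c\<close> is needed
  to compare with an approximating trigonometric polynomial.\<close>

lemma Bessel_identity:
  assumes u: "sq_int u" and F: "finite F"
  shows "(LINT x|circ. (cmod (of_real (u x) - (\<Sum>k\<in>F. c k * cis (of_int k * x))))\<^sup>2)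
    = (L2_norm u)\<^sup>2 + 2 * pi * (\<Sum>k\<in>F. (cmod (c k - fourier u k))\<^sup>2) - 2 * pi * (\<Sum>k\<in>F. (cmod (fourier u k))\<^sup>2)"
proof -
  let ?T = "\<lambda>x. \<Sum>k\<in>F. c k * cis (of_int k * x)"
  let ?U = "\<lambda>x. complex_of_real (u x)"
  have iu: "integrable circ u" by (rule sq_int_integrable[OF u])
  have pw: "complex_of_real ((cmod (?U x - ?T x))\<^sup>2) = complex_of_real ((u x)\<^sup>2)
      - (\<Sum>k\<in>F. cnj (c k) * (?U x * cis (- (of_int k * x))))
      - (\<Sum>k\<in>F. c k * (?U x * cis (of_int k * x)))
      + (\<Sum>k\<in>F. \<Sum>l\<in>F. c k * cnj (c l) * cis (of_int (k - l) * x))" for x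
  proof -
    have "complex_of_real ((cmod (?U x - ?T x))\<^sup>2) = (?U x - ?T x) * (?U x - cnj (?T x))"
      by (simp only: complex_norm_square complex_cnj_diff complex_cnj_complex_of_real)
    also have "\<dots> = ?U x * ?U x - ?U x * cnj (?T x) - ?T x * ?U x + ?T x * cnj (?T x)"
      by (simp only: left_diff_distrib right_diff_distrib) simp
    also have "?U x * cnj (?T x) = (\<Sum>k\<in>F. cnj (c k) * (?U x * cis (- (of_int k * x))))"
      unfolding cnj_sum sum_distrib_left by (simp add: cis_cnj mult_ac)
    also have "?T x * ?U x = (\<Sum>k\<in>F. c k * (?U x * cis (of_int k * x)))"
      unfolding sum_distrib_right by (simp add: mult_ac)
    also have "?T x * cnj (?T x) = (\<Sum>k\<in>F. \<Sum>l\<in>F. c k * cnj (c l) * cis (of_int (k - l) * x))"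
    proof -
      have "c k * cis (of_int k * x) * cnj (c l * cis (of_int l * x)) = c k * cnj (c l) * cis (of_int (k - l) * x)" for k l
        using cis_mult[of "of_int k * x" "- (of_int l * x)"] by (simp add: cis_cnj left_diff_distrib)
      then show ?thesis by (simp only: cnj_sum sum_product)
    qed
    finally show ?thesis by (simp add: power2_eq_square)
  qed
  have i1: "integrable circ (\<lambda>x. complex_of_real ((u x)\<^sup>2))"
    using u unfolding sq_int_def complex_of_real_integrable_eq by blast
  have i2: "integrable circ (\<lambda>x. cnj (c k) * (?U x * cis (- (of_int k * x))))" for k
    using integrable_fourier[OF iu] by simp
  have i3: "integrable circ (\<lambda>x. c k * (?U x * cis (of_int k * x)))" for k
    using integrable_mult_cis[OF iu] by simp
  have i4: "integrable circ (\<lambda>x. c k * cnj (c l) * cis (of_int (k - l) * x))" for k l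
    by (intro integrable_circ_continuous continuous_intros)
  have e2: "(LINT x|circ. ?U x * cis (- (of_int k * x))) = 2 * pi * fourier u k" for k
    by (simp add: fourier_circ)
  have e3: "(LINT x|circ. ?U x * cis (of_int k * x)) = 2 * pi * cnj (fourier u k)" for k
    using e2[of "-k"] by (simp add: fourier_uminus)
  have "complex_of_real (LINT x|circ. (cmod (?U x - ?T x))\<^sup>2)
      = (LINT x|circ. complex_of_real ((cmod (?U x - ?T x))\<^sup>2))"
    by (rule integral_complex_of_real[symmetric])
  also have "\<dots> = (LINT x|circ. complex_of_real ((u x)\<^sup>2))
      - (\<Sum>k\<in>F. cnj (c k) * (LINT x|circ. ?U x * cis (- (of_int k * x))))
      - (\<Sum>k\<in>F. c k * (LINT x|circ. ?U x * cis (of_int k * x)))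
      + (\<Sum>k\<in>F. \<Sum>l\<in>F. c k * cnj (c l) * (LINT x|circ. cis (of_int (k - l) * x)))"
    unfolding pw
    using i1 i2 i3 i4
    by (simp only: Bochner_Integration.integral_add Bochner_Integration.integral_diff
        Bochner_Integration.integral_sum Bochner_Integration.integrable_add
        Bochner_Integration.integrable_diff Bochner_Integration.integrable_sum
        integral_mult_right_zero)
  also have "\<dots> = complex_of_real ((L2_norm u)\<^sup>2)
      - 2 * pi * (\<Sum>k\<in>F. cnj (c k) * fourier u k) - 2 * pi * (\<Sum>k\<in>F. c k * cnj (fourier u k))
      + 2 * pi * (\<Sum>k\<in>F. c k * cnj (c k))"
  proof -
    have "(\<Sum>k\<in>F. \<Sum>l\<in>F. c k * cnj (c l) * (LINT x|circ. cis (of_int (k - l) * x))) = (\<Sum>k\<in>F. 2 * pi * (c k * cnj (c k)))"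
    proof (rule sum.cong[OF refl])
      fix k assume "k \<in> F"
      have "(\<Sum>l\<in>F. c k * cnj (c l) * (LINT x|circ. cis (of_int (k - l) * x)))
          = (\<Sum>l\<in>F. if k = l then 2 * pi * (c k * cnj (c l)) else 0)"
        unfolding cis_orthogonal by (intro sum.cong) auto
      then show "(\<Sum>l\<in>F. c k * cnj (c l) * (LINT x|circ. cis (of_int (k - l) * x))) = 2 * pi * (c k * cnj (c k))"
        using F \<open>k \<in> F\<close> by simp
    qed
    then show ?thesis
      unfolding e2 e3 L2_norm_sq integral_complex_of_real by (simp add: sum_distrib_left mult_ac)
  qed
  also have "\<dots> = complex_of_real ((L2_norm u)\<^sup>2) + 2 * pi * (\<Sum>k\<in>F. (c k - fourier u k) * cnj (c k - fourier u k))
      - 2 * pi * (\<Sum>k\<in>F. fourier u k * cnj (fourier u k))"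
    by (simp add: algebra_simps sum.distrib sum_subtractf)
  also have "\<dots> = complex_of_real ((L2_norm u)\<^sup>2 + 2 * pi * (\<Sum>k\<in>F. (cmod (c k - fourier u k))\<^sup>2)
      - 2 * pi * (\<Sum>k\<in>F. (cmod (fourier u k))\<^sup>2))"
    unfolding complex_norm_square[symmetric] by simp
  finally show ?thesis by (simp only: of_real_eq_iff)
qed

section \<open>The Parseval identity\<close>

definition trig_poly :: "(real \<Rightarrow> complex) \<Rightarrow> bool" where
  "trig_poly f \<longleftrightarrow> (\<exists>A c. finite A \<and> (\<forall>x. f x = (\<Sum>k\<in>A. c k * cis (of_int k * x))))"

lemma trig_poly_monomial: "trig_poly (\<lambda>x. c * cis (of_int k * x))"
  unfolding trig_poly_def by (intro exI[of _ "{k}"] exI[of _ "\<lambda>_. c"]) simp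

lemma trig_poly_add:
  assumes "trig_poly f" "trig_poly g"
  shows "trig_poly (\<lambda>x. f x + g x)"
proof -
  obtain A c B d where A: "finite A" "\<And>x. f x = (\<Sum>k\<in>A. c k * cis (of_int k * x))"
    and B: "finite B" "\<And>x. g x = (\<Sum>k\<in>B. d k * cis (of_int k * x))"
    using assms unfolding trig_poly_def by blast
  have a: "f x = (\<Sum>k\<in>A \<union> B. (if k \<in> A then c k else 0) * cis (of_int k * x))" for x
    unfolding A(2) by (rule sum.mono_neutral_cong_left) (use A B in auto)
  have b: "g x = (\<Sum>k\<in>A \<union> B. (if k \<in> B then d k else 0) * cis (of_int k * x))" for x
    unfolding B(2) by (rule sum.mono_neutral_cong_left) (use A B in auto)
  have "f x + g x = (\<Sum>k\<in>A \<union> B. ((if k \<in> A then c k else 0) + (if k \<in> B then d k else 0)) * cis (of_int k * x))" for x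
    unfolding a b by (simp only: sum.distrib distrib_right)
  then show ?thesis unfolding trig_poly_def
    using A(1) B(1) by (intro exI[of _ "A \<union> B"] exI[of _ "\<lambda>k. (if k \<in> A then c k else 0) + (if k \<in> B then d k else 0)"]) auto
qed

lemma trig_poly_sum: "(\<And>i. i \<in> I \<Longrightarrow> trig_poly (f i)) \<Longrightarrow> trig_poly (\<lambda>x. \<Sum>i\<in>I. f i x)"
proof (induction I rule: infinite_finite_induct)
  case (insert i I)
  then show ?case by (simp add: trig_poly_add)
qed (use trig_poly_monomial[of 0 0] in auto)

lemma trig_poly_mult:
  assumes "trig_poly f" "trig_poly g"
  shows "trig_poly (\<lambda>x. f x * g x)"
proof -
  obtain A c B d where f: "\<And>x. f x = (\<Sum>k\<in>A. c k * cis (of_int k * x))"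
    and g: "\<And>x. g x = (\<Sum>k\<in>B. d k * cis (of_int k * x))"
    using assms unfolding trig_poly_def by blast
  have "c k * cis (of_int k * x) * (d l * cis (of_int l * x)) = c k * d l * cis (of_int (k + l) * x)" for k l x
    using cis_mult[of "of_int k * x" "of_int l * x"] by (simp add: distrib_right)
  then have "f x * g x = (\<Sum>k\<in>A. \<Sum>l\<in>B. c k * d l * cis (of_int (k + l) * x))" for x
    unfolding f g sum_product by (simp only:)
  then show ?thesis by (simp only: trig_poly_sum trig_poly_monomial)
qed

text \<open>Induction over the generation of real polynomials on the plane: on the unit circle a
  linear functional is a combination of cos and sin, hence of \<open>cis x\<close> and
  \<open>cis (- x)\<close>, and trigonometric polynomials form an algebra.\<close>

lemma trig_poly_real_polynomial:
  assumes "real_polynomial_function (p :: complex \<Rightarrow> real)"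
  shows "trig_poly (\<lambda>x. of_real (p (cis x)))"
  using assms
proof (induction rule: real_polynomial_function.induct)
  case (linear f)
  have "f (cis x) = cos x * f 1 + sin x * f \<i>" for x
  proof -
    have "cis x = cos x *\<^sub>R 1 + sin x *\<^sub>R \<i>" by (simp add: complex_eq_iff)
    then show ?thesis using linear by (simp add: linear_simps)
  qed
  then have "complex_of_real (f (cis x)) = (of_real (f 1) / 2 + of_real (f \<i>) / (2 * \<i>)) * cis (of_int 1 * x)
      + (of_real (f 1) / 2 - of_real (f \<i>) / (2 * \<i>)) * cis (of_int (-1) * x)" for x
    by (simp add: complex_eq_iff)
  then show ?case by (simp only: trig_poly_add trig_poly_monomial)
next
  case (const c)
  show ?case using trig_poly_monomial[of "of_real c" 0] by simp
next
  case (add f g)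
  then show ?case using trig_poly_add by simp
next
  case (mult f g)
  then show ?case using trig_poly_mult by simp
qed

lemma trig_poly_approx:
  fixes F :: "complex \<Rightarrow> real"
  assumes "continuous_on (sphere 0 1) F" "0 < e"
  obtains T where "trig_poly T" "\<And>x. cmod (of_real (F (cis x)) - T x) < e"
proof -
  obtain p where p: "real_polynomial_function p" "\<And>z. z \<in> sphere 0 1 \<Longrightarrow> \<bar>F z - p z\<bar> < e"
    using Stone_Weierstrass_real_polynomial_function[OF compact_sphere assms] by blast
  show thesis
  proof (rule that[OF trig_poly_real_polynomial[OF p(1)]])
    fix x
    show "cmod (of_real (F (cis x)) - of_real (p (cis x))) < e"
      using p(2)[of "cis x"] by (simp flip: of_real_diff)
  qed
qed

section \<open>Density of trigonometric polynomials in L^2\<close>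

definition clamp_abs :: "real \<Rightarrow> real \<Rightarrow> real" where
  "clamp_abs M y = max (-M) (min M y)"

lemma clamp_abs_bound: "0 \<le> M \<Longrightarrow> \<bar>clamp_abs M y\<bar> \<le> M"
  unfolding clamp_abs_def by auto

lemma continuous_clamp_abs: "continuous_on S f \<Longrightarrow> continuous_on S (\<lambda>x. clamp_abs M (f x))"
  unfolding clamp_abs_def by (intro continuous_intros)

lemma tendsto_clamp_abs: "(f \<longlongrightarrow> y) F \<Longrightarrow> ((\<lambda>x. clamp_abs M (f x)) \<longlongrightarrow> clamp_abs M y) F"
  unfolding clamp_abs_def by (intro tendsto_intros)

lemma Arg2pi_cis: "0 \<le> x \<Longrightarrow> x < 2 * pi \<Longrightarrow> Arg2pi (cis x) = x"
  by (rule Arg2pi_unique[of 1]) (auto simp: cis_conv_exp)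

text \<open>The factor vanishing at \<open>z = 1\<close> removes the jump of the angle there.\<close>

lemma continuous_on_circle_cutoff:
  assumes g: "continuous_on UNIV g" and M: "0 \<le> M"
  shows "continuous_on (sphere 0 1) (\<lambda>z. min 1 (real n * cmod (z - 1)) * clamp_abs M (g (Arg2pi z)))"
    (is "continuous_on _ ?F")
  unfolding continuous_on_eq_continuous_within
proof
  fix z :: complex assume z: "z \<in> sphere 0 1"
  show "continuous (at z within sphere 0 1) ?F"
  proof (cases "z = 1")
    case False
    have "z \<notin> \<real>\<^sub>\<ge>\<^sub>0"
    proof
      assume "z \<in> \<real>\<^sub>\<ge>\<^sub>0"
      then obtain r where "z = of_real r" "0 \<le> r" by (auto simp: nonneg_Reals_def)
      with z False show False by auto
    qed
    then have "continuous (at z) Arg2pi" by (rule continuous_at_Arg2pi)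
    moreover have "isCont (\<lambda>y. clamp_abs M (g y)) (Arg2pi z)"
      using continuous_clamp_abs[OF g] by (simp add: continuous_on_eq_continuous_at)
    ultimately have "isCont (\<lambda>z. clamp_abs M (g (Arg2pi z))) z"
      by (rule isCont_o2)
    then have "isCont ?F z" by (intro continuous_intros)
    then show ?thesis by (rule continuous_at_imp_continuous_at_within)
  next
    case True
    have "((\<lambda>z. min 1 (real n * cmod (z - 1)) * clamp_abs M (g (Arg2pi z))) \<longlongrightarrow> 0) (at z within sphere 0 1)"
    proof (rule Lim_null_comparison)
      show "\<forall>\<^sub>F w in at z within sphere 0 1. norm (?F w) \<le> real n * cmod (w - 1) * M"
        using clamp_abs_bound[OF M] by (auto simp: abs_mult intro!: always_eventually mult_mono)
      have "((\<lambda>w. real n * cmod (w - 1) * M) \<longlongrightarrow> real n * cmod (z - 1) * M) (at z within sphere 0 1)"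
        by (intro tendsto_intros)
      then show "((\<lambda>w. real n * cmod (w - 1) * M) \<longlongrightarrow> 0) (at z within sphere 0 1)" using True by simp
    qed
    then show ?thesis unfolding continuous_within using True by simp
  qed
qed

lemma AE_circ:
  assumes "negligible N"
  shows "AE x in circ. x \<notin> N \<and> x \<noteq> 0 \<and> x \<noteq> 2 * pi"
proof -
  have "AE x in lebesgue. x \<notin> N"
    using assms by (simp add: negligible_iff_null_sets AE_not_in)
  then have "AE x in lborel. x \<notin> N" by (simp add: AE_completion_iff)
  with AE_lborel_singleton[of "0::real"] AE_lborel_singleton[of "2 * pi"]
  have "AE x in lborel. x \<notin> N \<and> x \<noteq> 0 \<and> x \<noteq> 2 * pi" by eventually_elim auto
  then show ?thesis unfolding circ_def by (subst AE_restrict_space_iff) auto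
qed

text \<open>A bounded measurable function is an almost everywhere limit of continuous functions on
  the line. Clamping by \<open>M\<close> gives the majorant for dominated convergence, and the
  factor of \<open>continuous_on_circle_cutoff\<close>, which tends to 1 away from the point 1,
  makes the approximants continuous on the circle.\<close>

lemma bounded_circle_approx:
  assumes g: "g \<in> borel_measurable borel" and M: "0 \<le> M" "\<And>x. \<bar>g x\<bar> \<le> M" and e: "0 < e"
  obtains F :: "complex \<Rightarrow> real" where "continuous_on (sphere 0 1) F" "(LINT x|circ. (g x - F (cis x))\<^sup>2) < e"
proof -
  have "g \<in> borel_measurable lebesgue" using g by (simp add: measurable_completion)
  then have "g measurable_on UNIV" by (rule lebesgue_measurable_imp_measurable_on) simp
  then obtain N h where N: "negligible N" and h: "\<And>n. continuous_on UNIV (h n)"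
    and lim: "\<And>x. x \<notin> N \<Longrightarrow> (\<lambda>n. h n x) \<longlonglongrightarrow> g x"
    unfolding measurable_on_def by auto
  define F where "F n z = min 1 (real n * cmod (z - 1)) * clamp_abs M (h n (Arg2pi z))" for n and z :: complex
  have F: "continuous_on (sphere 0 1) (F n)" for n
    unfolding F_def[abs_def] by (rule continuous_on_circle_cutoff[OF h M(1)])
  have Fb: "\<bar>F n z\<bar> \<le> M" for n z
  proof -
    have "\<bar>F n z\<bar> \<le> 1 * M" unfolding F_def abs_mult
      using clamp_abs_bound[OF M(1)] by (intro mult_mono) auto
    then show ?thesis by simp
  qed
  have Fc: "continuous_on UNIV (\<lambda>x. F n (cis x))" for n
    by (rule continuous_on_compose2[OF F]) (auto intro!: continuous_intros)
  have "(\<lambda>n. LINT x|circ. (g x - F n (cis x))\<^sup>2) \<longlonglongrightarrow> (LINT x|circ. 0)"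
  proof (rule integral_dominated_convergence)
    show "integrable circ (\<lambda>_. (2 * M)\<^sup>2)" by (rule integrable_circ_const)
    show "(\<lambda>x. (g x - F n (cis x))\<^sup>2) \<in> borel_measurable circ" for n
      using measurable_circ[OF g] measurable_circ[OF borel_measurable_continuous_onI[OF Fc]] by measurable
    show "AE x in circ. norm ((g x - F n (cis x))\<^sup>2) \<le> (2 * M)\<^sup>2" for n
    proof (rule AE_I2)
      fix x
      have "\<bar>g x - F n (cis x)\<bar> \<le> 2 * M" using M(2)[of x] Fb[of n "cis x"] by linarith
      then show "norm ((g x - F n (cis x))\<^sup>2) \<le> (2 * M)\<^sup>2"
        using power_mono[of "\<bar>g x - F n (cis x)\<bar>" "2 * M" 2] by simp
    qed
    show "AE x in circ. (\<lambda>n. (g x - F n (cis x))\<^sup>2) \<longlonglongrightarrow> 0"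
      using AE_circ[OF N] AE_space
    proof eventually_elim
      case (elim x)
      then have x: "0 < x" "x < 2 * pi" by (auto simp: space_circ)
      have "cis x \<noteq> 1"
      proof
        assume "cis x = 1"
        then have "Arg2pi (cis x) = 0" using Arg2pi_cis[of 0] by simp
        with Arg2pi_cis[of x] x show False by simp
      qed
      then have pos: "0 < cmod (cis x - 1)" by simp
      have "(\<lambda>n. min 1 (real n * cmod (cis x - 1))) \<longlonglongrightarrow> 1"
      proof (rule tendsto_eventually)
        obtain n0 :: nat where "1 / cmod (cis x - 1) < n0" using reals_Archimedean2 by blast
        then have n0: "1 \<le> real n0 * cmod (cis x - 1)" using pos by (simp add: field_simps)
        show "\<forall>\<^sub>F n in sequentially. min 1 (real n * cmod (cis x - 1)) = 1"
          using eventually_ge_at_top[of n0]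
        proof eventually_elim
          case (elim n)
          then have "real n0 * cmod (cis x - 1) \<le> real n * cmod (cis x - 1)"
            by (intro mult_right_mono) auto
          with n0 show ?case by simp
        qed
      qed
      moreover have "(\<lambda>n. clamp_abs M (h n x)) \<longlonglongrightarrow> clamp_abs M (g x)"
        using lim elim by (intro tendsto_clamp_abs) auto
      ultimately have "(\<lambda>n. F n (cis x)) \<longlonglongrightarrow> 1 * clamp_abs M (g x)"
        unfolding F_def Arg2pi_cis[OF less_imp_le[OF x(1)] x(2)] by (rule tendsto_mult)
      moreover have "clamp_abs M (g x) = g x" using M(2)[of x] unfolding clamp_abs_def by auto
      ultimately have "(\<lambda>n. F n (cis x)) \<longlonglongrightarrow> g x" by simp
      then have "(\<lambda>n. (g x - F n (cis x))\<^sup>2) \<longlonglongrightarrow> (g x - g x)\<^sup>2" by (intro tendsto_intros)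
      then show ?case by simp
    qed
  qed auto
  then have "\<forall>\<^sub>F n in sequentially. (LINT x|circ. (g x - F n (cis x))\<^sup>2) < e"
    using e by (intro order_tendstoD(2)[where y=0]) auto
  then obtain n where "(LINT x|circ. (g x - F n (cis x))\<^sup>2) < e"
    by (auto simp: eventually_sequentially)
  then show thesis using that[OF F] by blast
qed

lemma clamp_approx:
  assumes u: "sq_int u" and e: "0 < e"
  obtains M where "0 \<le> M" "(LINT x|circ. (u x - clamp_abs M (u x))\<^sup>2) < e"
proof -
  have "(\<lambda>n. LINT x|circ. (u x - clamp_abs (real n) (u x))\<^sup>2) \<longlonglongrightarrow> (LINT x|circ. 0)"
  proof (rule integral_dominated_convergence)
    show "integrable circ (\<lambda>x. (u x)\<^sup>2)" using u by (simp add: sq_int_def)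
    show "(\<lambda>x. (u x - clamp_abs (real n) (u x))\<^sup>2) \<in> borel_measurable circ" for n
      unfolding clamp_abs_def using sq_int_measurable[OF u] by measurable
    show "AE x in circ. norm ((u x - clamp_abs (real n) (u x))\<^sup>2) \<le> (u x)\<^sup>2" for n
    proof (rule AE_I2)
      fix x
      have "\<bar>u x - clamp_abs (real n) (u x)\<bar> \<le> \<bar>u x\<bar>" unfolding clamp_abs_def by auto
      from power_mono[OF this, of 2] show "norm ((u x - clamp_abs (real n) (u x))\<^sup>2) \<le> (u x)\<^sup>2" by simp
    qed
    have "(\<lambda>n. (u x - clamp_abs (real n) (u x))\<^sup>2) \<longlonglongrightarrow> 0" for x
    proof (rule tendsto_eventually)
      obtain n0 :: nat where "\<bar>u x\<bar> < n0" using reals_Archimedean2 by blast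
      then show "\<forall>\<^sub>F n in sequentially. (u x - clamp_abs (real n) (u x))\<^sup>2 = 0"
        by (intro eventually_sequentiallyI[of n0]) (auto simp: clamp_abs_def)
    qed
    then show "AE x in circ. (\<lambda>n. (u x - clamp_abs (real n) (u x))\<^sup>2) \<longlonglongrightarrow> 0" by simp
  qed auto
  then have "\<forall>\<^sub>F n in sequentially. (LINT x|circ. (u x - clamp_abs (real n) (u x))\<^sup>2) < e"
    using e by (intro order_tendstoD(2)[where y=0]) auto
  then obtain n where "(LINT x|circ. (u x - clamp_abs (real n) (u x))\<^sup>2) < e"
    by (auto simp: eventually_sequentially)
  then show thesis using that[of "real n"] by simp
qed

lemma trig_poly_dense:
  assumes u: "sq_int u" and e: "0 < e"
  obtains A c where "finite A" "(LINT x|circ. (cmod (of_real (u x) - (\<Sum>k\<in>A. c k * cis (of_int k * x))))\<^sup>2) < e"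
proof -
  \<comment> \<open>Three errors will be added, and the square of a sum of three is at most three
    times the sum of the squares; so each may contribute \<open>e / 9\<close>.\<close>
  have e9: "0 < e / 9" using e by simp
  obtain M where M: "0 \<le> M" "(LINT x|circ. (u x - clamp_abs M (u x))\<^sup>2) < e / 9"
    using clamp_approx[OF u e9] by blast
  have ub: "u \<in> borel_measurable borel" using sq_int_borel[OF u] .
  have gm: "(\<lambda>x. clamp_abs M (u x)) \<in> borel_measurable borel"
    unfolding clamp_abs_def using ub by measurable
  obtain F :: "complex \<Rightarrow> real" where F: "continuous_on (sphere 0 1) F"
    and Fe: "(LINT x|circ. (clamp_abs M (u x) - F (cis x))\<^sup>2) < e / 9"
    using bounded_circle_approx[OF gm M(1) clamp_abs_bound[OF M(1)] e9] by blast
  \<comment> \<open>A uniform error \<open>d\<close> contributes \<open>2 * pi * d\<^sup>2\<close>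
    to the integral, which is \<open>e / 9\<close> here.\<close>
  define d where "d = sqrt (e / 9 / (2 * pi))"
  have "0 < d" unfolding d_def using e by simp
  then obtain T where T: "trig_poly T" "\<And>x. cmod (of_real (F (cis x)) - T x) < d"
    using trig_poly_approx[OF F] by blast
  obtain A c where A: "finite A" and Tc: "T = (\<lambda>x. \<Sum>k\<in>A. c k * cis (of_int k * x))"
    using T(1) unfolding trig_poly_def by auto
  have Fc: "continuous_on UNIV (\<lambda>x. F (cis x))"
    by (rule continuous_on_compose2[OF F]) (auto intro!: continuous_intros)
  have Tcont: "continuous_on UNIV T" unfolding Tc by (intro continuous_intros)
  have sg: "sq_int (\<lambda>x. clamp_abs M (u x))"
    unfolding sq_int_def
  proof (intro conjI gm)
    show "integrable circ (\<lambda>x. (clamp_abs M (u x))\<^sup>2)"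
    proof (rule Bochner_Integration.integrable_bound[OF integrable_circ_const[of "M\<^sup>2"]])
      show "(\<lambda>x. (clamp_abs M (u x))\<^sup>2) \<in> borel_measurable circ"
        using measurable_circ[OF gm] by measurable
      show "AE x in circ. norm ((clamp_abs M (u x))\<^sup>2) \<le> norm (M\<^sup>2)"
        using power_mono[OF clamp_abs_bound[OF M(1)] abs_ge_zero, of _ 2] by auto
    qed
  qed
  have i1: "integrable circ (\<lambda>x. (u x - clamp_abs M (u x))\<^sup>2)"
    using sq_int_diff[OF u sg] by (simp add: sq_int_def)
  have i2: "integrable circ (\<lambda>x. (clamp_abs M (u x) - F (cis x))\<^sup>2)"
    using sq_int_diff[OF sg sq_int_continuous[OF Fc]] by (simp add: sq_int_def)
  have bound: "(cmod (of_real (u x) - T x))\<^sup>2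
      \<le> 3 * ((u x - clamp_abs M (u x))\<^sup>2 + (clamp_abs M (u x) - F (cis x))\<^sup>2 + d\<^sup>2)" for x
  proof -
    let ?a = "\<bar>u x - clamp_abs M (u x)\<bar>" and ?b = "\<bar>clamp_abs M (u x) - F (cis x)\<bar>"
    have "of_real (u x) - T x = of_real (u x - clamp_abs M (u x)) + of_real (clamp_abs M (u x) - F (cis x))
        + (of_real (F (cis x)) - T x)" by simp
    then have "cmod (of_real (u x) - T x) \<le> ?a + ?b + d"
      using norm_triangle_ineq[of "complex_of_real (u x - clamp_abs M (u x)) + of_real (clamp_abs M (u x) - F (cis x))" "of_real (F (cis x)) - T x"]
        norm_triangle_ineq[of "complex_of_real (u x - clamp_abs M (u x))" "of_real (clamp_abs M (u x) - F (cis x))"] T(2)[of x]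
      by (simp only: norm_of_real)
    then have "(cmod (of_real (u x) - T x))\<^sup>2 \<le> (?a + ?b + d)\<^sup>2" by (intro power_mono) auto
    also have "\<dots> \<le> 3 * (?a\<^sup>2 + ?b\<^sup>2 + d\<^sup>2)"
    proof -
      have "0 \<le> (?a - ?b)\<^sup>2 + (?a - d)\<^sup>2 + (?b - d)\<^sup>2" by simp
      then show ?thesis by (simp add: power2_eq_square algebra_simps)
    qed
    finally show ?thesis by simp
  qed
  have "(LINT x|circ. (cmod (of_real (u x) - T x))\<^sup>2)
      \<le> (LINT x|circ. 3 * ((u x - clamp_abs M (u x))\<^sup>2 + (clamp_abs M (u x) - F (cis x))\<^sup>2 + d\<^sup>2))"
  proof (rule Bochner_Integration.integral_mono)
    show I: "integrable circ (\<lambda>x. 3 * ((u x - clamp_abs M (u x))\<^sup>2 + (clamp_abs M (u x) - F (cis x))\<^sup>2 + d\<^sup>2))"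
      using i1 i2 integrable_circ_const[of "d\<^sup>2"] by auto
    show "integrable circ (\<lambda>x. (cmod (of_real (u x) - T x))\<^sup>2)"
    proof (rule Bochner_Integration.integrable_bound[OF I])
      show "(\<lambda>x. (cmod (of_real (u x) - T x))\<^sup>2) \<in> borel_measurable circ"
        using measurable_circ[OF ub] measurable_circ[OF borel_measurable_continuous_onI[OF Tcont]] by measurable
      show "AE x in circ. norm ((cmod (of_real (u x) - T x))\<^sup>2)
          \<le> norm (3 * ((u x - clamp_abs M (u x))\<^sup>2 + (clamp_abs M (u x) - F (cis x))\<^sup>2 + d\<^sup>2))"
        using bound by simp
    qed
  qed (rule bound)
  also have "\<dots> = 3 * ((LINT x|circ. (u x - clamp_abs M (u x))\<^sup>2)
      + (LINT x|circ. (clamp_abs M (u x) - F (cis x))\<^sup>2) + 2 * pi * d\<^sup>2)"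
    using i1 i2 integrable_circ_const[of "d\<^sup>2"]
    by (simp only: integral_mult_right_zero Bochner_Integration.integral_add Bochner_Integration.integrable_add)
       (simp add: measure_circ)
  also have "\<dots> < 3 * (e / 9 + e / 9 + e / 9)"
  proof -
    have "2 * pi * d\<^sup>2 = e / 9" unfolding d_def using e by simp
    then show ?thesis using M(2) Fe by simp
  qed
  finally have "(LINT x|circ. (cmod (of_real (u x) - T x))\<^sup>2) < e" by simp
  then show thesis using that[OF A] unfolding Tc by blast
qed

text \<open>Bessel's inequality is one half; for the other an approximating polynomial is inserted
  into \<open>Bessel_identity\<close> and the nonnegative middle term dropped. The equality carries
  estimates made mode by mode over to \<open>L2_norm\<close>.\<close>

theorem Parseval:
  assumes u: "sq_int u"
  shows "sq_summable (fourier u)" "(L2_norm u)\<^sup>2 = 2 * pi * (l2_norm (fourier u))\<^sup>2"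
proof -
  have B: "2 * pi * (\<Sum>k\<in>F. (cmod (fourier u k))\<^sup>2) \<le> (L2_norm u)\<^sup>2" if F: "finite F" for F
  proof -
    have "0 \<le> (LINT x|circ. (cmod (of_real (u x) - (\<Sum>k\<in>F. fourier u k * cis (of_int k * x))))\<^sup>2)" by simp
    then show ?thesis unfolding Bessel_identity[OF u F] by simp
  qed
  have bd: "(\<Sum>k\<in>F. (cmod (fourier u k))\<^sup>2) \<le> (L2_norm u)\<^sup>2 / (2 * pi)" if "finite F" for F
    using B[OF that] by (simp add: field_simps)
  show s: "sq_summable (fourier u)" unfolding sq_summable_def
    by (rule nonneg_bdd_above_summable_on) (use bd in \<open>auto intro!: bdd_aboveI2\<close>)
  have le: "2 * pi * (l2_norm (fourier u))\<^sup>2 \<le> (L2_norm u)\<^sup>2"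
  proof -
    have "(l2_norm (fourier u))\<^sup>2 \<le> (L2_norm u)\<^sup>2 / (2 * pi)"
      unfolding l2_norm_sq using s bd by (intro infsum_le_finite_sums) (auto simp: sq_summable_def)
    then show ?thesis by (simp add: field_simps)
  qed
  have "(L2_norm u)\<^sup>2 \<le> 2 * pi * (l2_norm (fourier u))\<^sup>2 + e" if e: "0 < e" for e
  proof -
    obtain A c where A: "finite A" and
      c: "(LINT x|circ. (cmod (of_real (u x) - (\<Sum>k\<in>A. c k * cis (of_int k * x))))\<^sup>2) < e"
      using trig_poly_dense[OF u e] by blast
    have "0 \<le> 2 * pi * (\<Sum>k\<in>A. (cmod (c k - fourier u k))\<^sup>2)" by (simp add: sum_nonneg)
    with c have "(L2_norm u)\<^sup>2 \<le> 2 * pi * (\<Sum>k\<in>A. (cmod (fourier u k))\<^sup>2) + e"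
      unfolding Bessel_identity[OF u A] by linarith
    also have "(\<Sum>k\<in>A. (cmod (fourier u k))\<^sup>2) \<le> (l2_norm (fourier u))\<^sup>2"
      unfolding l2_norm_sq using s A by (intro finite_sum_le_infsum) (auto simp: sq_summable_def)
    finally show ?thesis by simp
  qed
  then have "(L2_norm u)\<^sup>2 \<le> 2 * pi * (l2_norm (fourier u))\<^sup>2" by (rule field_le_epsilon)
  with le show "(L2_norm u)\<^sup>2 = 2 * pi * (l2_norm (fourier u))\<^sup>2" by simp
qed

section \<open>The Hilbert basis of the paper\<close>

definition basis_coeff :: "nat \<Rightarrow> real" where
  "basis_coeff n = sqrt (real n / (pi * ((real n)\<^sup>2 + 1)))"

lemma basis_coeff_pos: "1 \<le> n \<Longrightarrow> 0 < basis_coeff n"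
  unfolding basis_coeff_def by (auto intro!: divide_pos_pos mult_pos_pos add_nonneg_pos)

lemma basis_coeff_sq: "(basis_coeff n)\<^sup>2 = real n / (pi * ((real n)\<^sup>2 + 1))"
  unfolding basis_coeff_def by (auto simp: add_nonneg_pos)

lemma integrable_circ_cis: "integrable circ (\<lambda>x. cis (c * x))"
  by (intro integrable_circ_continuous continuous_intros)

text \<open>Only modes of nonnegative index are computed; \<open>fourier_uminus\<close> supplies the
  others.\<close>

lemma fourier_basis:
  assumes "1 \<le> n"
  shows "fourier (\<lambda>x. p * phi_plus n x + q * phi_minus n x) (int m)
    = (if m = n then of_real (basis_coeff n / 2) * (of_real p - \<i> * of_real q) else 0)"
proof -
  \<comment> \<open>p cos(nx) + q sin(nx) is the real part of (p - iq) exp(inx), so mode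
    \<open>n\<close> carries half of p - iq and mode \<open>- n\<close> its conjugate.\<close>
  let ?z = "of_real (basis_coeff n / 2) * (of_real p - \<i> * of_real q)"
  have "complex_of_real (p * phi_plus n x + q * phi_minus n x) * cis (- (of_int (int m) * x))
      = ?z * cis (of_int (int n - int m) * x) + cnj ?z * cis (of_int (- int n - int m) * x)" for x
  proof -
    have e: "complex_of_real (p * phi_plus n x + q * phi_minus n x)
        = ?z * cis (real n * x) + cnj ?z * cis (- (real n * x))"
      unfolding phi_plus_def phi_minus_def basis_coeff_def[symmetric]
      by (simp add: complex_eq_iff algebra_simps diff_divide_distrib)
    have "cis (of_int (int n - int m) * x) = cis (real n * x) * cis (- (of_int (int m) * x))"
      "cis (of_int (- int n - int m) * x) = cis (- (real n * x)) * cis (- (of_int (int m) * x))"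
      unfolding cis_mult by (rule arg_cong[of _ _ cis], simp add: algebra_simps)+
    then show ?thesis unfolding e by (simp only: distrib_right mult.assoc)
  qed
  then have "(LINT x|circ. complex_of_real (p * phi_plus n x + q * phi_minus n x) * cis (- (of_int (int m) * x)))
      = ?z * (LINT x|circ. cis (of_int (int n - int m) * x)) + cnj ?z * (LINT x|circ. cis (of_int (- int n - int m) * x))"
    by (simp only: Bochner_Integration.integral_add Bochner_Integration.integrable_mult_right
        integrable_circ_cis integral_mult_right_zero)
  also have "\<dots> = ?z * (if m = n then 2 * pi else 0)"
    unfolding cis_orthogonal using assms by auto
  finally have e: "(LINT x|circ. complex_of_real (p * phi_plus n x + q * phi_minus n x) * cis (- (of_int (int m) * x)))
      = ?z * (if m = n then 2 * pi else 0)" .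
  show ?thesis unfolding fourier_circ e by simp
qed

definition expansion_sum :: "(nat \<Rightarrow> real) \<Rightarrow> (nat \<Rightarrow> real) \<Rightarrow> nat \<Rightarrow> real \<Rightarrow> real" where
  "expansion_sum p q N x = (\<Sum>n=1..N. p n * phi_plus n x + q n * phi_minus n x)"

lemma continuous_basis: "continuous_on UNIV (\<lambda>x. p * phi_plus n x + q * phi_minus n x)"
  unfolding phi_plus_def phi_minus_def by (intro continuous_intros)

lemma sq_int_expansion_sum: "sq_int (expansion_sum p q N)"
  unfolding expansion_sum_def[abs_def] by (intro sq_int_sum sq_int_continuous continuous_basis)

lemma fourier_expansion_sum:
  "fourier (expansion_sum p q N) (int m)
    = (if 1 \<le> m \<and> m \<le> N then of_real (basis_coeff m / 2) * (of_real (p m) - \<i> * of_real (q m)) else 0)"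
proof -
  have "fourier (expansion_sum p q N) (int m)
      = (\<Sum>n=1..N. fourier (\<lambda>x. p n * phi_plus n x + q n * phi_minus n x) (int m))"
    unfolding expansion_sum_def[abs_def]
    by (rule fourier_sum) (auto intro!: sq_int_integrable sq_int_continuous continuous_basis)
  also have "\<dots> = (\<Sum>n=1..N. if m = n then of_real (basis_coeff n / 2) * (of_real (p n) - \<i> * of_real (q n)) else 0)"
    by (intro sum.cong refl fourier_basis) auto
  finally show ?thesis by simp
qed

lemma H_half_0_sq_int: "u \<in> H_half_0 \<Longrightarrow> sq_int u"
  unfolding H_half_0_def sobolev_def L2_torus_iff by blast

lemma H_half_0_fourier_0: "u \<in> H_half_0 \<Longrightarrow> fourier u 0 = 0"
  unfolding H_half_0_def fourier_circ set_integral_circ by simp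

lemma sobolev_normI:
  assumes "\<And>k. fourier u k = a k"
  shows "sobolev_norm s u = sqrt (\<Sum>\<^sub>\<infinity>k. (1 + (of_int k)\<^sup>2) powr s * (cmod (a k))\<^sup>2)"
  unfolding sobolev_norm_def assms ..

text \<open>Replaces convergence of the expansion by one equation per mode. Forwards, each mode of
  the remainder is bounded by its Sobolev norm, the weights being at least 1. Backwards, the
  remainder is a tail of a convergent series, mode 0 vanishing by mean zero.\<close>

lemma has_expansion_iff:
  "has_expansion u p q \<longleftrightarrow> u \<in> H_half_0 \<and>
     (\<forall>n\<ge>1. fourier u (int n) = of_real (basis_coeff n / 2) * (of_real (p n) - \<i> * of_real (q n)))"
    (is "_ \<longleftrightarrow> _ \<and> (\<forall>n\<ge>1. _ = ?z n)")
proof (cases "u \<in> H_half_0")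
  case False
  then show ?thesis by (simp add: has_expansion_def)
next
  case True
  let ?S = "expansion_sum p q"
  let ?w = "\<lambda>k::int. (1 + (of_int k)\<^sup>2) powr (1/2) :: real"
  define f where "f k = ?w k * (cmod (fourier u k))\<^sup>2" for k
  have f: "f summable_on UNIV" using True unfolding f_def H_half_0_def sobolev_def by blast
  have w1: "1 \<le> ?w k" for k by (rule ge_one_powr_ge_zero) auto
  have iu: "integrable circ u" using sq_int_integrable[OF H_half_0_sq_int[OF True]] .
  have iS: "integrable circ (?S N)" for N using sq_int_integrable[OF sq_int_expansion_sum] .
  have d: "fourier (\<lambda>x. u x - ?S N x) k = fourier u k - fourier (?S N) k" for N k
    by (rule fourier_diff[OF iu iS])
  have S0: "fourier (?S N) k = 0" if "int N < \<bar>k\<bar>" for N k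
  proof (cases "0 \<le> k")
    case True
    with that have "\<not> nat k \<le> N" by linarith
    with True show ?thesis using fourier_expansion_sum[of p q N "nat k"] by simp
  next
    case False
    with that have "\<not> nat (-k) \<le> N" by linarith
    with False show ?thesis using fourier_expansion_sum[of p q N "nat (-k)"] fourier_uminus[of "?S N" "-k"] by simp
  qed
  have exp: "has_expansion u p q \<longleftrightarrow> (\<lambda>N. sobolev_norm (1/2) (\<lambda>x. u x - ?S N x)) \<longlonglongrightarrow> 0"
    using True unfolding has_expansion_def expansion_sum_def by simp
  show ?thesis
  proof
    assume L: "has_expansion u p q"
    have "fourier u (int n) = ?z n" if n: "1 \<le> n" for n
    proof -
      have "\<forall>\<^sub>F N in sequentially. cmod (fourier u (int n) - ?z n) \<le> sobolev_norm (1/2) (\<lambda>x. u x - ?S N x)"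
        using eventually_ge_at_top[of n]
      proof eventually_elim
        case (elim N)
        let ?g = "\<lambda>k. ?w k * (cmod (fourier u k - fourier (?S N) k))\<^sup>2"
        \<comment> \<open>Summability must be shown: the \<open>infsum\<close> of a nonsummable
          family is 0 and would bound nothing.\<close>
        have "?g summable_on UNIV"
        proof (rule summable_on_comparison_test)
          have "(\<lambda>k. ?w k * (cmod (fourier (?S N) k))\<^sup>2) summable_on UNIV"
            by (rule finite_nonzero_values_imp_summable_on, rule finite_subset[of _ "{-int N..int N}"])
               (use S0 in force)+
          then show "(\<lambda>k. 2 * f k + 2 * (?w k * (cmod (fourier (?S N) k))\<^sup>2)) summable_on UNIV"
            by (intro summable_on_add summable_on_cmult_right f)
          fix k
          have "(cmod (fourier u k - fourier (?S N) k))\<^sup>2 \<le> (cmod (fourier u k) + cmod (fourier (?S N) k))\<^sup>2"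
            by (intro power_mono norm_triangle_ineq4) auto
          also have "\<dots> \<le> 2 * (cmod (fourier u k))\<^sup>2 + 2 * (cmod (fourier (?S N) k))\<^sup>2"
            using zero_le_power2[of "cmod (fourier u k) - cmod (fourier (?S N) k)"]
            by (simp add: power2_eq_square algebra_simps)
          finally have "?g k \<le> ?w k * (2 * (cmod (fourier u k))\<^sup>2 + 2 * (cmod (fourier (?S N) k))\<^sup>2)"
            by (intro mult_left_mono) auto
          then show "?g k \<le> 2 * f k + 2 * (?w k * (cmod (fourier (?S N) k))\<^sup>2)"
            unfolding f_def by (simp add: algebra_simps)
        qed simp
        then have "sum ?g {int n} \<le> infsum ?g UNIV"
          by (rule finite_sum_le_infsum) auto
        moreover have "sum ?g {int n} = ?w (int n) * (cmod (fourier u (int n) - ?z n))\<^sup>2"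
        proof -
          have "fourier (?S N) (int n) = ?z n" unfolding fourier_expansion_sum using elim n by (simp only: if_True simp_thms)
          moreover have "sum ?g {int n} = ?g (int n)" by simp
          ultimately show ?thesis by (simp only:)
        qed
        moreover have "1 * (cmod (fourier u (int n) - ?z n))\<^sup>2 \<le> ?w (int n) * (cmod (fourier u (int n) - ?z n))\<^sup>2"
          by (rule mult_right_mono[OF w1]) simp
        ultimately have "(cmod (fourier u (int n) - ?z n))\<^sup>2 \<le> infsum ?g UNIV" by linarith
        then show ?case unfolding sobolev_normI[OF d] by (rule real_le_rsqrt)
      qed
      then have "cmod (fourier u (int n) - ?z n) \<le> 0"
        using L unfolding exp by (intro tendsto_lowerbound[where F=sequentially]) auto
      then show ?thesis by simp
    qed
    with True show "u \<in> H_half_0 \<and> (\<forall>n\<ge>1. fourier u (int n) = ?z n)" by blast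
  next
    assume R: "u \<in> H_half_0 \<and> (\<forall>n\<ge>1. fourier u (int n) = ?z n)"
    have low: "fourier u k - fourier (?S N) k = 0" if "k \<in> {-int N..int N}" for N k
    proof -
      have pos: "fourier u (int m) = fourier (?S N) (int m)" if "m \<le> N" for m
      proof (cases "m = 0")
        case True
        then show ?thesis
          using fourier_expansion_sum[of p q N 0] H_half_0_fourier_0[OF \<open>u \<in> H_half_0\<close>] by simp
      next
        case False
        then have m: "1 \<le> m" by simp
        with that have "fourier (?S N) (int m) = ?z m"
          unfolding fourier_expansion_sum by (simp only: if_True simp_thms)
        moreover have "fourier u (int m) = ?z m" using R m by blast
        ultimately show ?thesis by (simp only:)
      qed
      show ?thesis
      proof (cases "0 \<le> k")
        case True
        with pos[of "nat k"] that show ?thesis by simp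
      next
        case False
        with pos[of "nat (-k)"] that fourier_uminus[of u "-k"] fourier_uminus[of "?S N" "-k"] show ?thesis by simp
      qed
    qed
    have "(\<Sum>\<^sub>\<infinity>k. ?w k * (cmod (fourier u k - fourier (?S N) k))\<^sup>2) = infsum f UNIV - (\<Sum>k\<in>{-int N..int N}. f k)" for N
    proof -
      have "(\<Sum>\<^sub>\<infinity>k. ?w k * (cmod (fourier u k - fourier (?S N) k))\<^sup>2) = infsum f (UNIV - {-int N..int N})"
      proof (rule infsum_cong_neutral)
        fix k assume "k \<in> UNIV \<inter> (UNIV - {-int N..int N})"
        then have "int N < \<bar>k\<bar>" by auto
        then show "?w k * (cmod (fourier u k - fourier (?S N) k))\<^sup>2 = f k" using S0 unfolding f_def by simp
      qed (use low in auto)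
      also have "\<dots> = infsum f UNIV - (\<Sum>k\<in>{-int N..int N}. f k)"
        using infsum_Diff[OF f, of "{-int N..int N}"] by simp
      finally show ?thesis .
    qed
    then have "(\<lambda>N. sobolev_norm (1/2) (\<lambda>x. u x - ?S N x)) = (\<lambda>N. sqrt (infsum f UNIV - (\<Sum>k\<in>{-int N..int N}. f k)))"
      unfolding sobolev_normI[OF d] by simp
    also have "\<dots> \<longlonglongrightarrow> sqrt 0" by (intro tendsto_real_sqrt summable_on_int_tail f)
    finally show "has_expansion u p q" unfolding exp by simp
  qed
qed

text \<open>The factor is \<open>4 / (basis_coeff n)\<^sup>2\<close>, the 4 coming from the halving
  in \<open>fourier_basis\<close>.\<close>

lemma has_expansion_sq:
  assumes "has_expansion u p q" "1 \<le> n"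
  shows "(p n)\<^sup>2 + (q n)\<^sup>2 = 4 * pi * ((real n)\<^sup>2 + 1) / real n * (cmod (fourier u (int n)))\<^sup>2"
proof -
  have "fourier u (int n) = of_real (basis_coeff n / 2) * (of_real (p n) - \<i> * of_real (q n))"
    using assms has_expansion_iff by blast
  then have "(cmod (fourier u (int n)))\<^sup>2 = (basis_coeff n / 2)\<^sup>2 * (cmod (of_real (p n) - \<i> * of_real (q n)))\<^sup>2"
    by (simp only: norm_mult norm_of_real power_mult_distrib power2_abs)
  also have "(cmod (of_real (p n) - \<i> * of_real (q n)))\<^sup>2 = (p n)\<^sup>2 + (q n)\<^sup>2"
    by (simp add: cmod_power2)
  finally have "(cmod (fourier u (int n)))\<^sup>2 = real n / (4 * (pi * ((real n)\<^sup>2 + 1))) * ((p n)\<^sup>2 + (q n)\<^sup>2)"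
    by (simp add: power_divide basis_coeff_sq)
  moreover have "S = 4 * pi * Y / m * X" if "X = m / (4 * (pi * Y)) * S" "Y \<noteq> 0" "m \<noteq> 0" for S X Y m :: real
    using that by simp
  moreover have "(real n)\<^sup>2 + 1 \<noteq> 0" by (simp add: add_nonneg_eq_0_iff)
  ultimately show ?thesis using assms(2) by simp
qed

lemma has_expansion_exists:
  assumes "u \<in> H_half_0"
  obtains p q where "has_expansion u p q"
proof
  show "has_expansion u (\<lambda>n. 2 * Re (fourier u (int n)) / basis_coeff n) (\<lambda>n. - 2 * Im (fourier u (int n)) / basis_coeff n)"
    unfolding has_expansion_iff
  proof (intro conjI assms allI impI)
    fix n :: nat assume "1 \<le> n"
    then have "basis_coeff n \<noteq> 0" using basis_coeff_pos[of n] by simp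
    then show "fourier u (int n) = of_real (basis_coeff n / 2) *
        (of_real (2 * Re (fourier u (int n)) / basis_coeff n) - \<i> * of_real (- 2 * Im (fourier u (int n)) / basis_coeff n))"
      by (simp add: complex_eq_iff)
  qed
qed

text \<open>The definite description in \<open>H_norm\<close> is evaluated: by
  \<open>has_expansion_sq\<close> all expansions have the same sequence of squares, and bounded
  partial sums make it summable.\<close>

lemma H_norm_le:
  assumes u: "u \<in> H_half_0" and S: "0 \<le> S"
    and bd: "\<And>N. (\<Sum>n=1..N. 4 * pi * ((real n)\<^sup>2 + 1) / real n * (cmod (fourier u (int n)))\<^sup>2) \<le> S\<^sup>2"
  shows "H_norm u \<le> S"
proof -
  define g where "g n = 4 * pi * ((real (Suc n))\<^sup>2 + 1) / real (Suc n) * (cmod (fourier u (int (Suc n))))\<^sup>2" for n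
  have g0: "0 \<le> g n" for n unfolding g_def by simp
  have gb: "(\<Sum>n<N. g n) \<le> S\<^sup>2" for N
  proof -
    have "(\<Sum>n<N. g n) = (\<Sum>n=1..N. 4 * pi * ((real n)\<^sup>2 + 1) / real n * (cmod (fourier u (int n)))\<^sup>2)"
      unfolding g_def by (rule sum.reindex_bij_witness[of _ "\<lambda>n. n - 1" Suc]) auto
    then show ?thesis using bd[of N] by simp
  qed
  have sg: "summable g" by (rule summableI_nonneg_bounded[of _ "S\<^sup>2"]) (use g0 gb in auto)
  have pq: "(\<lambda>n. (p (Suc n))\<^sup>2 + (q (Suc n))\<^sup>2) = g" if "has_expansion u p q" for p q
    using has_expansion_sq[OF that] unfolding g_def by auto
  have "(THE s. \<exists>p q. has_expansion u p q \<and> (\<lambda>n. (p (Suc n))\<^sup>2 + (q (Suc n))\<^sup>2) sums s) = suminf g"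
  proof (rule the_equality)
    obtain p q where "has_expansion u p q" using has_expansion_exists[OF u] by blast
    then show "\<exists>p q. has_expansion u p q \<and> (\<lambda>n. (p (Suc n))\<^sup>2 + (q (Suc n))\<^sup>2) sums suminf g"
      using pq summable_sums[OF sg] by metis
    show "s = suminf g" if "\<exists>p q. has_expansion u p q \<and> (\<lambda>n. (p (Suc n))\<^sup>2 + (q (Suc n))\<^sup>2) sums s" for s
      using that pq sums_unique by metis
  qed
  then have "H_norm u = sqrt (suminf g)" unfolding H_norm_def by simp
  also have "suminf g \<le> S\<^sup>2" by (rule suminf_le_const[OF sg gb])
  finally show ?thesis using S by (simp add: real_le_lsqrt)
qed

lemma H_cylinder_fourier:
  assumes "u \<in> H_cylinder R n" "1 \<le> n"
  shows "4 * pi * ((real n)\<^sup>2 + 1) / real n * (cmod (fourier u (int n)))\<^sup>2 < R\<^sup>2"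
  using assms has_expansion_sq[of u _ _ n] unfolding H_cylinder_def by fastforce

section \<open>Uniqueness of solutions\<close>

lemma sobolev_sq_int: "u \<in> sobolev s \<Longrightarrow> sq_int u"
  unfolding sobolev_def L2_torus_iff by blast

lemma L2_norm_fourier:
  assumes "sq_int u"
  shows "L2_norm u = sqrt (2 * pi) * l2_norm (fourier u)"
proof -
  have "sqrt ((L2_norm u)\<^sup>2) = sqrt (2 * pi * (l2_norm (fourier u))\<^sup>2)" using Parseval(2)[OF assms] by simp
  then show ?thesis by (simp add: real_sqrt_mult)
qed

text \<open>Minkowski's inequality is inherited from \<open>l2_norm_add\<close> through
  Parseval.\<close>

lemma L2_norm_triangle:
  assumes "sq_int u" "sq_int v"
  shows "L2_norm (\<lambda>x. u x + v x) \<le> L2_norm u + L2_norm v"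
proof -
  have "fourier (\<lambda>x. u x + v x) = (\<lambda>k. fourier u k + fourier v k)"
    using fourier_add assms sq_int_integrable by (intro ext) blast
  then show ?thesis
    using l2_norm_add(2)[OF Parseval(1)[OF assms(1)] Parseval(1)[OF assms(2)]] assms
    unfolding L2_norm_fourier[OF sq_int_add[OF assms]] L2_norm_fourier[OF assms(1)] L2_norm_fourier[OF assms(2)]
    by (simp flip: distrib_left)
qed

lemma L2_norm_triangle_abs:
  assumes "sq_int u" "sq_int v"
  shows "\<bar>L2_norm u - L2_norm v\<bar> \<le> L2_norm (\<lambda>x. u x - v x)"
proof -
  have "fourier (\<lambda>x. u x - v x) = (\<lambda>k. fourier u k - fourier v k)"
    using fourier_diff assms sq_int_integrable by (intro ext) blast
  then show ?thesis
    using l2_norm_triangle_abs[OF Parseval(1)[OF assms(1)] Parseval(1)[OF assms(2)]] assms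
    unfolding L2_norm_fourier[OF sq_int_diff[OF assms]] L2_norm_fourier[OF assms(1)] L2_norm_fourier[OF assms(2)]
    by (simp add: abs_mult flip: right_diff_distrib)
qed

text \<open>The Sobolev weights are at least 1. Through this, continuity into H^{1/2} becomes the
  L^2 continuity on which uniqueness is based.\<close>

lemma L2_norm_diff_le_sobolev_norm:
  assumes u: "u \<in> sobolev (1/2)" and v: "v \<in> sobolev (1/2)"
  shows "L2_norm (\<lambda>x. u x - v x) \<le> sqrt (2 * pi) * sobolev_norm (1/2) (\<lambda>x. u x - v x)"
proof -
  let ?w = "\<lambda>k::int. (1 + (of_int k)\<^sup>2) powr (1/2) :: real"
  have w1: "1 \<le> ?w k" for k by (rule ge_one_powr_ge_zero) auto
  note su = sobolev_sq_int[OF u] and sv = sobolev_sq_int[OF v]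
  have d: "fourier (\<lambda>x. u x - v x) k = fourier u k - fourier v k" for k
    by (rule fourier_diff) (intro sq_int_integrable su sv)+
  let ?g = "\<lambda>k. ?w k * (cmod (fourier u k - fourier v k))\<^sup>2"
  have g: "?g summable_on UNIV"
  proof (rule summable_on_comparison_test)
    show "(\<lambda>k. 2 * (?w k * (cmod (fourier u k))\<^sup>2) + 2 * (?w k * (cmod (fourier v k))\<^sup>2)) summable_on UNIV"
      using u v unfolding sobolev_def by (intro summable_on_add summable_on_cmult_right) auto
    fix k
    have "(cmod (fourier u k - fourier v k))\<^sup>2 \<le> (cmod (fourier u k) + cmod (fourier v k))\<^sup>2"
      by (intro power_mono norm_triangle_ineq4) auto
    also have "\<dots> \<le> 2 * (cmod (fourier u k))\<^sup>2 + 2 * (cmod (fourier v k))\<^sup>2"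
      using zero_le_power2[of "cmod (fourier u k) - cmod (fourier v k)"]
      by (simp add: power2_eq_square algebra_simps)
    finally have "?g k \<le> ?w k * (2 * (cmod (fourier u k))\<^sup>2 + 2 * (cmod (fourier v k))\<^sup>2)"
      by (intro mult_left_mono) auto
    then show "?g k \<le> 2 * (?w k * (cmod (fourier u k))\<^sup>2) + 2 * (?w k * (cmod (fourier v k))\<^sup>2)"
      by (simp add: algebra_simps)
  qed simp
  have "l2_norm (fourier (\<lambda>x. u x - v x)) \<le> sobolev_norm (1/2) (\<lambda>x. u x - v x)"
    unfolding sobolev_normI[OF d] l2_norm_def d
  proof (intro real_sqrt_le_mono infsum_mono g)
    show "(\<lambda>k. (cmod (fourier u k - fourier v k))\<^sup>2) summable_on UNIV"
      using l2_norm_diff(1)[OF Parseval(1)[OF su] Parseval(1)[OF sv]] by (simp add: sq_summable_def)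
    show "(cmod (fourier u k - fourier v k))\<^sup>2 \<le> ?g k" for k
      using mult_right_mono[OF w1[of k], of "(cmod (fourier u k - fourier v k))\<^sup>2"] by simp
  qed
  then show ?thesis unfolding L2_norm_fourier[OF sq_int_diff[OF su sv]] by simp
qed

definition L2_continuous :: "(real \<Rightarrow> real \<Rightarrow> real) \<Rightarrow> bool" where
  "L2_continuous u \<longleftrightarrow> (\<forall>t. sq_int (u t)) \<and> (\<forall>t. ((\<lambda>s. L2_norm (\<lambda>x. u s x - u t x)) \<longlongrightarrow> 0) (at t))"

lemma bbm_solution_L2_continuous:
  assumes "bbm_solution u0 u"
  shows "L2_continuous u"
  unfolding L2_continuous_def
proof (intro conjI allI)
  fix t
  have u: "u s \<in> sobolev (1/2)" for s using assms by (simp add: bbm_solution_def)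
  show "sq_int (u t)" by (rule sobolev_sq_int[OF u])
  have "((\<lambda>s. sqrt (2 * pi) * sobolev_norm (1/2) (\<lambda>x. u s x - u t x)) \<longlongrightarrow> sqrt (2 * pi) * 0) (at t)"
    using assms unfolding bbm_solution_def by (intro tendsto_mult tendsto_const) blast
  then have *: "((\<lambda>s. sqrt (2 * pi) * sobolev_norm (1/2) (\<lambda>x. u s x - u t x)) \<longlongrightarrow> 0) (at t)" by simp
  show "((\<lambda>s. L2_norm (\<lambda>x. u s x - u t x)) \<longlongrightarrow> 0) (at t)"
    by (rule Lim_null_comparison[OF _ *]) (use L2_norm_diff_le_sobolev_norm[OF u u] in auto)
qed

lemma L2_continuous_diff:
  assumes "L2_continuous u" "L2_continuous v"
  shows "L2_continuous (\<lambda>t x. u t x - v t x)"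
  unfolding L2_continuous_def
proof (intro conjI allI)
  have su: "sq_int (u t)" and sv: "sq_int (v t)" for t using assms by (auto simp: L2_continuous_def)
  show "sq_int (\<lambda>x. u t x - v t x)" for t by (rule sq_int_diff[OF su sv])
  fix t
  have *: "((\<lambda>s. L2_norm (\<lambda>x. u s x - u t x) + L2_norm (\<lambda>x. v t x - v s x)) \<longlongrightarrow> 0) (at t)"
  proof -
    have "L2_norm (\<lambda>x. v t x - v s x) = L2_norm (\<lambda>x. v s x - v t x)" for s
      unfolding L2_norm_def by (simp add: power2_commute)
    then show ?thesis
      using tendsto_add[of "\<lambda>s. L2_norm (\<lambda>x. u s x - u t x)" 0 "at t" "\<lambda>s. L2_norm (\<lambda>x. v s x - v t x)" 0]
        assms unfolding L2_continuous_def by simp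
  qed
  show "((\<lambda>s. L2_norm (\<lambda>x. (u s x - v s x) - (u t x - v t x))) \<longlongrightarrow> 0) (at t)"
  proof (rule Lim_null_comparison[OF always_eventually *], intro allI)
    fix s
    have "L2_norm (\<lambda>x. (u s x - u t x) + (v t x - v s x)) \<le> L2_norm (\<lambda>x. u s x - u t x) + L2_norm (\<lambda>x. v t x - v s x)"
      by (intro L2_norm_triangle sq_int_diff su sv)
    then show "norm (L2_norm (\<lambda>x. (u s x - v s x) - (u t x - v t x))) \<le> L2_norm (\<lambda>x. u s x - u t x) + L2_norm (\<lambda>x. v t x - v s x)"
      by (simp add: algebra_simps)
  qed
qed

lemma L2_continuous_norm:
  assumes "L2_continuous u"
  shows "continuous_on UNIV (\<lambda>t. L2_norm (u t))"
  unfolding continuous_on_eq_continuous_within continuous_within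
proof
  fix t
  have "((\<lambda>s. L2_norm (u s) - L2_norm (u t)) \<longlongrightarrow> 0) (at t)"
    by (rule Lim_null_comparison[where g="\<lambda>s. L2_norm (\<lambda>x. u s x - u t x)"])
       (use assms L2_norm_triangle_abs in \<open>auto simp: L2_continuous_def intro!: always_eventually\<close>)
  then show "((\<lambda>t. L2_norm (u t)) \<longlongrightarrow> L2_norm (u t)) (at t)"
    by (rule LIM_zero_cancel)
qed

text \<open>The square of an L^2 function is only integrable, so each coefficient is bounded
  separately, by Cauchy-Schwarz for the product of u - v and u + v. Decay in \<open>k\<close> will
  come from \<open>bbm_symbol\<close>.\<close>

lemma fourier_square_diff:
  assumes "sq_int u" "sq_int v"
  shows "cmod (fourier (\<lambda>x. (u x)\<^sup>2) k - fourier (\<lambda>x. (v x)\<^sup>2) k)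
    \<le> L2_norm (\<lambda>x. u x - v x) * (L2_norm u + L2_norm v) / (2 * pi)"
proof -
  have "fourier (\<lambda>x. (u x)\<^sup>2) k - fourier (\<lambda>x. (v x)\<^sup>2) k = fourier (\<lambda>x. (u x)\<^sup>2 - (v x)\<^sup>2) k"
    using assms by (intro fourier_diff[symmetric]) (auto simp: sq_int_def)
  also have "(\<lambda>x. (u x)\<^sup>2 - (v x)\<^sup>2) = (\<lambda>x. (u x - v x) * (u x + v x))"
    by (auto simp: power2_eq_square algebra_simps)
  finally have "cmod (fourier (\<lambda>x. (u x)\<^sup>2) k - fourier (\<lambda>x. (v x)\<^sup>2) k)
      \<le> L2_norm (\<lambda>x. u x - v x) * L2_norm (\<lambda>x. u x + v x) / (2 * pi)"
    using fourier_mult_bound[OF sq_int_diff[OF assms] sq_int_add[OF assms]] by simp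
  also have "\<dots> \<le> L2_norm (\<lambda>x. u x - v x) * (L2_norm u + L2_norm v) / (2 * pi)"
    by (intro divide_right_mono mult_left_mono L2_norm_triangle assms) auto
  finally show ?thesis .
qed

lemma L2_continuous_fourier_square:
  assumes "L2_continuous u"
  shows "continuous_on UNIV (\<lambda>t. fourier (\<lambda>x. (u t x)\<^sup>2) k)"
  unfolding continuous_on_eq_continuous_within continuous_within
proof
  fix t
  have su: "sq_int (u t)" for t using assms by (auto simp: L2_continuous_def)
  have "((\<lambda>s. L2_norm (u s)) \<longlongrightarrow> L2_norm (u t)) (at t)"
    using L2_continuous_norm[OF assms] by (simp add: continuous_on_eq_continuous_within continuous_within)
  moreover have "((\<lambda>s. L2_norm (\<lambda>x. u s x - u t x)) \<longlongrightarrow> 0) (at t)"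
    using assms by (simp add: L2_continuous_def)
  ultimately have "((\<lambda>s. L2_norm (\<lambda>x. u s x - u t x) * (L2_norm (u s) + L2_norm (u t)) / (2 * pi))
      \<longlongrightarrow> 0 * (L2_norm (u t) + L2_norm (u t)) / (2 * pi)) (at t)"
    by (intro tendsto_intros) auto
  then have *: "((\<lambda>s. L2_norm (\<lambda>x. u s x - u t x) * (L2_norm (u s) + L2_norm (u t)) / (2 * pi)) \<longlongrightarrow> 0) (at t)"
    by simp
  have "((\<lambda>s. fourier (\<lambda>x. (u s x)\<^sup>2) k - fourier (\<lambda>x. (u t x)\<^sup>2) k) \<longlongrightarrow> 0) (at t)"
    by (rule Lim_null_comparison[OF _ *]) (use fourier_square_diff[OF su su] in \<open>auto intro!: always_eventually\<close>)
  then show "((\<lambda>t. fourier (\<lambda>x. (u t x)\<^sup>2) k) \<longlongrightarrow> fourier (\<lambda>x. (u t x)\<^sup>2) k) (at t)"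
    by (rule LIM_zero_cancel)
qed

text \<open>
  Gronwall's inequality in \<open>L\<^sup>2\<close>, using that the multiplier \<open>bbm_symbol\<close> is square summable: the
  maximum \<open>m\<close> of \<open>exp (- L * \<bar>\<tau>\<bar>)\<close> times the distance of the two solutions satisfies
  \<open>m \<le> m / 2\<close> for large \<open>L\<close>.
\<close>

lemma bbm_solution_unique:
  assumes u: "bbm_solution u0 u" and v: "bbm_solution v0 v"
    and eq: "\<And>k. fourier u0 k = fourier v0 k"
  shows "fourier (u t) k = fourier (v t) k"
proof -
  note cu = bbm_solution_L2_continuous[OF u] and cv = bbm_solution_L2_continuous[OF v]
  have su: "sq_int (u t)" and sv: "sq_int (v t)" for t using cu cv by (auto simp: L2_continuous_def)
  define T where "T = \<bar>t\<bar>"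
  have "\<exists>C. \<forall>\<tau>\<in>{-T..T}. L2_norm (u \<tau>) + L2_norm (v \<tau>) \<le> C"
  proof -
    have "continuous_on {-T..T} (\<lambda>\<tau>. L2_norm (u \<tau>) + L2_norm (v \<tau>))"
      by (intro continuous_on_add continuous_on_subset[OF L2_continuous_norm[OF cu]]
          continuous_on_subset[OF L2_continuous_norm[OF cv]]) auto
    then have "compact ((\<lambda>\<tau>. L2_norm (u \<tau>) + L2_norm (v \<tau>)) ` {-T..T})"
      by (intro compact_continuous_image) auto
    from bounded_imp_bdd_above[OF compact_imp_bounded[OF this]]
    show ?thesis by (auto simp: bdd_above_def)
  qed
  then obtain C where C': "\<forall>\<tau>\<in>{-T..T}. L2_norm (u \<tau>) + L2_norm (v \<tau>) \<le> C" by blast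
  have C: "L2_norm (u \<tau>) + L2_norm (v \<tau>) \<le> C" if "\<bar>\<tau>\<bar> \<le> T" for \<tau>
    using C' that by (simp add: abs_le_iff)
  have C0: "0 \<le> C" using C[of 0] L2_norm_nonneg[of "u 0"] L2_norm_nonneg[of "v 0"] unfolding T_def
    by (simp del: L2_norm_nonneg)
  \<comment> \<open>\<open>C / (2 * pi)\<close> comes from \<open>fourier_square_diff\<close>,
    \<open>l2_norm wt_inv\<close> from summing over the modes, and \<open>sqrt (2 * pi)\<close> from
    Parseval.\<close>
  define K where "K = sqrt (2 * pi) * (C / (2 * pi) * l2_norm wt_inv)"
  have K0: "0 \<le> K" unfolding K_def using C0 by simp
  \<comment> \<open>At least \<open>2 * K\<close>, so that \<open>K / L\<close> is at most 1/2; the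
    1 keeps \<open>L\<close> positive.\<close>
  define L where "L = 2 * K + 1"
  have L0: "0 < L" unfolding L_def using K0 by simp
  let ?w = "\<lambda>t x. u t x - v t x"
  let ?g = "\<lambda>\<tau>. L2_norm (?w \<tau>)"
  have "continuous_on {-T..T} (\<lambda>\<tau>. exp (- L * \<bar>\<tau>\<bar>) * ?g \<tau>)"
    by (intro continuous_intros continuous_on_subset[OF L2_continuous_norm[OF L2_continuous_diff[OF cu cv]]]) auto
  then obtain s where s: "s \<in> {-T..T}" and max: "\<And>\<tau>. \<tau> \<in> {-T..T} \<Longrightarrow> exp (- L * \<bar>\<tau>\<bar>) * ?g \<tau> \<le> exp (- L * \<bar>s\<bar>) * ?g s"
    using continuous_attains_sup[of "{-T..T}" "\<lambda>\<tau>. exp (- L * \<bar>\<tau>\<bar>) * ?g \<tau>"] unfolding T_def by auto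
  define m where "m = exp (- L * \<bar>s\<bar>) * ?g s"
  have m0: "0 \<le> m" unfolding m_def by simp
  have gm: "?g \<tau> \<le> m * exp (L * \<bar>\<tau>\<bar>)" if "\<bar>\<tau>\<bar> \<le> T" for \<tau>
  proof -
    have "exp (L * \<bar>\<tau>\<bar>) * exp (- L * \<bar>\<tau>\<bar>) = 1" by (simp flip: exp_add)
    then have "?g \<tau> = (exp (L * \<bar>\<tau>\<bar>) * exp (- L * \<bar>\<tau>\<bar>)) * ?g \<tau>" by (simp only: mult_1)
    also have "\<dots> = exp (L * \<bar>\<tau>\<bar>) * (exp (- L * \<bar>\<tau>\<bar>) * ?g \<tau>)" by (rule mult.assoc)
    also have "\<dots> \<le> exp (L * \<bar>\<tau>\<bar>) * m"
      unfolding m_def using that by (intro mult_left_mono max) auto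
    also have "\<dots> = m * exp (L * \<bar>\<tau>\<bar>)" by (rule mult.commute)
    finally show ?thesis .
  qed
  \<comment> \<open>The linear parts cancel because the data agree. The integral gains
    \<open>1 / L\<close> through the exponential weight, and half the symbol is at most
    \<open>1 / wt k\<close>.\<close>
  have dec: "cmod (fourier (?w r) k) \<le> (C / (2 * pi) * m / L * exp (L * \<bar>r\<bar>)) * cmod (wt_inv k)"
    if r: "\<bar>r\<bar> \<le> T" for r k
  proof -
    let ?h = "\<lambda>u \<tau>. cis (- ((r - \<tau>) * bbm_symbol k)) * (complex_of_real (bbm_symbol k) * fourier (\<lambda>x. (u \<tau> x)\<^sup>2) k)"
    have ch: "continuous_on UNIV (?h u)" if "L2_continuous u" for u
      by (intro continuous_intros L2_continuous_fourier_square that)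
    have ih: "interval_lebesgue_integrable lborel (ereal 0) (ereal r) (?h u)" if "L2_continuous u" for u
      by (rule interval_integrable_isCont) (use ch[OF that] in \<open>simp add: continuous_on_eq_continuous_at\<close>)
    have "fourier (?w r) k = fourier (u r) k - fourier (v r) k"
      by (intro fourier_diff sq_int_integrable su sv)
    also have "\<dots> = - \<i> / 2 * ((LBINT \<tau>=ereal 0..ereal r. ?h u \<tau>) - (LBINT \<tau>=ereal 0..ereal r. ?h v \<tau>))"
    proof -
      have "fourier (u r) k = cis (- (r * bbm_symbol k)) * fourier u0 k - \<i> / 2 * (LBINT \<tau>=ereal 0..ereal r. ?h u \<tau>)"
        using u unfolding bbm_solution_def by blast
      moreover have "fourier (v r) k = cis (- (r * bbm_symbol k)) * fourier v0 k - \<i> / 2 * (LBINT \<tau>=ereal 0..ereal r. ?h v \<tau>)"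
        using v unfolding bbm_solution_def by blast
      ultimately show ?thesis unfolding eq by (simp only:) (simp add: algebra_simps)
    qed
    also have "(LBINT \<tau>=ereal 0..ereal r. ?h u \<tau>) - (LBINT \<tau>=ereal 0..ereal r. ?h v \<tau>)
        = (LBINT \<tau>=ereal 0..ereal r. ?h u \<tau> - ?h v \<tau>)"
      by (rule interval_lebesgue_integral_diff(2)[OF ih[OF cu] ih[OF cv], symmetric])
    finally have "cmod (fourier (?w r) k) = 1 / 2 * cmod (LBINT \<tau>=ereal 0..ereal r. ?h u \<tau> - ?h v \<tau>)"
      by (simp add: norm_mult)
    also have "\<dots> \<le> 1 / 2 * ((\<bar>bbm_symbol k\<bar> * (C / (2 * pi) * m)) / L * exp (L * \<bar>r\<bar>))"
    proof (rule mult_left_mono, rule norm_interval_integral_exp_bound[OF _ L0])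
      show "continuous_on UNIV (\<lambda>\<tau>. ?h u \<tau> - ?h v \<tau>)" by (intro continuous_on_diff ch cu cv)
      fix \<tau> :: real assume "\<bar>\<tau>\<bar> \<le> \<bar>r\<bar>"
      then have \<tau>: "\<bar>\<tau>\<bar> \<le> T" using r by linarith
      have "cmod (fourier (\<lambda>x. (u \<tau> x)\<^sup>2) k - fourier (\<lambda>x. (v \<tau> x)\<^sup>2) k)
          \<le> ?g \<tau> * (L2_norm (u \<tau>) + L2_norm (v \<tau>)) / (2 * pi)"
        by (rule fourier_square_diff[OF su sv])
      also have "\<dots> \<le> (m * exp (L * \<bar>\<tau>\<bar>)) * C / (2 * pi)"
        using m0 by (intro divide_right_mono mult_mono gm C \<tau>) auto
      finally have F: "cmod (fourier (\<lambda>x. (u \<tau> x)\<^sup>2) k - fourier (\<lambda>x. (v \<tau> x)\<^sup>2) k) \<le> C / (2 * pi) * m * exp (L * \<bar>\<tau>\<bar>)"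
        by (simp add: mult_ac)
      have "?h u \<tau> - ?h v \<tau> = cis (- ((r - \<tau>) * bbm_symbol k)) * (complex_of_real (bbm_symbol k)
          * (fourier (\<lambda>x. (u \<tau> x)\<^sup>2) k - fourier (\<lambda>x. (v \<tau> x)\<^sup>2) k))"
        by (simp only: right_diff_distrib)
      then have "cmod (?h u \<tau> - ?h v \<tau>) = \<bar>bbm_symbol k\<bar> * cmod (fourier (\<lambda>x. (u \<tau> x)\<^sup>2) k - fourier (\<lambda>x. (v \<tau> x)\<^sup>2) k)"
        by (simp only: norm_mult norm_cis norm_of_real mult_1)
      also have "\<dots> \<le> \<bar>bbm_symbol k\<bar> * (C / (2 * pi) * m * exp (L * \<bar>\<tau>\<bar>))"
        by (rule mult_left_mono[OF F]) simp
      finally show "cmod (?h u \<tau> - ?h v \<tau>) \<le> \<bar>bbm_symbol k\<bar> * (C / (2 * pi) * m) * exp (L * \<bar>\<tau>\<bar>)"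
        by (simp only: mult.assoc)
    qed (use C0 m0 in auto)
    also have "\<dots> = (C / (2 * pi) * m / L * exp (L * \<bar>r\<bar>)) * (\<bar>bbm_symbol k\<bar> / 2)" by simp
    also have "\<dots> \<le> (C / (2 * pi) * m / L * exp (L * \<bar>r\<bar>)) * cmod (wt_inv k)"
    proof (rule mult_left_mono)
      show "\<bar>bbm_symbol k\<bar> / 2 \<le> cmod (wt_inv k)"
        using bbm_symbol_wt(2)[of k] by (simp add: field_simps)
    qed (use C0 m0 L0 in auto)
    finally show ?thesis .
  qed
  have "?g s \<le> K / L * m * exp (L * \<bar>s\<bar>)"
  proof -
    have "l2_norm (fourier (?w s)) \<le> (C / (2 * pi) * m / L * exp (L * \<bar>s\<bar>)) * l2_norm wt_inv"
      by (rule l2_norm_mono(2)[OF sq_summable_wt_inv _ dec]) (use C0 m0 L0 s in auto)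
    then have "sqrt (2 * pi) * l2_norm (fourier (?w s)) \<le> sqrt (2 * pi) * ((C / (2 * pi) * m / L * exp (L * \<bar>s\<bar>)) * l2_norm wt_inv)"
      by (rule mult_left_mono) simp
    also have "\<dots> = K / L * m * exp (L * \<bar>s\<bar>)" unfolding K_def by simp
    finally show ?thesis unfolding L2_norm_fourier[OF sq_int_diff[OF su sv]] .
  qed
  then have "m \<le> exp (- L * \<bar>s\<bar>) * (K / L * m * exp (L * \<bar>s\<bar>))"
    unfolding m_def by (rule mult_left_mono) simp
  also have "\<dots> = K / L * m * (exp (- L * \<bar>s\<bar>) * exp (L * \<bar>s\<bar>))" by (simp only: mult_ac)
  also have "exp (- L * \<bar>s\<bar>) * exp (L * \<bar>s\<bar>) = 1" by (simp flip: exp_add)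
  also have "K / L * m * 1 \<le> 1 / 2 * m * 1"
  proof (intro mult_right_mono)
    show "K / L \<le> 1 / 2" unfolding L_def using K0 by (simp add: field_simps)
  qed (use m0 in auto)
  finally have "m = 0" using m0 by simp
  then have "fourier (?w t) k = 0" using dec[of t k] unfolding T_def by simp
  moreover have "fourier (?w t) k = fourier (u t) k - fourier (v t) k"
    by (intro fourier_diff sq_int_integrable su sv)
  ultimately show ?thesis by simp
qed

section \<open>Solutions from trigonometric series\<close>

text \<open>\<open>Re\<close> only serves the type: for Hermitian coefficients of sufficient decay
  the sum is real, by \<open>of_real_trig_series\<close>.\<close>

definition trig_series :: "(int \<Rightarrow> complex) \<Rightarrow> real \<Rightarrow> real" where
  "trig_series c x = Re (\<Sum>\<^sub>\<infinity>k. c k * cis (of_int k * x))"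

lemma summable_on_wt_powr_cmult: "s < -1 \<Longrightarrow> (\<lambda>k. C * wt k powr s) summable_on UNIV"
  by (intro summable_on_cmult_right summable_on_wt_powr)

text \<open>The Sobolev weight is at most \<open>wt k\<close> and the square contributes the power
  -7/2; this leaves the summable power -5/2.\<close>

lemma sobolev_weight_bound:
  assumes "cmod z \<le> B * wt k powr (-7/4)"
  shows "(1 + (of_int k)\<^sup>2) powr (1/2) * (cmod z)\<^sup>2 \<le> B\<^sup>2 * wt k powr (-5/2)"
proof -
  have "(1 + (real_of_int k)\<^sup>2) powr (1/2) \<le> ((wt k)\<^sup>2) powr (1/2)"
    by (rule powr_mono2) (auto simp: wt_def power2_sum add_nonneg_nonneg)
  also have "\<dots> = wt k powr 1" by (simp add: powr_powr flip: powr_numeral)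
  finally have 1: "(1 + (real_of_int k)\<^sup>2) powr (1/2) \<le> wt k powr 1" .
  have "(cmod z)\<^sup>2 \<le> (B * wt k powr (-7/4))\<^sup>2" using assms by (intro power_mono) auto
  also have "\<dots> = B\<^sup>2 * (wt k powr (-7/4) * wt k powr (-7/4))" by (simp only: power2_eq_square mult_ac)
  also have "wt k powr (-7/4) * wt k powr (-7/4) = wt k powr (-7/2)" by (subst powr_add[symmetric]) simp
  finally have 2: "(cmod z)\<^sup>2 \<le> B\<^sup>2 * wt k powr (-7/2)" .
  have "(1 + (of_int k)\<^sup>2) powr (1/2) * (cmod z)\<^sup>2 \<le> wt k powr 1 * (B\<^sup>2 * wt k powr (-7/2))"
    by (rule mult_mono[OF 1 2]) auto
  also have "\<dots> = B\<^sup>2 * (wt k powr 1 * wt k powr (-7/2))" by (simp only: mult_ac)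
  also have "wt k powr 1 * wt k powr (-7/2) = wt k powr (-5/2)" by (subst powr_add[symmetric]) simp
  finally show ?thesis .
qed

context
  fixes c :: "int \<Rightarrow> complex" and C :: real
  assumes C: "\<And>k. cmod (c k) \<le> C * wt k powr (-7/4)" and herm: "\<And>k. c (-k) = cnj (c k)"
begin

lemma trig_series_term_bound: "cmod (c k * cis (of_int k * x)) \<le> C * wt k powr (-7/4)"
  using C by (simp add: norm_mult)

lemma of_real_trig_series: "complex_of_real (trig_series c x) = (\<Sum>\<^sub>\<infinity>k. c k * cis (of_int k * x))"
proof -
  have "cnj (\<Sum>\<^sub>\<infinity>k. c k * cis (of_int k * x)) = (\<Sum>\<^sub>\<infinity>k. cnj (c k * cis (of_int k * x)))"
    by (rule infsum_cnj[symmetric])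
  also have "\<dots> = (\<Sum>\<^sub>\<infinity>k. c k * cis (of_int k * x))"
    by (rule infsum_reindex_bij_witness[of _ uminus uminus]) (auto simp: herm cis_cnj)
  finally have "Im (\<Sum>\<^sub>\<infinity>k. c k * cis (of_int k * x)) = 0"
    by (simp add: complex_eq_iff)
  then show ?thesis unfolding trig_series_def by (simp add: complex_eq_iff)
qed

lemma continuous_trig_series: "continuous_on UNIV (trig_series c)"
  unfolding trig_series_def[abs_def]
proof (intro continuous_on_Re, rule continuous_on_infsum)
  show "(\<lambda>k. C * wt k powr (-7/4)) summable_on UNIV" by (rule summable_on_wt_powr_cmult) simp
qed (use trig_series_term_bound in \<open>auto intro!: continuous_intros\<close>)

lemma trig_series_periodic: "trig_series c (x + 2 * pi) = trig_series c x"
proof -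
  have "cis (of_int k * (x + 2 * pi)) = cis (of_int k * x)" for k :: int
    using cis_multiple_2pi[of "of_int k"] by (simp add: distrib_left mult.commute flip: cis_mult)
  then show ?thesis unfolding trig_series_def by simp
qed

lemma sq_int_trig_series: "sq_int (trig_series c)"
  by (rule sq_int_continuous[OF continuous_trig_series])

text \<open>Uniform convergence of the series puts both sides within a common null sequence of the
  same finite sum. Taking \<open>w\<close> to be 1 gives the coefficients of the series, taking it
  to be the series itself those of its square.\<close>

lemma fourier_mult_trig_series:
  assumes w: "sq_int w"
  shows "fourier (\<lambda>x. w x * trig_series c x) k = (\<Sum>\<^sub>\<infinity>j. c j * fourier w (k - j))"
proof -
  let ?g = "\<lambda>k. C * wt k powr (-7/4)"
  have g: "?g summable_on UNIV" by (rule summable_on_wt_powr_cmult) simp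
  define W where "W = (LINT x|circ. \<bar>w x\<bar>) / (2 * pi)"
  have iw: "integrable circ w" by (rule sq_int_integrable[OF w])
  have W0: "0 \<le> W" unfolding W_def by simp
  define \<delta> where "\<delta> N = infsum ?g UNIV - (\<Sum>k\<in>{-int N..int N}. ?g k)" for N
  have \<delta>: "\<delta> \<longlonglongrightarrow> 0" unfolding \<delta>_def by (rule summable_on_int_tail[OF g])
  let ?X = "fourier (\<lambda>x. w x * trig_series c x) k" and ?Y = "\<Sum>\<^sub>\<infinity>j. c j * fourier w (k - j)"
  have 1: "cmod (?X - (\<Sum>j\<in>{-int N..int N}. c j * fourier w (k - j))) \<le> W * \<delta> N" for N
  proof -
    let ?S = "\<lambda>x. \<Sum>j\<in>{-int N..int N}. c j * cis (of_int j * x)"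
    let ?e = "\<lambda>x. cis (- (of_int k * x))"
    have i1: "integrable circ (\<lambda>x. complex_of_real (w x * trig_series c x) * ?e x)"
      by (rule integrable_fourier[OF sq_int_mult[OF w sq_int_trig_series]])
    have i2: "integrable circ (\<lambda>x. c j * (complex_of_real (w x) * cis (- (of_int (k - j) * x))))" for j
      using integrable_fourier[OF iw, of "k - j"] by (rule Bochner_Integration.integrable_mult_right)
    have S: "complex_of_real (w x) * ?S x * ?e x
        = (\<Sum>j\<in>{-int N..int N}. c j * (complex_of_real (w x) * cis (- (of_int (k - j) * x))))" for x
    proof -
      have e: "cis (of_int j * x) * ?e x = cis (- (of_int (k - j) * x))" for j
        unfolding cis_mult by (rule arg_cong[of _ _ cis]) (simp add: algebra_simps)
      have "complex_of_real (w x) * (c j * cis (of_int j * x)) * ?e x = c j * (complex_of_real (w x) * cis (- (of_int (k - j) * x)))" for j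
        unfolding e[symmetric] by simp
      then show ?thesis unfolding sum_distrib_left sum_distrib_right by (simp only:)
    qed
    have "(\<Sum>j\<in>{-int N..int N}. c j * fourier w (k - j))
        = (LINT x|circ. complex_of_real (w x) * ?S x * ?e x) / complex_of_real (2 * pi)"
      unfolding S fourier_circ using i2
      by (simp only: Bochner_Integration.integral_sum integral_mult_right_zero sum_divide_distrib times_divide_eq_right)
    then have "?X - (\<Sum>j\<in>{-int N..int N}. c j * fourier w (k - j))
        = ((LINT x|circ. complex_of_real (w x * trig_series c x) * ?e x) - (LINT x|circ. complex_of_real (w x) * ?S x * ?e x))
          / complex_of_real (2 * pi)"
      unfolding fourier_circ[of "\<lambda>x. w x * trig_series c x"] by (simp only: diff_divide_distrib)
    also have "(LINT x|circ. complex_of_real (w x * trig_series c x) * ?e x) - (LINT x|circ. complex_of_real (w x) * ?S x * ?e x)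
        = (LINT x|circ. complex_of_real (w x * trig_series c x) * ?e x - complex_of_real (w x) * ?S x * ?e x)"
      by (rule Bochner_Integration.integral_diff[symmetric, OF i1])
         (unfold S, intro Bochner_Integration.integrable_sum i2)
    finally have E: "cmod (?X - (\<Sum>j\<in>{-int N..int N}. c j * fourier w (k - j)))
        = cmod (LINT x|circ. complex_of_real (w x * trig_series c x) * ?e x - complex_of_real (w x) * ?S x * ?e x) / (2 * pi)"
      by (simp only: norm_divide norm_of_real) simp
    have "cmod (LINT x|circ. complex_of_real (w x * trig_series c x) * ?e x - complex_of_real (w x) * ?S x * ?e x)
        \<le> (LINT x|circ. \<bar>w x\<bar> * \<delta> N)"
    proof (rule Bochner_Integration.integral_norm_bound_integral)
      show "integrable circ (\<lambda>x. complex_of_real (w x * trig_series c x) * ?e x - complex_of_real (w x) * ?S x * ?e x)"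
        unfolding S by (intro Bochner_Integration.integrable_diff i1 Bochner_Integration.integrable_sum i2)
      show "integrable circ (\<lambda>x. \<bar>w x\<bar> * \<delta> N)" using iw by simp
      fix x
      have "complex_of_real (w x * trig_series c x) * ?e x - complex_of_real (w x) * ?S x * ?e x
          = complex_of_real (w x) * (complex_of_real (trig_series c x) - ?S x) * ?e x"
        by (simp only: of_real_mult left_diff_distrib right_diff_distrib)
      then have "cmod (complex_of_real (w x * trig_series c x) * ?e x - complex_of_real (w x) * ?S x * ?e x)
          = \<bar>w x\<bar> * cmod (complex_of_real (trig_series c x) - ?S x)"
        by (simp only: norm_mult norm_of_real norm_cis mult_1_right)
      also have "\<dots> \<le> \<bar>w x\<bar> * \<delta> N"
        unfolding of_real_trig_series \<delta>_def
        by (intro mult_left_mono infsum_int_tail_le[OF g trig_series_term_bound]) auto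
      finally show "cmod (complex_of_real (w x * trig_series c x) * ?e x - complex_of_real (w x) * ?S x * ?e x) \<le> \<bar>w x\<bar> * \<delta> N" .
    qed
    also have "\<dots> = W * \<delta> N * (2 * pi)" unfolding W_def by simp
    finally show ?thesis unfolding E by (simp add: divide_le_eq)
  qed
  have 2: "cmod (?Y - (\<Sum>j\<in>{-int N..int N}. c j * fourier w (k - j))) \<le> W * \<delta> N" for N
  proof -
    have "cmod (c j * fourier w (k - j)) \<le> W * ?g j" for j
      using mult_mono[OF C fourier_bound[OF iw], of j "k - j"] order_trans[OF norm_ge_zero C]
      unfolding W_def norm_mult by (simp add: mult.commute)
    then have "cmod (?Y - (\<Sum>j\<in>{-int N..int N}. c j * fourier w (k - j)))
        \<le> infsum (\<lambda>j. W * ?g j) UNIV - (\<Sum>j\<in>{-int N..int N}. W * ?g j)"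
      by (intro infsum_int_tail_le summable_on_cmult_right g) auto
    then show ?thesis unfolding \<delta>_def infsum_cmult_right' sum_distrib_left[symmetric] right_diff_distrib[symmetric] .
  qed
  have bd: "cmod (?X - ?Y) \<le> 2 * (W * \<delta> N)" for N
  proof -
    let ?Z = "\<Sum>j\<in>{-int N..int N}. c j * fourier w (k - j)"
    have "cmod (?X - ?Y) = cmod ((?X - ?Z) - (?Y - ?Z))" by simp
    also have "\<dots> \<le> cmod (?X - ?Z) + cmod (?Y - ?Z)" by (rule norm_triangle_ineq4)
    finally show ?thesis using 1[of N] 2[of N] by linarith
  qed
  have lim: "(\<lambda>N. 2 * (W * \<delta> N)) \<longlonglongrightarrow> 2 * (W * 0)" by (intro tendsto_intros \<delta>)
  have "cmod (?X - ?Y) \<le> 2 * (W * 0)"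
    by (rule LIMSEQ_le_const[OF lim]) (use bd in blast)
  then show ?thesis by simp
qed

lemma fourier_trig_series: "fourier (trig_series c) k = c k"
proof -
  have one: "fourier (\<lambda>_. 1) m = (if m = 0 then 1 else 0)" for m
    using cis_orthogonal[of "-m"] by (simp add: fourier_circ)
  have "fourier (trig_series c) k = (\<Sum>\<^sub>\<infinity>j. c j * fourier (\<lambda>_. 1) (k - j))"
    using fourier_mult_trig_series[OF sq_int_const[of 1], of k] by simp
  also have "\<dots> = (\<Sum>\<^sub>\<infinity>j\<in>{k}. c j * fourier (\<lambda>_. 1) (k - j))"
    by (rule infsum_cong_neutral) (auto simp: one)
  finally show ?thesis by (simp add: one)
qed

lemma fourier_trig_series_square: "fourier (\<lambda>x. (trig_series c x)\<^sup>2) k = conv c c k"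
  using fourier_mult_trig_series[OF sq_int_trig_series, of k]
  by (simp add: power2_eq_square fourier_trig_series conv_def)

lemma trig_series_sobolev: "trig_series c \<in> sobolev (1/2)"
proof -
  have "(\<lambda>k::int. (1 + (of_int k)\<^sup>2) powr (1/2) * (cmod (c k))\<^sup>2) summable_on UNIV"
    by (rule summable_on_comparison_test[OF summable_on_wt_powr_cmult[of "-5/2" "C\<^sup>2"]])
       (use sobolev_weight_bound[OF C] in auto)
  then show ?thesis
    unfolding sobolev_def L2_torus_iff
    using sq_int_trig_series trig_series_periodic by (simp add: fourier_trig_series)
qed

end

text \<open>The integrating factor \<open>cis (\<tau> * bbm_symbol k)\<close> removes the linear
  term, and integration gives Duhamel's formula. The Lipschitz bound in time gives continuity into
  H^{1/2}.\<close>

lemma trig_series_bbm_solution: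
  assumes C: "0 \<le> C" "\<And>t. 0 \<le> V t"
    and d: "\<And>t k. ((\<lambda>t. b t k) has_vector_derivative
        - \<i> * of_real (bbm_symbol k) * (b t k + 1 / 2 * conv (b t) (b t) k)) (at t)"
    and h: "\<And>t k. b t (-k) = cnj (b t k)"
    and dec: "\<And>t k. cmod (b t k) \<le> V t * wt k powr (-7/4)" and V: "\<And>T t. \<bar>t\<bar> \<le> T \<Longrightarrow> V t \<le> V' T"
    and lip: "\<And>s t k. cmod (b t k - b s k) \<le> C * \<bar>t - s\<bar> * wt k powr (-7/4)"
  shows "bbm_solution (trig_series (b 0)) (\<lambda>t. trig_series (b t))"
  unfolding bbm_solution_def
proof (intro conjI allI)
  note F = fourier_trig_series[OF dec h] and F2 = fourier_trig_series_square[OF dec h]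
  show "trig_series (b t) \<in> sobolev (1/2)" for t by (rule trig_series_sobolev[OF dec h])
  show "((\<lambda>s. sobolev_norm (1/2) (\<lambda>x. trig_series (b s) x - trig_series (b t) x)) \<longlongrightarrow> 0) (at t)" for t
  proof -
    let ?K = "\<Sum>\<^sub>\<infinity>k. wt k powr (-5/2)"
    have bound: "sobolev_norm (1/2) (\<lambda>x. trig_series (b s) x - trig_series (b t) x) \<le> C * \<bar>s - t\<bar> * sqrt ?K" for s
    proof -
      have e: "fourier (\<lambda>x. trig_series (b s) x - trig_series (b t) x) k = b s k - b t k" for k
        by (subst fourier_diff) (auto intro!: sq_int_integrable sq_int_trig_series[OF dec h] simp: F)
      let ?f = "\<lambda>k::int. (1 + (of_int k)\<^sup>2) powr (1/2) * (cmod (b s k - b t k))\<^sup>2"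
      have le: "?f k \<le> (C * \<bar>s - t\<bar>)\<^sup>2 * wt k powr (-5/2)" for k
        by (rule sobolev_weight_bound[OF lip])
      have g: "(\<lambda>k. (C * \<bar>s - t\<bar>)\<^sup>2 * wt k powr (-5/2)) summable_on UNIV"
        by (rule summable_on_wt_powr_cmult) simp
      have "infsum ?f UNIV \<le> (\<Sum>\<^sub>\<infinity>k. (C * \<bar>s - t\<bar>)\<^sup>2 * wt k powr (-5/2))"
        by (intro infsum_mono g le summable_on_comparison_test[OF g]) auto
      also have "\<dots> = (C * \<bar>s - t\<bar>)\<^sup>2 * ?K" by (rule infsum_cmult_right')
      finally have "sqrt (infsum ?f UNIV) \<le> sqrt ((C * \<bar>s - t\<bar>)\<^sup>2 * ?K)" by (rule real_sqrt_le_mono)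
      also have "\<dots> = C * \<bar>s - t\<bar> * sqrt ?K" using C(1) by (simp add: real_sqrt_mult)
      finally show ?thesis unfolding sobolev_normI[OF e] .
    qed
    have "((\<lambda>s. C * \<bar>s - t\<bar> * sqrt ?K) \<longlongrightarrow> C * \<bar>t - t\<bar> * sqrt ?K) (at t)"
      by (intro tendsto_intros)
    then have *: "((\<lambda>s. C * \<bar>s - t\<bar> * sqrt ?K) \<longlongrightarrow> 0) (at t)" by simp
    have "0 \<le> sobolev_norm (1/2) w" for w unfolding sobolev_norm_def by (simp add: infsum_nonneg)
    then show ?thesis
      by (intro Lim_null_comparison[OF _ *] always_eventually allI) (use bound in simp)
  qed
  fix t k
  let ?\<phi> = "bbm_symbol k"
  let ?n = "\<lambda>\<tau>. conv (b \<tau>) (b \<tau>) k"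
  have bc: "continuous_on UNIV (\<lambda>t. b t k)" for k
    unfolding continuous_on_eq_continuous_within using has_vector_derivative_continuous[OF d] by blast
  have nc: "continuous_on UNIV ?n"
  \<comment> \<open>The cutoff radius 1 is a dummy, since this claim concerns \<open>conv\<close>
    alone.\<close>
  proof (rule cut_field_continuous(2)[of 1, OF _ bc])
    fix T :: real assume "0 < T"
    then have "0 \<le> V' T" using V[of 0 T] C(2)[of 0] by simp
    moreover have "cmod (b t k) \<le> V' T / wt k" if "\<bar>t\<bar> \<le> T" for t k
    proof -
      have "V t * wt k powr (-7/4) \<le> V' T * (1 / wt k)"
        using V[OF that] C(2) \<open>0 \<le> V' T\<close> wt_powr_le_inverse[of "-7/4" k] by (intro mult_mono) auto
      with dec[of t k] show ?thesis by simp
    qed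
    ultimately show "\<exists>B\<ge>0. \<forall>t k. \<bar>t\<bar> \<le> T \<longrightarrow> cmod (b t k) \<le> B / wt k" by blast
  qed simp
  have fd: "((\<lambda>\<tau>. cis (\<tau> * ?\<phi>) * b \<tau> k) has_vector_derivative cis (\<tau> * ?\<phi>) * (- \<i> / 2 * (of_real ?\<phi> * ?n \<tau>))) (at \<tau>)" for \<tau>
  proof -
    have "((\<lambda>\<tau>. cis (\<tau> * ?\<phi>)) has_vector_derivative (?\<phi> *\<^sub>R (\<i> * cis (\<tau> * ?\<phi>)))) (at \<tau>)"
      using has_derivative_cis[OF has_derivative_mult_left[OF has_derivative_ident], of ?\<phi> \<tau> UNIV]
      unfolding has_vector_derivative_def scaleR_scaleR .
    from has_vector_derivative_mult[OF this d[of k \<tau>]]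
    show ?thesis by (rule has_vector_derivative_eq_rhs) (simp add: scaleR_conv_of_real algebra_simps)
  qed
  have "(LBINT \<tau>=ereal 0..ereal t. cis (\<tau> * ?\<phi>) * (- \<i> / 2 * (of_real ?\<phi> * ?n \<tau>)))
      = cis (t * ?\<phi>) * b t k - cis (0 * ?\<phi>) * b 0 k"
  proof (rule interval_integral_FTC_finite[where F="\<lambda>\<tau>. cis (\<tau> * ?\<phi>) * b \<tau> k"])
    have "continuous_on UNIV (\<lambda>\<tau>. cis (\<tau> * ?\<phi>) * (- \<i> / 2 * (of_real ?\<phi> * ?n \<tau>)))"
      by (intro continuous_intros nc)
    then show "continuous_on {min 0 t..max 0 t} (\<lambda>\<tau>. cis (\<tau> * ?\<phi>) * (- \<i> / 2 * (of_real ?\<phi> * ?n \<tau>)))"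
      using continuous_on_subset by blast
  qed (rule has_vector_derivative_at_within[OF fd])
  then have I: "cis (t * ?\<phi>) * b t k = b 0 k + (LBINT \<tau>=ereal 0..ereal t. cis (\<tau> * ?\<phi>) * (- \<i> / 2 * (of_real ?\<phi> * ?n \<tau>)))"
    by simp
  have c1: "cis (- (t * ?\<phi>)) * cis (t * ?\<phi>) = 1" by (simp add: cis_mult)
  have "b t k = cis (- (t * ?\<phi>)) * (cis (t * ?\<phi>) * b t k)"
    unfolding mult.assoc[symmetric] c1 by simp
  also have "\<dots> = cis (- (t * ?\<phi>)) * b 0 k
      + cis (- (t * ?\<phi>)) * (LBINT \<tau>=ereal 0..ereal t. cis (\<tau> * ?\<phi>) * (- \<i> / 2 * (of_real ?\<phi> * ?n \<tau>)))"
    unfolding I by (rule distrib_left)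
  also have "cis (- (t * ?\<phi>)) * (LBINT \<tau>=ereal 0..ereal t. cis (\<tau> * ?\<phi>) * (- \<i> / 2 * (of_real ?\<phi> * ?n \<tau>)))
      = (LBINT \<tau>=ereal 0..ereal t. cis (- (t * ?\<phi>)) * (cis (\<tau> * ?\<phi>) * (- \<i> / 2 * (of_real ?\<phi> * ?n \<tau>))))"
    by (rule interval_lebesgue_integral_mult_right[symmetric])
  also have "\<dots> = (LBINT \<tau>=ereal 0..ereal t. (- \<i> / 2) * (cis (- ((t - \<tau>) * ?\<phi>)) * (of_real ?\<phi> * ?n \<tau>)))"
  proof -
    have "cis (- ((t - \<tau>) * ?\<phi>)) = cis (- (t * ?\<phi>)) * cis (\<tau> * ?\<phi>)" for \<tau>
      unfolding cis_mult by (rule arg_cong[of _ _ cis]) (simp add: algebra_simps)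
    then show ?thesis by (simp only: mult_ac)
  qed
  also have "\<dots> = (- \<i> / 2) * (LBINT \<tau>=ereal 0..ereal t. cis (- ((t - \<tau>) * ?\<phi>)) * (of_real ?\<phi> * ?n \<tau>))"
    by (rule interval_lebesgue_integral_mult_right)
  finally show "fourier (trig_series (b t)) k = cis (- (t * ?\<phi>)) * fourier (trig_series (b 0)) k
      - \<i> / 2 * (LBINT \<tau>=ereal 0..ereal t. cis (- ((t - \<tau>) * ?\<phi>)) * (of_real ?\<phi> * fourier (\<lambda>x. (trig_series (b \<tau>) x)\<^sup>2) k))"
    unfolding F F2 by simp
qed

section \<open>Backward evolution of a single mode\<close>

lemma trig_series_H_half_0:
  assumes dec: "\<And>k. cmod (c k) \<le> C * wt k powr (-7/4)" and h: "\<And>k. c (-k) = cnj (c k)" and c0: "c 0 = 0"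
  shows "trig_series c \<in> H_half_0"
proof -
  have "fourier (trig_series c) 0 = 0" using fourier_trig_series[OF dec h] c0 by simp
  then have "(LINT x|circ. complex_of_real (trig_series c x)) = 0"
    unfolding fourier_circ by simp
  then have "(LINT x|circ. trig_series c x) = 0" unfolding integral_complex_of_real by simp
  then show ?thesis unfolding H_half_0_def set_integral_circ using trig_series_sobolev[OF dec h] by simp
qed

lemma energy_symmetric:
  assumes h: "\<And>k. c (-k) = cnj (c k)"
  shows "energy c (int ` {1..N} \<union> (\<lambda>n. - int n) ` {1..N})
    = 2 * (\<Sum>n=1..N. ((real n)\<^sup>2 + 1) * (cmod (c (int n)))\<^sup>2)"
proof -
  have p: "energy c (int ` {1..N}) = (\<Sum>n=1..N. ((real n)\<^sup>2 + 1) * (cmod (c (int n)))\<^sup>2)"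
    unfolding energy_def by (subst sum.reindex) (auto simp: inj_on_def add.commute)
  have m: "energy c ((\<lambda>n. - int n) ` {1..N}) = (\<Sum>n=1..N. ((real n)\<^sup>2 + 1) * (cmod (c (int n)))\<^sup>2)"
    unfolding energy_def by (subst sum.reindex) (auto simp: inj_on_def add.commute h)
  have "energy c (int ` {1..N} \<union> (\<lambda>n. - int n) ` {1..N}) = energy c (int ` {1..N}) + energy c ((\<lambda>n. - int n) ` {1..N})"
    unfolding energy_def by (rule sum.union_disjoint) auto
  then show ?thesis unfolding p m by simp
qed

text \<open>Positive modes in the support satisfy \<open>n \<ge> n0\<close>, so \<open>1 / n\<close>
  is at most \<open>1 / n0\<close>. The energy counts both \<open>n\<close> and \<open>- n\<close>,
  which turns \<open>4 * pi\<close> into \<open>2 * pi\<close>. Mode 0 has its own hypothesis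
  because \<open>n0\<close> divides 0.\<close>

lemma H_norm_trig_series_le:
  assumes dec: "\<And>k. cmod (c k) \<le> C * wt k powr (-7/4)" and h: "\<And>k. c (-k) = cnj (c k)"
    and n0: "1 \<le> n0" and supp: "\<And>k. \<not> int n0 dvd k \<Longrightarrow> c k = 0" and c0: "c 0 = 0"
    and E: "\<And>F. finite F \<Longrightarrow> energy c F \<le> E" and S: "0 \<le> S" "2 * pi * E / real n0 \<le> S\<^sup>2"
  shows "H_norm (trig_series c) \<le> S"
proof (rule H_norm_le[OF trig_series_H_half_0[OF dec h c0] S(1)])
  fix N
  have "(\<Sum>n=1..N. 4 * pi * ((real n)\<^sup>2 + 1) / real n * (cmod (fourier (trig_series c) (int n)))\<^sup>2)
      \<le> (\<Sum>n=1..N. 4 * pi / real n0 * (((real n)\<^sup>2 + 1) * (cmod (c (int n)))\<^sup>2))"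
  proof (rule sum_mono)
    fix n assume n: "n \<in> {1..N}"
    show "4 * pi * ((real n)\<^sup>2 + 1) / real n * (cmod (fourier (trig_series c) (int n)))\<^sup>2
        \<le> 4 * pi / real n0 * (((real n)\<^sup>2 + 1) * (cmod (c (int n)))\<^sup>2)"
    proof (cases "n0 dvd n")
      case True
      then have "n0 \<le> n" using n by (auto intro: dvd_imp_le)
      then have "1 / real n \<le> 1 / real n0" using n0 by (intro divide_left_mono) auto
      then have "4 * pi * (((real n)\<^sup>2 + 1) * (cmod (c (int n)))\<^sup>2) * (1 / real n)
          \<le> 4 * pi * (((real n)\<^sup>2 + 1) * (cmod (c (int n)))\<^sup>2) * (1 / real n0)"
        by (intro mult_left_mono) auto
      then show ?thesis unfolding fourier_trig_series[OF dec h] by simp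
    next
      case False
      then have "c (int n) = 0" by (intro supp) simp
      then show ?thesis unfolding fourier_trig_series[OF dec h] by simp
    qed
  qed
  also have "\<dots> = 4 * pi / real n0 * (\<Sum>n=1..N. ((real n)\<^sup>2 + 1) * (cmod (c (int n)))\<^sup>2)"
    by (simp only: sum_distrib_left)
  also have "(\<Sum>n=1..N. ((real n)\<^sup>2 + 1) * (cmod (c (int n)))\<^sup>2) \<le> E / 2"
    using E[of "int ` {1..N} \<union> (\<lambda>n. - int n) ` {1..N}"] unfolding energy_symmetric[of c, OF h] by simp
  then have "4 * pi / real n0 * (\<Sum>n=1..N. ((real n)\<^sup>2 + 1) * (cmod (c (int n)))\<^sup>2) \<le> 4 * pi / real n0 * (E / 2)"
    by (rule mult_left_mono) simp
  also have "\<dots> \<le> S\<^sup>2" using S(2) by (simp add: mult_ac)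
  finally show "(\<Sum>n=1..N. 4 * pi * ((real n)\<^sup>2 + 1) / real n * (cmod (fourier (trig_series c) (int n)))\<^sup>2) \<le> S\<^sup>2" .
qed

lemma bbm_flow_reaches_mode:
  fixes n0 :: nat
  assumes n0: "1 \<le> n0" and S: "0 \<le> S"
  obtains u0 where "u0 \<in> H_half_0" "H_norm u0 \<le> S"
    "4 * pi * ((real n0)\<^sup>2 + 1) / real n0 * (cmod (fourier (bbm_flow t u0) (int n0)))\<^sup>2 = S\<^sup>2"
proof -
  \<comment> \<open>The coefficient at \<open>n0\<close> and \<open>- n0\<close> of the pure mode
    with \<open>p n0 = S\<close> and \<open>q n0 = 0\<close>, whose norm is
    \<open>S\<close>.\<close>
  define z where "z = S * basis_coeff n0 / 2"
  have z0: "0 \<le> z" unfolding z_def using S basis_coeff_pos[OF n0] by simp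
  have zS: "4 * pi * ((real n0)\<^sup>2 + 1) / real n0 * z\<^sup>2 = S\<^sup>2"
  proof -
    have "4 * pi * Y / n * (S\<^sup>2 * (n / (pi * Y)) / 4) = S\<^sup>2" if "0 < Y" "0 < n" for Y n :: real
      using that by simp
    from this[of "(real n0)\<^sup>2 + 1" "real n0"] show ?thesis
      unfolding z_def using n0 by (simp add: power_divide power_mult_distrib basis_coeff_sq add_nonneg_pos)
  qed
  define v :: "int \<Rightarrow> complex" where "v k = (if \<bar>k\<bar> = int n0 then of_real z else 0)" for k
  \<comment> \<open>Makes the decay bound an equality at the modes \<open>n0\<close> and
    \<open>- n0\<close>.\<close>
  define V where "V = z * wt (int n0) powr (7/4)"
  \<comment> \<open>The energy of the two modes; \<open>2 * pi * E / real n0\<close> is then exactly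
    \<open>S\<^sup>2\<close>.\<close>
  define E where "E = 2 * ((1 + (real n0)\<^sup>2) * z\<^sup>2)"
  have V0: "0 \<le> V" unfolding V_def using z0 by simp
  have vV: "cmod (v k) \<le> V * wt k powr (-7/4)" for k
  proof (cases "\<bar>k\<bar> = int n0")
    case True
    then have "wt k = wt (int n0)" unfolding wt_def by (metis of_int_abs abs_of_nat of_int_of_nat_eq)
    then have "V * wt k powr (-7/4) = z * (wt k powr (7/4) * wt k powr (-7/4))" unfolding V_def by simp
    also have "wt k powr (7/4) * wt k powr (-7/4) = 1" by (subst powr_add[symmetric]) simp
    finally show ?thesis using True z0 by (simp add: v_def)
  next
    case False
    then show ?thesis using V0 by (simp add: v_def)
  qed
  have vE: "energy v F \<le> E" if "finite F" for F
  proof -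
    have "energy v F \<le> energy v (F \<union> {int n0, - int n0})" using that by (intro energy_mono) auto
    also have "\<dots> = energy v {int n0, - int n0}"
      unfolding energy_def by (rule sum.mono_neutral_right) (use that in \<open>auto simp: v_def\<close>)
    also have "\<dots> = E" unfolding energy_def E_def using n0 by (auto simp: v_def)
    finally show ?thesis .
  qed
  have vh: "v (-k) = cnj (v k)" for k by (simp add: v_def)
  have vs: "v k = 0" if "\<not> int n0 dvd k" for k
  proof -
    have "\<bar>k\<bar> \<noteq> int n0" using that by (metis dvd_abs_iff dvd_refl)
    then show ?thesis by (simp add: v_def)
  qed
  obtain a C where C: "0 \<le> C" and a0: "a 0 = v"
    and d: "\<And>t k. ((\<lambda>t. a t k) has_vector_derivative
        - \<i> * of_real (bbm_symbol k) * (a t k + 1 / 2 * conv (a t) (a t) k)) (at t)"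
    and h: "\<And>t k. a t (-k) = cnj (a t k)" and s: "\<And>t k. \<not> int n0 dvd k \<Longrightarrow> a t k = 0"
    and e: "\<And>t F. finite F \<Longrightarrow> energy (a t) F \<le> E"
    and dec: "\<And>t k. cmod (a t k) \<le> (V + C * \<bar>t\<bar>) * wt k powr (-7/4)"
    and lip: "\<And>s t k. cmod (a t k - a s k) \<le> C * \<bar>t - s\<bar> * wt k powr (-7/4)"
    by (rule bbm_coefficients_exist[where v=v and m="int n0", OF V0 vV vE vh vs]) (assumption | rule that)+
  \<comment> \<open>The mean is conserved because \<open>bbm_symbol 0 = 0\<close>; the support
    property gives nothing here, as \<open>n0\<close> divides 0.\<close>
  have m0: "a r 0 = 0" for r
  proof -
    have "cmod (a r 0 - a 0 0) \<le> 0 * \<bar>r - 0\<bar>"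
      by (rule vector_derivative_increment_bound[OF d, where T="\<bar>r\<bar>"]) (auto simp: bbm_symbol_def)
    then show ?thesis using n0 by (simp add: a0 v_def)
  qed
  \<comment> \<open>The equation is autonomous, so a time shift of a solution is a solution. This
    one starts from \<open>a (- t)\<close> and passes through \<open>v\<close> at time
    \<open>t\<close>.\<close>
  define b where "b r = a (r - t)" for r
  have "bbm_solution (trig_series (b 0)) (\<lambda>r. trig_series (b r))"
  proof (rule trig_series_bbm_solution[where V="\<lambda>r. V + C * \<bar>r - t\<bar>" and V'="\<lambda>T. V + C * (T + \<bar>t\<bar>)" and C=C])
    show "0 \<le> C" by (rule C)
    show "0 \<le> V + C * \<bar>r - t\<bar>" for r using V0 C by simp
    show "((\<lambda>r. b r k) has_vector_derivative
        - \<i> * of_real (bbm_symbol k) * (b r k + 1 / 2 * conv (b r) (b r) k)) (at r)" for r k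
    proof -
      have "((\<lambda>r. r - t) has_vector_derivative 1) (at r)" by (auto intro!: derivative_eq_intros)
      from vector_diff_chain_at[OF this d[of k "r - t"]] show ?thesis
        unfolding b_def o_def by simp
    qed
    show "b r (-k) = cnj (b r k)" for r k unfolding b_def by (rule h)
    show "cmod (b r k) \<le> (V + C * \<bar>r - t\<bar>) * wt k powr (-7/4)" for r k unfolding b_def by (rule dec)
    show "V + C * \<bar>r - t\<bar> \<le> V + C * (T + \<bar>t\<bar>)" if "\<bar>r\<bar> \<le> T" for r T
      using that C by (intro add_left_mono mult_left_mono) auto
    show "cmod (b r k - b s k) \<le> C * \<bar>r - s\<bar> * wt k powr (-7/4)" for r s k
      using lip[of "r - t" k "s - t"] unfolding b_def by simp
  qed
  then have sol: "bbm_solution (trig_series (b 0)) (\<lambda>r. trig_series (b r))" .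
  \<comment> \<open>The exhibited solution is the witness that makes the choice in
    \<open>bbm_flow\<close> a solution; uniqueness then fixes its coefficients, whichever solution
    was chosen.\<close>
  then have "bbm_solution (trig_series (b 0)) (SOME u. bbm_solution (trig_series (b 0)) u)" by (rule someI[of "bbm_solution (trig_series (b 0))"])
  then have "fourier (bbm_flow t (trig_series (b 0))) (int n0) = fourier (trig_series (b t)) (int n0)"
    unfolding bbm_flow_def by (rule bbm_solution_unique[OF _ sol]) simp
  also have "\<dots> = v (int n0)"
    unfolding b_def fourier_trig_series[OF dec h] by (simp add: a0)
  also have "\<dots> = of_real z" by (simp add: v_def)
  finally have F: "fourier (bbm_flow t (trig_series (b 0))) (int n0) = of_real z" .
  show thesis
  proof (rule that[of "trig_series (b 0)"])
    show "trig_series (b 0) \<in> H_half_0"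
      unfolding b_def by (rule trig_series_H_half_0[OF dec h m0])
    have "2 * pi * E / real n0 = S\<^sup>2" unfolding E_def zS[symmetric] by simp
    then show "H_norm (trig_series (b 0)) \<le> S"
      unfolding b_def by (intro H_norm_trig_series_le[OF dec h n0 s m0 e S]) auto
    show "4 * pi * ((real n0)\<^sup>2 + 1) / real n0 * (cmod (fourier (bbm_flow t (trig_series (b 0))) (int n0)))\<^sup>2 = S\<^sup>2"
      unfolding F using zS by simp
  qed
qed

theorem theorem1p1:
  fixes t r R :: real and n0 :: nat
  assumes "r > 0" and "R > 0" and "n0 \<ge> 1"
    and "bbm_flow t ` H_ball r \<subseteq> H_cylinder R n0"
  shows "r \<le> R"
proof (rule ccontr)
  assume "\<not> r \<le> R"
  obtain u0 where u0: "u0 \<in> H_half_0" "H_norm u0 \<le> R"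
    and eq: "4 * pi * ((real n0)\<^sup>2 + 1) / real n0 * (cmod (fourier (bbm_flow t u0) (int n0)))\<^sup>2 = R\<^sup>2"
    using bbm_flow_reaches_mode[of n0 R t] assms by auto
  with \<open>\<not> r \<le> R\<close> have "u0 \<in> H_ball r" unfolding H_ball_def by simp
  with assms(4) have "bbm_flow t u0 \<in> H_cylinder R n0" by blast
  from H_cylinder_fourier[OF this assms(3)] eq show False by simp
qed

end
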